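(* Let $\Gamma$ be a triangle (three nodes, each pair joined by one edge). Then there are two inequivalent ways to colour $\Gamma$ (namely all three edges of distinct colours, or all three edges of the same colour; a colouring with exactly two edges of the same colour yields multiplicative quiver varieties isomorphic to those for three distinct colours), and the resulting multiplicative quiver varieties are not isomorphic in general: for example they are not isomorphic as algebraic varieties if $d=(1,1,1)$ and $q\in(\mathbb C^* )^3$ is generic.
   Context: Graphs. $\Gamma$ is a finite graph with node set $I$, each edge joining two distinct nodes. For a finite dimensional $I$-graded complex vector space $V=\bigoplus_{i\in I}V_i$, $\mathrm{Rep}(\Gamma,V)=\bigoplus_a\mathrm{Hom}(V_{t(a)},V_{h(a)})$, the sum being over all oriented edges $a$ (each edge with both orientations). $H=\prod_{i\in I}\mathrm{GL}(V_i)$ acts naturally. A graph is complete $k$-partite if its nodes are partitioned into $k$ nonempty parts, two nodes being joined by a single edge if they lie in different parts and not joined otherwise. An ordering of it is a total ordering of the parts and of the nodes of each part; this induces a total order on its nodes (nodes of earlier parts being smaller). Colourings. A coloured graph is a graph $\Gamma$ with a map from its edges to a finite set $C$ of colours, such that each monochromatic subgraph $\Gamma_c$ (with node set $I_c$) is an embedded complete $k$-partite graph ($k$ depending on $c$). (The triangle is the complete tripartite graph with parts of size one; two of its edges form a complete bipartite graph with parts of sizes one and two.) Choose an ordering of each $\Gamma_c$ and a total ordering of $C$ at each node (up to isomorphism the varieties below do not depend on these choices). Invertible representations. Given $\rho\in\mathrm{Rep}(\Gamma,V)$ and $c\in C$, put $V_c=\bigoplus_{i\in I_c}V_i$, let $v_{ij}:V_j\to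 V_i$ be the maps of $\rho$ along the edges of $\Gamma_c$ ($v_{ij}=0$ if $i,j\in I_c$ are in the same part), and $v_{c+}=1+\sum_{i<j}v_{ij}$, $v_{c-}=1+\sum_{i>j}v_{ij}\in\mathrm{GL}(V_c)$. $\mathrm{Rep}^*(\Gamma,V)$ is the open affine subset of $\rho$ such that for every $c$ there is a (unique) factorisation $v_{c-}v_{c+}=w_{c+}g_cw_{c-}$ with $g_c=(g_{ci})\in\prod_{i\in I_c}\mathrm{GL}(V_i)$, $w_{c+}=1+\sum_{i<j}w_{ij}$, $w_{c-}=1+\sum_{i>j}w_{ij}$, $w_{ij}\in\mathrm{Hom}(V_j,V_i)$. The moment map $\mu:\mathrm{Rep}^*(\Gamma,V)\to H$ has components $\mu_i=g_{c_1i}\cdots g_{c_pi}$, where $c_1<\dots<c_p$ are the colours $c$ with $i\in I_c$ in the chosen order at $i$. Multiplicative quiver variety. For $d\in\mathbb Z_{\ge0}^I$, $q\in(\mathbb C^* )^I$ with $q^d:=\prod_iq_i^{d_i}=1$, take $V_i=\mathbb C^{d_i}$, identify $q$ with $(q_i\mathrm{Id}_{V_i})\in H$, and let $\mathcal M(\Gamma,q,d)=\mu^{-1}(q)/H$ (affine geometric invariant theory quotient). Genericity: for given $d$, $q$ (with $q^d=1$) is generic if $q^\alpha\ne1$ for all $\alpha\in\mathbb Z^I\setminus\{0,d\}$ with $0\le\alpha_i\le d_i$ for all $i$ and $(\alpha,\alpha)\le2$, where $(\varepsilon_i,\varepsilon_j)=2\delta_{ij}-A_{ij}$ with $A_{ij}$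 the number of edges joining $i,j$. Two colourings are considered equivalent if one is obtained from the other by relabelling colours and by the recolouring operation (giving distinct new colours to all edges of a star-shaped monochromatic subgraph) or its inverse. *)

theory Defs
  imports
    "HOL-Library.Disjoint_Sets"
    "HOL-Library.FuncSet"
    "Jordan_Normal_Form.Gauss_Jordan_Elimination"
begin

section \<open>Graphs and colourings\<close>

record ('v, 'e) graph =
  nodes :: "'v set"
  edges :: "'e set"
  ends :: "'e \<Rightarrow> 'v set"

definition fin_graph :: "('v, 'e) graph \<Rightarrow> bool" where
  "fin_graph G \<longleftrightarrow> finite (nodes G) \<and> finite (edges G) \<and>
     (\<forall>e\<in>edges G. ends G e \<subseteq> nodes G \<and> card (ends G e) = 2)"

definition num_edges :: "('v, 'e) graph \<Rightarrow> 'v \<Rightarrow> 'v \<Rightarrow> nat" where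
  "num_edges G i j = card {e \<in> edges G. ends G e = {i, j}}"

definition triangle :: "('v, 'e) graph \<Rightarrow> bool" where
  "triangle G \<longleftrightarrow> fin_graph G \<and> card (nodes G) = 3 \<and>
     (\<forall>i\<in>nodes G. \<forall>j\<in>nodes G. i \<noteq> j \<longrightarrow> num_edges G i j = 1)"

definition complete_multipartite :: "('v, 'e) graph \<Rightarrow> 'v set set \<Rightarrow> bool" where
  "complete_multipartite G P \<longleftrightarrow> partition_on (nodes G) P \<and>
     (\<forall>i\<in>nodes G. \<forall>j\<in>nodes G.
        num_edges G i j = (if \<exists>p\<in>P. i \<in> p \<and> j \<in> p then 0 else 1))"

text \<open>An ordering of a complete \<open>k\<close>-partite graph is the list of its parts, each given as the
  list of its nodes; the induced order on the nodes is that of the concatenated list.\<close>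

definition is_ordering :: "('v, 'e) graph \<Rightarrow> 'v list list \<Rightarrow> bool" where
  "is_ordering G ps \<longleftrightarrow> distinct (concat ps) \<and> complete_multipartite G (set ` set ps)"

definition node_less :: "'v list list \<Rightarrow> 'v \<Rightarrow> 'v \<Rightarrow> bool" where
  "node_less ps i j \<longleftrightarrow>
     (\<exists>m n. m < n \<and> n < length (concat ps) \<and> concat ps ! m = i \<and> concat ps ! n = j)"

definition mono_subgraph :: "('v, 'e) graph \<Rightarrow> ('e \<Rightarrow> 'c) \<Rightarrow> 'c \<Rightarrow> ('v, 'e) graph" where
  "mono_subgraph G \<kappa> c =
     \<lparr>nodes = \<Union> (ends G ` {e \<in> edges G. \<kappa> e = c}), edges = {e \<in> edges G. \<kappa> e = c}, ends = ends G\<rparr>"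

text \<open>The set of colours of a colouring \<open>\<kappa>\<close> is taken to be the set \<open>\<kappa> ` edges G\<close> of colours
  that occur; an unused colour has an empty monochromatic subgraph and contributes nothing.\<close>

definition is_colouring :: "('v, 'e) graph \<Rightarrow> ('e \<Rightarrow> 'c) \<Rightarrow> bool" where
  "is_colouring G \<kappa> \<longleftrightarrow> (\<forall>c\<in>\<kappa> ` edges G. \<exists>P. complete_multipartite (mono_subgraph G \<kappa> c) P)"

definition star_shaped :: "('v, 'e) graph \<Rightarrow> bool" where
  "star_shaped G \<longleftrightarrow> edges G \<noteq> {} \<and> (\<exists>i\<in>nodes G. \<forall>e\<in>edges G. i \<in> ends G e)"

definition relabelling :: "('v, 'e) graph \<Rightarrow> ('e \<Rightarrow> 'c) \<Rightarrow> ('e \<Rightarrow> 'c) \<Rightarrow> bool" where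
  "relabelling G \<kappa> \<kappa>' \<longleftrightarrow> (\<exists>\<sigma>. inj_on \<sigma> (\<kappa> ` edges G) \<and> (\<forall>e\<in>edges G. \<kappa>' e = \<sigma> (\<kappa> e)))"

definition recolouring :: "('v, 'e) graph \<Rightarrow> ('e \<Rightarrow> 'c) \<Rightarrow> ('e \<Rightarrow> 'c) \<Rightarrow> bool" where
  "recolouring G \<kappa> \<kappa>' \<longleftrightarrow> (\<exists>c. star_shaped (mono_subgraph G \<kappa> c) \<and>
     (\<forall>e\<in>edges G. \<kappa> e \<noteq> c \<longrightarrow> \<kappa>' e = \<kappa> e) \<and>
     (\<forall>e\<in>edges G. \<kappa> e = c \<longrightarrow> \<kappa>' e \<notin> \<kappa> ` edges G) \<and>
     inj_on \<kappa>' {e \<in> edges G. \<kappa> e = c})"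

definition colourings :: "('v, 'e) graph \<Rightarrow> ('e \<Rightarrow> 'c) set" where
  "colourings G = {\<kappa>. is_colouring G \<kappa>}"

definition colouring_equiv :: "('v, 'e) graph \<Rightarrow> (('e \<Rightarrow> 'c) \<times> ('e \<Rightarrow> 'c)) set" where
  "colouring_equiv G = {(\<kappa>, \<kappa>'). \<kappa> \<in> colourings G \<and> \<kappa>' \<in> colourings G \<and>
     equivclp (\<lambda>\<kappa>\<^sub>1 \<kappa>\<^sub>2. \<kappa>\<^sub>1 \<in> colourings G \<and> \<kappa>\<^sub>2 \<in> colourings G \<and>
       (relabelling G \<kappa>\<^sub>1 \<kappa>\<^sub>2 \<or> recolouring G \<kappa>\<^sub>1 \<kappa>\<^sub>2)) \<kappa> \<kappa>'}"

text \<open>The auxiliary choices: an ordering of each monochromatic subgraph, and at each node a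
  total order of the colours, given as a list.\<close>

record ('v, 'c) choices =
  part_order :: "'c \<Rightarrow> 'v list list"
  colour_order :: "'v \<Rightarrow> 'c list"

definition valid_choices :: "('v, 'e) graph \<Rightarrow> ('e \<Rightarrow> 'c) \<Rightarrow> ('v, 'c) choices \<Rightarrow> bool" where
  "valid_choices G \<kappa> \<omega> \<longleftrightarrow>
     (\<forall>c\<in>\<kappa> ` edges G. is_ordering (mono_subgraph G \<kappa> c) (part_order \<omega> c)) \<and>
     (\<forall>i\<in>nodes G. distinct (colour_order \<omega> i) \<and> set (colour_order \<omega> i) = \<kappa> ` edges G)"

section \<open>Representations\<close>

text \<open>The triple \<open>(e, i, j)\<close> is the edge \<open>e\<close> oriented with head \<open>i\<close> and tail \<open>j\<close>.\<close>

type_synonym ('v, 'e) arc = "'e \<times> 'v \<times> 'v"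
type_synonym ('v, 'e) rep = "('v, 'e) arc \<Rightarrow> complex mat"

definition arcs :: "('v, 'e) graph \<Rightarrow> ('v, 'e) arc set" where
  "arcs G = {(e, i, j). e \<in> edges G \<and> ends G e = {i, j}}"

definition Rep :: "('v, 'e) graph \<Rightarrow> ('v \<Rightarrow> nat) \<Rightarrow> ('v, 'e) rep set" where
  "Rep G d = (\<Pi>\<^sub>E (e, i, j)\<in>arcs G. carrier_mat (d i) (d j))"

definition GL :: "nat \<Rightarrow> complex mat set" where
  "GL n = {A \<in> carrier_mat n n. invertible_mat A}"

definition gauge_group :: "('v, 'e) graph \<Rightarrow> ('v \<Rightarrow> nat) \<Rightarrow> ('v \<Rightarrow> complex mat) set" where
  "gauge_group G d = (\<Pi>\<^sub>E i\<in>nodes G. GL (d i))"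

definition gauge_act :: "('v, 'e) graph \<Rightarrow> ('v \<Rightarrow> complex mat) \<Rightarrow> ('v, 'e) rep \<Rightarrow> ('v, 'e) rep" where
  "gauge_act G h \<rho> = (\<lambda>(e, i, j)\<in>arcs G. h i * \<rho> (e, i, j) * the (mat_inverse (h j)))"

text \<open>An endomorphism of \<open>\<Oplus>\<^sub>i\<^sub>\<in>\<^sub>N \<complex>\<^bsup>d i\<^esup>\<close> is given by its blocks \<open>A i j\<close>, of size
  \<open>d i \<times> d j\<close>, with \<open>i, j \<in> N\<close>.\<close>

type_synonym 'v block_mat = "'v \<Rightarrow> 'v \<Rightarrow> complex mat"

definition block_mult :: "'v set \<Rightarrow> ('v \<Rightarrow> nat) \<Rightarrow> 'v block_mat \<Rightarrow> 'v block_mat \<Rightarrow> 'v block_mat" where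
  "block_mult N d A B =
     (\<lambda>i j. mat (d i) (d j) (\<lambda>(r, s). \<Sum>k\<in>N. (A i k * B k j) $$ (r, s)))"

definition block_diag :: "('v \<Rightarrow> nat) \<Rightarrow> ('v \<Rightarrow> complex mat) \<Rightarrow> 'v block_mat" where
  "block_diag d g = (\<lambda>i j. if i = j then g i else 0\<^sub>m (d i) (d j))"

text \<open>\<open>A = 1 + \<Sum> A\<^sub>i\<^sub>j\<close>, the sum being over all \<open>i, j \<in> N\<close> with \<open>lt i j\<close>.\<close>

definition unitriangular ::
  "'v set \<Rightarrow> ('v \<Rightarrow> nat) \<Rightarrow> ('v \<Rightarrow> 'v \<Rightarrow> bool) \<Rightarrow> 'v block_mat \<Rightarrow> bool" where
  "unitriangular N d lt A \<longleftrightarrow> (\<forall>i\<in>N. \<forall>j\<in>N. A i j \<in> carrier_mat (d i) (d j) \<and>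
     (i = j \<longrightarrow> A i j = 1\<^sub>m (d i)) \<and> (i \<noteq> j \<and> \<not> lt i j \<longrightarrow> A i j = 0\<^sub>m (d i) (d j)))"

definition factorises ::
  "'v set \<Rightarrow> ('v \<Rightarrow> nat) \<Rightarrow> ('v \<Rightarrow> 'v \<Rightarrow> bool) \<Rightarrow> 'v block_mat \<Rightarrow> ('v \<Rightarrow> complex mat) \<Rightarrow> bool" where
  "factorises N d lt M g \<longleftrightarrow> (\<forall>i\<in>N. g i \<in> GL (d i)) \<and>
     (\<exists>wp wm. unitriangular N d lt wp \<and> unitriangular N d (\<lambda>i j. lt j i) wm \<and>
        (\<forall>i\<in>N. \<forall>j\<in>N. M i j = block_mult N d (block_mult N d wp (block_diag d g)) wm i j))"

definition edge_map ::
  "('v, 'e) graph \<Rightarrow> ('e \<Rightarrow> 'c) \<Rightarrow> ('v \<Rightarrow> nat) \<Rightarrow> ('v, 'e) rep \<Rightarrow> 'c \<Rightarrow> 'v block_mat" where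
  "edge_map G \<kappa> d \<rho> c i j =
     (if \<exists>e\<in>edges G. \<kappa> e = c \<and> ends G e = {i, j}
      then \<rho> (THE e. e \<in> edges G \<and> \<kappa> e = c \<and> ends G e = {i, j}, i, j)
      else 0\<^sub>m (d i) (d j))"

definition tri_part ::
  "('v \<Rightarrow> nat) \<Rightarrow> ('v \<Rightarrow> 'v \<Rightarrow> bool) \<Rightarrow> 'v block_mat \<Rightarrow> 'v block_mat" where
  "tri_part d lt v =
     (\<lambda>i j. if i = j then 1\<^sub>m (d i) else if lt i j then v i j else 0\<^sub>m (d i) (d j))"

text \<open>The product \<open>v\<^sub>c\<^sub>- v\<^sub>c\<^sub>+\<close>.\<close>

definition colour_product ::
  "('v, 'e) graph \<Rightarrow> ('e \<Rightarrow> 'c) \<Rightarrow> ('v, 'c) choices \<Rightarrow> ('v \<Rightarrow> nat) \<Rightarrow> ('v, 'e) rep \<Rightarrow> 'c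
     \<Rightarrow> 'v block_mat" where
  "colour_product G \<kappa> \<omega> d \<rho> c =
     (let N = nodes (mono_subgraph G \<kappa> c); lt = node_less (part_order \<omega> c);
          v = edge_map G \<kappa> d \<rho> c
      in block_mult N d (tri_part d (\<lambda>i j. lt j i) v) (tri_part d lt v))"

definition colour_factorises ::
  "('v, 'e) graph \<Rightarrow> ('e \<Rightarrow> 'c) \<Rightarrow> ('v, 'c) choices \<Rightarrow> ('v \<Rightarrow> nat) \<Rightarrow> ('v, 'e) rep \<Rightarrow> 'c
     \<Rightarrow> ('v \<Rightarrow> complex mat) \<Rightarrow> bool" where
  "colour_factorises G \<kappa> \<omega> d \<rho> c g \<longleftrightarrow>
     factorises (nodes (mono_subgraph G \<kappa> c)) d (node_less (part_order \<omega> c))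
       (colour_product G \<kappa> \<omega> d \<rho> c) g"

definition Rep_star ::
  "('v, 'e) graph \<Rightarrow> ('e \<Rightarrow> 'c) \<Rightarrow> ('v, 'c) choices \<Rightarrow> ('v \<Rightarrow> nat) \<Rightarrow> ('v, 'e) rep set" where
  "Rep_star G \<kappa> \<omega> d =
     {\<rho> \<in> Rep G d. \<forall>c\<in>\<kappa> ` edges G. \<exists>g. colour_factorises G \<kappa> \<omega> d \<rho> c g}"

definition colour_moment ::
  "('v, 'e) graph \<Rightarrow> ('e \<Rightarrow> 'c) \<Rightarrow> ('v, 'c) choices \<Rightarrow> ('v \<Rightarrow> nat) \<Rightarrow> ('v, 'e) rep \<Rightarrow> 'c
     \<Rightarrow> 'v \<Rightarrow> complex mat" where
  "colour_moment G \<kappa> \<omega> d \<rho> c i = (THE A. \<exists>g. colour_factorises G \<kappa> \<omega> d \<rho> c g \<and> A = g i)"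

definition moment_map ::
  "('v, 'e) graph \<Rightarrow> ('e \<Rightarrow> 'c) \<Rightarrow> ('v, 'c) choices \<Rightarrow> ('v \<Rightarrow> nat) \<Rightarrow> ('v, 'e) rep
     \<Rightarrow> 'v \<Rightarrow> complex mat" where
  "moment_map G \<kappa> \<omega> d \<rho> i =
     foldr (\<lambda>c A. colour_moment G \<kappa> \<omega> d \<rho> c i * A)
       (filter (\<lambda>c. i \<in> nodes (mono_subgraph G \<kappa> c)) (colour_order \<omega> i)) (1\<^sub>m (d i))"

definition moment_fibre ::
  "('v, 'e) graph \<Rightarrow> ('e \<Rightarrow> 'c) \<Rightarrow> ('v, 'c) choices \<Rightarrow> ('v \<Rightarrow> complex) \<Rightarrow> ('v \<Rightarrow> nat)
     \<Rightarrow> ('v, 'e) rep set" where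
  "moment_fibre G \<kappa> \<omega> q d =
     {\<rho> \<in> Rep_star G \<kappa> \<omega> d. \<forall>i\<in>nodes G. moment_map G \<kappa> \<omega> d \<rho> i = q i \<cdot>\<^sub>m 1\<^sub>m (d i)}"

section \<open>Affine varieties and the quotient\<close>

text \<open>A complex affine variety is represented by its set of points and its algebra of regular
  functions; a map of affine varieties is a morphism iff it pulls back regular functions to
  regular functions.\<close>

type_synonym 'p variety = "'p set \<times> ('p \<Rightarrow> complex) set"

definition variety_morphism :: "'p variety \<Rightarrow> 'r variety \<Rightarrow> ('p \<Rightarrow> 'r) \<Rightarrow> bool" where
  "variety_morphism X Y \<phi> \<longleftrightarrow> \<phi> \<in> fst X \<rightarrow> fst Y \<and> (\<forall>f\<in>snd Y. restrict (f \<circ> \<phi>) (fst X) \<in> snd X)"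

definition variety_isomorphic :: "'p variety \<Rightarrow> 'r variety \<Rightarrow> bool" where
  "variety_isomorphic X Y \<longleftrightarrow> (\<exists>\<phi> \<psi>. variety_morphism X Y \<phi> \<and> variety_morphism Y X \<psi> \<and>
     (\<forall>x\<in>fst X. \<psi> (\<phi> x) = x) \<and> (\<forall>y\<in>fst Y. \<phi> (\<psi> y) = y))"

inductive_set poly_functions :: "('v, 'e) graph \<Rightarrow> ('v \<Rightarrow> nat) \<Rightarrow> (('v, 'e) rep \<Rightarrow> complex) set"
  for G :: "('v, 'e) graph" and d :: "'v \<Rightarrow> nat" where
  const: "(\<lambda>_. a) \<in> poly_functions G d"
| coord: "\<lbrakk>(e, i, j) \<in> arcs G; r < d i; s < d j\<rbrakk> \<Longrightarrow> (\<lambda>\<rho>. \<rho> (e, i, j) $$ (r, s)) \<in> poly_functions G d"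
| add: "\<lbrakk>f \<in> poly_functions G d; g \<in> poly_functions G d\<rbrakk> \<Longrightarrow> (\<lambda>\<rho>. f \<rho> + g \<rho>) \<in> poly_functions G d"
| mult: "\<lbrakk>f \<in> poly_functions G d; g \<in> poly_functions G d\<rbrakk> \<Longrightarrow> (\<lambda>\<rho>. f \<rho> * g \<rho>) \<in> poly_functions G d"

text \<open>The coordinate ring of a closed subvariety \<open>X\<close> of a principal open subset
  \<open>{\<Delta> \<noteq> 0}\<close> of the affine space \<open>Rep G d\<close>: the functions \<open>p / \<Delta>\<^sup>n\<close> on \<open>X\<close>, or equivalently
  the fractions \<open>p / h\<close> whose denominator has no zero on \<open>X\<close>. The set \<open>Rep_star\<close> is principal open,
  as the factorisations exist iff certain minors do not vanish.\<close>

definition coord_ring ::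
  "('v, 'e) graph \<Rightarrow> ('v \<Rightarrow> nat) \<Rightarrow> ('v, 'e) rep set \<Rightarrow> (('v, 'e) rep \<Rightarrow> complex) set" where
  "coord_ring G d X = {restrict (\<lambda>x. p x / h x) X | p h.
     p \<in> poly_functions G d \<and> h \<in> poly_functions G d \<and> (\<forall>x\<in>X. h x \<noteq> 0)}"

definition invariant_ring ::
  "('v, 'e) graph \<Rightarrow> ('v \<Rightarrow> nat) \<Rightarrow> ('v, 'e) rep set \<Rightarrow> (('v, 'e) rep \<Rightarrow> complex) set" where
  "invariant_ring G d X =
     {f \<in> coord_ring G d X. \<forall>h\<in>gauge_group G d. \<forall>x\<in>X. f (gauge_act G h x) = f x}"

text \<open>The points of \<open>Spec A\<close>, for a finitely generated algebra \<open>A\<close> of complex functions on \<open>X\<close>: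
  the algebra homomorphisms from \<open>A\<close> to \<open>\<complex>\<close>. The elements of \<open>A\<close> are the regular functions,
  by evaluation.\<close>

definition spec_points :: "'x set \<Rightarrow> ('x \<Rightarrow> complex) set \<Rightarrow> (('x \<Rightarrow> complex) \<Rightarrow> complex) set" where
  "spec_points X A = {\<chi> \<in> extensional A.
     (\<forall>a. \<chi> (restrict (\<lambda>_. a) X) = a) \<and>
     (\<forall>f\<in>A. \<forall>g\<in>A. \<chi> (restrict (\<lambda>x. f x + g x) X) = \<chi> f + \<chi> g) \<and>
     (\<forall>f\<in>A. \<forall>g\<in>A. \<chi> (restrict (\<lambda>x. f x * g x) X) = \<chi> f * \<chi> g)}"

definition spec :: "'x set \<Rightarrow> ('x \<Rightarrow> complex) set \<Rightarrow> (('x \<Rightarrow> complex) \<Rightarrow> complex) variety" where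
  "spec X A = (spec_points X A, (\<lambda>f. restrict (\<lambda>\<chi>. \<chi> f) (spec_points X A)) ` A)"

definition git_quotient ::
  "('v, 'e) graph \<Rightarrow> ('v \<Rightarrow> nat) \<Rightarrow> ('v, 'e) rep set
     \<Rightarrow> ((('v, 'e) rep \<Rightarrow> complex) \<Rightarrow> complex) variety" where
  "git_quotient G d X = spec X (invariant_ring G d X)"

definition quiver_variety ::
  "('v, 'e) graph \<Rightarrow> ('e \<Rightarrow> 'c) \<Rightarrow> ('v, 'c) choices \<Rightarrow> ('v \<Rightarrow> complex) \<Rightarrow> ('v \<Rightarrow> nat)
     \<Rightarrow> ((('v, 'e) rep \<Rightarrow> complex) \<Rightarrow> complex) variety" where
  "quiver_variety G \<kappa> \<omega> q d = git_quotient G d (moment_fibre G \<kappa> \<omega> q d)"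

section \<open>Parameters\<close>

definition param_power :: "('v, 'e) graph \<Rightarrow> ('v \<Rightarrow> complex) \<Rightarrow> ('v \<Rightarrow> nat) \<Rightarrow> complex" where
  "param_power G q \<alpha> = (\<Prod>i\<in>nodes G. q i ^ \<alpha> i)"

definition admissible :: "('v, 'e) graph \<Rightarrow> ('v \<Rightarrow> complex) \<Rightarrow> ('v \<Rightarrow> nat) \<Rightarrow> bool" where
  "admissible G q d \<longleftrightarrow> (\<forall>i\<in>nodes G. q i \<noteq> 0) \<and> param_power G q d = 1"

definition quadratic_form :: "('v, 'e) graph \<Rightarrow> ('v \<Rightarrow> nat) \<Rightarrow> int" where
  "quadratic_form G \<alpha> = (\<Sum>i\<in>nodes G. \<Sum>j\<in>nodes G.
     int (\<alpha> i) * int (\<alpha> j) * ((if i = j then 2 else 0) - int (num_edges G i j)))"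

definition generic :: "('v, 'e) graph \<Rightarrow> ('v \<Rightarrow> complex) \<Rightarrow> ('v \<Rightarrow> nat) \<Rightarrow> bool" where
  "generic G q d \<longleftrightarrow> admissible G q d \<and>
     (\<forall>\<alpha>. (\<forall>i\<in>nodes G. \<alpha> i \<le> d i) \<and> (\<exists>i\<in>nodes G. \<alpha> i \<noteq> 0) \<and> (\<exists>i\<in>nodes G. \<alpha> i \<noteq> d i) \<and>
        quadratic_form G \<alpha> \<le> 2 \<longrightarrow> param_power G q \<alpha> \<noteq> 1)"

end

theory Submission
  imports Defs "Jordan_Normal_Form.Determinant"
    "HOL-Computational_Algebra.Fundamental_Theorem_Algebra"
begin

text \<open>
  Eliminating the largest node turns the factorisation of \<open>v\<^sub>c\<^sub>- v\<^sub>c\<^sub>+\<close> into iterated Schur complements.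
  An edge \<open>x < y\<close> of its own colour thus contributes \<open>(1 + v\<^sub>x\<^sub>y v\<^sub>y\<^sub>x)\<^sup>-\<^sup>1\<close> at \<open>x\<close> and \<open>1 + v\<^sub>y\<^sub>x v\<^sub>x\<^sub>y\<close> at \<open>y\<close>.
  For a star with two leaves the factors decouple after rescaling one arrow, so its moment fibre is
  equivariantly isomorphic to that of three distinct colours; the orientation of an edge is changed by
  \<open>v\<^sub>x\<^sub>y \<mapsto> - (1 + v\<^sub>x\<^sub>y v\<^sub>y\<^sub>x)\<^sup>-\<^sup>1 v\<^sub>x\<^sub>y\<close>, and the order of the colours at a node is irrelevant because the
  product of the two contributions is a scalar.

  For \<open>d = (1, 1, 1)\<close> the two varieties are told apart by their units. With three colours
  \<open>1 + v\<^sub>x\<^sub>y v\<^sub>y\<^sub>x\<close> is a nonconstant unit. With one colour and generic \<open>q\<close> every unit is constant: a unit is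
  constant along affine lines and a monomial along punctured lines, and the surface contains
  enough of both.
\<close>

section \<open>Invertible matrices\<close>

text \<open>Every colouring with at least two colours is compared with one space,
  \<open>edge_fibre\<close>, which remembers only an orientation of the three edges. The
  isomorphisms involved change a single arrow at a time, so they are built before passing to the
  quotient and descend by functoriality of Spec. The quotients are never described by equations. An
  isomorphism of quotients carries units to units, so it suffices to study invariant fractions
  \<open>p / h\<close> on the moment fibres: for a unit neither \<open>p\<close> nor
  \<open>h\<close> has a zero along a curve inside the fibre. The obstacle is the exponent of the
  resulting monomial, an integer that may depend on the curve. It is removed by intersecting two
  families of curves: on one of them the values are \<open>n\<close>-th powers of arbitrary nonzero
  numbers, on the other they are integral powers of 2. Genericity enters through
  \<open>q z \<noteq> 1\<close>, \<open>q y \<noteq> 1\<close> and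
  \<open>q y * q z \<noteq> 1\<close>, which allow every exceptional point to be joined to the open
  stratum.\<close>

abbreviation minv :: "complex mat \<Rightarrow> complex mat" where
  "minv A \<equiv> the (mat_inverse A)"

text \<open>The side conditions are equations between dimensions instead of membership in
  \<open>carrier_mat\<close>, so that the simplifier can discharge them while normalising long
  products of rectangular blocks.\<close>

lemma mat_assoc_dim:
  fixes A B C :: "complex mat"
  shows "dim_col A = dim_row B \<Longrightarrow> dim_col B = dim_row C \<Longrightarrow> A * B * C = A * (B * C)"
  by (rule assoc_mult_mat) auto

lemma mat_distrib_dim:
  fixes A B C :: "complex mat"
  shows "dim_row B = dim_row C \<Longrightarrow> dim_col B = dim_col C \<Longrightarrow> dim_col A = dim_row B \<Longrightarrow> A * (B + C) = A * B + A * C"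
    and "dim_row A = dim_row B \<Longrightarrow> dim_col A = dim_col B \<Longrightarrow> dim_col A = dim_row C \<Longrightarrow> (A + B) * C = A * C + B * C"
    and "dim_row B = dim_row C \<Longrightarrow> dim_col B = dim_col C \<Longrightarrow> dim_col A = dim_row B \<Longrightarrow> A * (B - C) = A * B - A * C"
    and "dim_row A = dim_row B \<Longrightarrow> dim_col A = dim_col B \<Longrightarrow> dim_col A = dim_row C \<Longrightarrow> (A - B) * C = A * C - B * C"
  by (rule mult_add_distrib_mat add_mult_distrib_mat mult_minus_distrib_mat minus_mult_distrib_mat; auto)+

lemma mat_one_dim:
  fixes A :: "complex mat"
  shows "dim_row A = n \<Longrightarrow> 1\<^sub>m n * A = A" and "dim_col A = n \<Longrightarrow> A * 1\<^sub>m n = A"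
  by auto

lemmas mat_algebra = mat_assoc_dim mat_distrib_dim mat_one_dim

text \<open>For square matrices over a field a right inverse is also a left inverse.\<close>

lemma GL_I:
  assumes "A \<in> carrier_mat n n" "B \<in> carrier_mat n n" "A * B = 1\<^sub>m n"
  shows "A \<in> GL n"
  using assms mat_mult_left_right_inverse[OF assms]
  unfolding GL_def invertible_mat_def inverts_mat_def by auto

text \<open>Bridges two notions of inverse: \<open>invertible_mat\<close> asks for some matrix,
  whereas \<open>mat_inverse\<close> is computed by Gauss-Jordan elimination and returns an option.
  Nothing is known about \<open>minv\<close> outside \<open>GL n\<close>, so membership in
  \<open>GL n\<close> is carried along everywhere.\<close>

lemma minv_GL:
  assumes "A \<in> GL n"
  shows "A \<in> carrier_mat n n" "minv A \<in> carrier_mat n n" "A * minv A = 1\<^sub>m n" "minv A * A = 1\<^sub>m n"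
    "minv A \<in> GL n"
proof -
  show A: "A \<in> carrier_mat n n" using assms unfolding GL_def by simp
  then obtain B where B: "A * B = 1\<^sub>m n" "B * A = 1\<^sub>m (dim_row B)"
    using assms unfolding GL_def invertible_mat_def inverts_mat_def by auto
  have "dim_col B = n" using B(1) by (metis index_mult_mat(3) index_one_mat(3))
  moreover have "dim_row B = n" using B(2) A by (metis carrier_matD(2) index_mult_mat(3) index_one_mat(3))
  ultimately have Bc: "B \<in> carrier_mat n n" by auto
  have "A \<in> Units (ring_mat TYPE(complex) n ())"
    unfolding Units_def ring_mat_def using A B Bc by simp (metis carrier_matD(1))
  then obtain C where C: "mat_inverse A = Some C" using mat_inverse(1)[OF A, of "()"] by (cases "mat_inverse A") auto
  from mat_inverse(2)[OF A this]
  show 1: "minv A \<in> carrier_mat n n" "A * minv A = 1\<^sub>m n" "minv A * A = 1\<^sub>m n" unfolding C by auto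
  show "minv A \<in> GL n" by (rule GL_I[OF 1(1) A 1(3)])
qed

lemma minv_eqI:
  assumes "A \<in> carrier_mat n n" "B \<in> carrier_mat n n" "A * B = 1\<^sub>m n"
  shows "minv A = B"
proof -
  note A = minv_GL[OF GL_I[OF assms]]
  have "minv A = minv A * (A * B)" using A assms by simp
  also have "\<dots> = minv A * A * B" using A(1,2) assms(2) by (subst mat_assoc_dim) auto
  also have "\<dots> = B" using A(4) assms(2) by simp
  finally show ?thesis .
qed

lemma minv_minv [simp]: "A \<in> GL n \<Longrightarrow> minv (minv A) = A"
  by (rule minv_eqI[of _ n]) (auto dest: minv_GL)

lemma GL_carrier: "A \<in> GL n \<Longrightarrow> A \<in> carrier_mat n n"
  by (rule minv_GL)

lemma GL_dim: "A \<in> GL n \<Longrightarrow> dim_row A = n" "A \<in> GL n \<Longrightarrow> dim_col A = n"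
  by (auto dest: GL_carrier)

lemma minv_dim: "A \<in> GL n \<Longrightarrow> dim_row (minv A) = n" "A \<in> GL n \<Longrightarrow> dim_col (minv A) = n"
  by (auto dest: minv_GL(2))

lemma minv_cancel:
  assumes "A \<in> GL n" "dim_row B = n"
  shows "A * (minv A * B) = B" "minv A * (A * B) = B"
proof -
  note A = minv_GL[OF assms(1)]
  have "A * (minv A * B) = A * minv A * B" "minv A * (A * B) = minv A * A * B"
    using A(1,2) assms(2) by (subst mat_assoc_dim; simp)+
  then show "A * (minv A * B) = B" "minv A * (A * B) = B" using A assms(2) by simp_all
qed

lemma minv_mult:
  assumes "A \<in> GL n" "B \<in> GL n"
  shows "A * B \<in> GL n" "minv (A * B) = minv B * minv A"
proof -
  note [simp] = minv_GL(3,4)[OF assms(1)] minv_GL(3,4)[OF assms(2)] GL_dim[OF assms(1)] GL_dim[OF assms(2)]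
    minv_dim[OF assms(1)] minv_dim[OF assms(2)]
  have *: "A * B * (minv B * minv A) = 1\<^sub>m n"
    by (simp add: mat_assoc_dim minv_cancel[OF assms(2)])
  show "A * B \<in> GL n" by (rule GL_I[OF _ _ *]; intro carrier_matI; simp)
  show "minv (A * B) = minv B * minv A" by (rule minv_eqI[OF _ _ *]; intro carrier_matI; simp)
qed

lemma GL_mult_cancel:
  assumes "A \<in> GL n" "B \<in> carrier_mat n n" "A * B \<in> GL n"
  shows "B \<in> GL n"
proof -
  have "minv A * (A * B) \<in> GL n" by (rule minv_mult(1)[OF minv_GL(5)[OF assms(1)] assms(3)])
  then show ?thesis using assms(2) by (simp add: minv_cancel[OF assms(1)])
qed

text \<open>\<open>B\<close> is \<open>c\<close> times the inverse of \<open>A\<close>, hence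
  commutes with it. This makes the moment equations insensitive to the order of two factors.\<close>

lemma GL_commute_scalar:
  assumes "A \<in> GL n" "B \<in> GL n" "A * B = c \<cdot>\<^sub>m 1\<^sub>m n" "c \<noteq> 0"
  shows "B * A = c \<cdot>\<^sub>m 1\<^sub>m n"
proof -
  note AB = GL_carrier[OF assms(1)] GL_carrier[OF assms(2)]
  have "A * ((1/c) \<cdot>\<^sub>m B) = (1/c) \<cdot>\<^sub>m (c \<cdot>\<^sub>m 1\<^sub>m n)"
    using assms(3) mult_smult_distrib[OF AB] by simp
  also have "\<dots> = 1\<^sub>m n" using assms(4) by (intro eq_matI) simp_all
  finally have "((1/c) \<cdot>\<^sub>m B) * A = 1\<^sub>m n"
    by (rule mat_mult_left_right_inverse[rotated 2]) (use AB in simp_all)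
  then have "(1/c) \<cdot>\<^sub>m (B * A) = 1\<^sub>m n"
    using AB by (simp add: mult_smult_assoc_mat)
  then have "c \<cdot>\<^sub>m ((1/c) \<cdot>\<^sub>m (B * A)) = c \<cdot>\<^sub>m 1\<^sub>m n" by simp
  moreover have "c \<cdot>\<^sub>m ((1/c) \<cdot>\<^sub>m (B * A)) = B * A" using assms(4) by (intro eq_matI) simp_all
  ultimately show ?thesis by simp
qed

text \<open>The formula for the inverse is the Woodbury identity; read from right to left it
  recognises a Schur complement as the inverse of \<open>1 + B * A\<close>. The last part is
  \<open>A * (1 + B * A) = (1 + A * B) * A\<close> with both inverses moved across.\<close>

lemma one_plus_swap:
  assumes A: "A \<in> carrier_mat m n" and B: "B \<in> carrier_mat n m" and I: "1\<^sub>m m + A * B \<in> GL m"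
  shows "1\<^sub>m n + B * A \<in> GL n" "minv (1\<^sub>m n + B * A) = 1\<^sub>m n - B * (minv (1\<^sub>m m + A * B) * A)"
    "A * minv (1\<^sub>m n + B * A) = minv (1\<^sub>m m + A * B) * A"
proof -
  let ?X = "1\<^sub>m m + A * B" and ?Y = "1\<^sub>m n + B * A"
  have [simp]: "dim_row A = m" "dim_col A = n" "dim_row B = n" "dim_col B = m"
    "dim_row (minv ?X) = m" "dim_col (minv ?X) = m"
    using A B minv_dim[OF I] by auto
  have "minv ?X * A + A * (B * (minv ?X * A)) = ?X * (minv ?X * A)"
    by (simp add: mat_algebra)
  also have "\<dots> = A" by (rule minv_cancel(1)[OF I]) simp
  finally have 1: "minv ?X * A + A * (B * (minv ?X * A)) = A" .
  have "?Y * (1\<^sub>m n - B * (minv ?X * A)) = ?Y - (B * (minv ?X * A) + B * (A * (B * (minv ?X * A))))"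
    by (simp add: mat_algebra)
  also have "B * (minv ?X * A) + B * (A * (B * (minv ?X * A))) = B * (minv ?X * A + A * (B * (minv ?X * A)))"
    by (rule mat_distrib_dim(1)[symmetric]) simp_all
  also have "\<dots> = B * A" using 1 by simp
  also have "?Y - B * A = 1\<^sub>m n" by (rule eq_matI) (simp_all del: index_mult_mat(1))
  finally have *: "?Y * (1\<^sub>m n - B * (minv ?X * A)) = 1\<^sub>m n" .
  have c: "?Y \<in> carrier_mat n n" "1\<^sub>m n - B * (minv ?X * A) \<in> carrier_mat n n"
    by (intro carrier_matI; simp)+
  show "?Y \<in> GL n" by (rule GL_I[OF c *])
  show 2: "minv ?Y = 1\<^sub>m n - B * (minv ?X * A)" by (rule minv_eqI[OF c *])
  have "A * minv ?Y = A - A * (B * (minv ?X * A))" unfolding 2 by (simp add: mat_algebra)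
  also have "\<dots> = (minv ?X * A + A * (B * (minv ?X * A))) - A * (B * (minv ?X * A))"
    using 1 by simp
  also have "\<dots> = minv ?X * A" by (rule eq_matI) (simp_all del: index_mult_mat(1))
  finally show "A * minv ?Y = minv ?X * A" .
qed

lemma one_minus_swap:
  assumes A: "A \<in> carrier_mat m n" and B: "B \<in> carrier_mat n m" and I: "1\<^sub>m m - A * B \<in> GL m"
  shows "1\<^sub>m n - B * A \<in> GL n"
proof -
  have "1\<^sub>m m - A * B = 1\<^sub>m m + A * (-B)" "1\<^sub>m n - B * A = 1\<^sub>m n + (-B) * A"
    using A B by (intro eq_matI; simp del: index_mult_mat(1))+
  then show ?thesis using one_plus_swap(1)[of A m n "-B"] A B I by simp
qed


section \<open>Triangular factorisation by elimination of the largest node\<close>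

lemma block_mult_empty [simp]: "block_mult {} d A B i j = 0\<^sub>m (d i) (d j)"
  unfolding block_mult_def by auto

lemma block_mult_carrier [simp]: "block_mult N d A B i j \<in> carrier_mat (d i) (d j)"
  unfolding block_mult_def by simp

lemma block_mult_dim [simp]:
  "dim_row (block_mult N d A B i j) = d i" "dim_col (block_mult N d A B i j) = d j"
  unfolding block_mult_def by simp_all

lemma block_mult_insert:
  assumes "finite N" "m \<notin> N" "A i m \<in> carrier_mat (d i) (d m)" "B m j \<in> carrier_mat (d m) (d j)"
  shows "block_mult (insert m N) d A B i j = A i m * B m j + block_mult N d A B i j"
  using assms unfolding block_mult_def by (intro eq_matI) (simp_all del: index_mult_mat(1))

lemma block_mult_cong:
  assumes "\<And>k. k \<in> N \<Longrightarrow> A i k = A' i k" "\<And>k. k \<in> N \<Longrightarrow> B k j = B' k j"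
  shows "block_mult N d A B i j = block_mult N d A' B' i j"
  using assms unfolding block_mult_def by (intro eq_matI) (simp_all del: index_mult_mat(1))

lemma block_mult_zero:
  assumes "\<And>k. k \<in> N \<Longrightarrow> A i k * B k j = 0\<^sub>m (d i) (d j)"
  shows "block_mult N d A B i j = 0\<^sub>m (d i) (d j)"
  using assms unfolding block_mult_def by (intro eq_matI) (simp_all del: index_mult_mat(1))

lemma block_mult_block_diag:
  assumes "finite N" "i \<in> N" "k \<in> N" "\<And>l. l \<in> N \<Longrightarrow> A i l \<in> carrier_mat (d i) (d l)"
    "g k \<in> carrier_mat (d k) (d k)"
  shows "block_mult N d A (block_diag d g) i k = A i k * g k"
proof (rule eq_matI)
  fix r s assume rs: "r < dim_row (A i k * g k)" "s < dim_col (A i k * g k)"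
  have dims: "r < d i" "s < d k" using rs assms(4)[OF assms(3)] assms(5) by auto
  have z: "(A i l * block_diag d g l k) $$ (r, s) = (if l = k then (A i k * g k) $$ (r, s) else 0)"
    if l: "l \<in> N" for l
  proof (cases "l = k")
    case True then show ?thesis by (simp add: block_diag_def)
  next
    case False
    then have "A i l * block_diag d g l k = 0\<^sub>m (d i) (d k)"
      using assms(4)[OF l] by (simp add: block_diag_def)
    then show ?thesis using False dims by simp
  qed
  show "block_mult N d A (block_diag d g) i k $$ (r, s) = (A i k * g k) $$ (r, s)"
    using dims assms(1,3) z unfolding block_mult_def by (simp add: sum.delta del: index_mult_mat(1))
qed (use assms(4)[OF assms(3)] assms(5) in auto)

definition schur :: "'v \<Rightarrow> 'v block_mat \<Rightarrow> 'v block_mat" where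
  "schur m M = (\<lambda>i j. M i j - M i m * (minv (M m m) * M m j))"

text \<open>The diagonal factor is absorbed into the columns of \<open>wp\<close>, which leaves a
  single block product to expand.\<close>

lemma factorises_iff:
  assumes "finite N"
  shows "factorises N d lt M g \<longleftrightarrow> (\<forall>i\<in>N. g i \<in> GL (d i)) \<and>
     (\<exists>wp wm. unitriangular N d lt wp \<and> unitriangular N d (\<lambda>i j. lt j i) wm \<and>
        (\<forall>i\<in>N. \<forall>j\<in>N. M i j = block_mult N d (\<lambda>i k. wp i k * g k) wm i j))"
proof -
  have "block_mult N d (block_mult N d wp (block_diag d g)) wm i j = block_mult N d (\<lambda>i k. wp i k * g k) wm i j"
    if "\<forall>i\<in>N. g i \<in> GL (d i)" "unitriangular N d lt wp" "i \<in> N" for i j wp wm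
  proof (rule block_mult_cong)
    fix k assume "k \<in> N"
    then show "block_mult N d wp (block_diag d g) i k = wp i k * g k"
      using that assms by (intro block_mult_block_diag) (auto simp: unitriangular_def GL_carrier)
  qed simp
  then show ?thesis unfolding factorises_def by (metis (no_types, lifting))
qed

text \<open>One step of block elimination. The row of \<open>m\<close> in \<open>wp\<close> and the
  column of \<open>m\<close> in \<open>wm\<close> vanish off the diagonal, so the products meeting
  \<open>m\<close> read \<open>M m m = g m\<close>, \<open>M i m = wp i m * g m\<close> and
  \<open>M m j = g m * wm m j\<close>; removing their contribution from the remaining blocks leaves
  exactly the Schur complement. Iteration also shows that \<open>g\<close> is determined on the
  nodes, as \<open>colour_moment\<close> requires.\<close>

lemma factorises_insert:
  assumes fin: "finite N" and m: "m \<notin> N" and lt: "\<And>x. x \<in> N \<Longrightarrow> lt x m \<and> \<not> lt m x"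
    and M: "\<And>i j. i \<in> insert m N \<Longrightarrow> j \<in> insert m N \<Longrightarrow> M i j \<in> carrier_mat (d i) (d j)"
  shows "factorises (insert m N) d lt M g \<longleftrightarrow>
    M m m \<in> GL (d m) \<and> g m = M m m \<and> factorises N d lt (schur m M) g"
proof
  assume "factorises (insert m N) d lt M g"
  then obtain wp wm where g: "\<forall>i\<in>insert m N. g i \<in> GL (d i)"
    and wp: "unitriangular (insert m N) d lt wp" and wm: "unitriangular (insert m N) d (\<lambda>i j. lt j i) wm"
    and "\<forall>i\<in>insert m N. \<forall>j\<in>insert m N. M i j = block_mult (insert m N) d (\<lambda>i k. wp i k * g k) wm i j"
    using fin by (subst (asm) factorises_iff) blast+
  then have eq: "\<And>i j. i \<in> insert m N \<Longrightarrow> j \<in> insert m N \<Longrightarrow>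
        M i j = block_mult (insert m N) d (\<lambda>i k. wp i k * g k) wm i j" by blast
  have c: "wp i j \<in> carrier_mat (d i) (d j)" "wm i j \<in> carrier_mat (d i) (d j)"
    "g i \<in> carrier_mat (d i) (d i)"
    if "i \<in> insert m N" "j \<in> insert m N" for i j
    using wp wm g that by (auto simp: unitriangular_def GL_carrier)
  have one: "wp m m = 1\<^sub>m (d m)" "wm m m = 1\<^sub>m (d m)"
    and zero: "\<And>k. k \<in> N \<Longrightarrow> wp m k = 0\<^sub>m (d m) (d k)" "\<And>k. k \<in> N \<Longrightarrow> wm k m = 0\<^sub>m (d k) (d m)"
    using wp wm lt m by (auto simp: unitriangular_def)
  have eq': "M i j = wp i m * g m * wm m j + block_mult N d (\<lambda>i k. wp i k * g k) wm i j"
    if "i \<in> insert m N" "j \<in> insert m N" for i j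
    unfolding eq[OF that] using that
    by (subst block_mult_insert[OF fin m]) (auto intro!: mult_carrier_mat[where n = "d m"] c)
  have bz: "block_mult N d (\<lambda>i k. wp i k * g k) wm m j = 0\<^sub>m (d m) (d j)" if "j \<in> insert m N" for j
    by (rule block_mult_zero)
       (simp add: zero(1) left_mult_zero_mat[OF c(3)[OF insertI2 insertI2]] left_mult_zero_mat[OF c(2)[OF insertI2 that]])
  have bz': "block_mult N d (\<lambda>i k. wp i k * g k) wm i m = 0\<^sub>m (d i) (d m)" if "i \<in> insert m N" for i
    by (rule block_mult_zero)
       (simp add: zero(2) right_mult_zero_mat[OF mult_carrier_mat[OF c(1)[OF that insertI2] c(3)[OF insertI2 insertI2]]])
  have gm: "g m \<in> GL (d m)" using g by simp
  note [simp] = minv_dim[OF gm] GL_dim[OF gm]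
  have Mmm: "M m m = g m"
    unfolding eq'[OF insertI1 insertI1] bz[OF insertI1] one using c(3)[of m m] by simp
  have Mim: "M i m = wp i m * g m" if "i \<in> N" for i
    using eq'[of i m] bz'[of i] that c(1)[of i m] c(3)[of m m] one by (simp add: right_add_zero_mat[of _ "d i" "d m"])
  have Mmj: "M m j = g m * wm m j" if "j \<in> N" for j
    using eq'[of m j] bz[of j] that c(2)[of m j] c(3)[of m m] one by (simp add: right_add_zero_mat[of _ "d m" "d j"])
  have sch: "schur m M i j = block_mult N d (\<lambda>i k. wp i k * g k) wm i j" if ij: "i \<in> N" "j \<in> N" for i j
  proof -
    have [simp]: "dim_row (wp i m) = d i" "dim_col (wp i m) = d m" "dim_row (wm m j) = d m" "dim_col (wm m j) = d j"
      using c(1)[of i m] c(2)[of m j] ij by auto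
    have "M i m * (minv (M m m) * M m j) = wp i m * g m * wm m j"
      unfolding Mmm Mim[OF ij(1)] Mmj[OF ij(2)] by (simp add: mat_assoc_dim minv_cancel[OF gm])
    then show ?thesis unfolding schur_def using ij
      by (subst eq') (auto intro!: eq_matI simp del: index_mult_mat(1))
  qed
  have "unitriangular N d lt wp" "unitriangular N d (\<lambda>i j. lt j i) wm"
    using wp wm by (auto simp: unitriangular_def)
  then have "factorises N d lt (schur m M) g"
    using g sch by (subst factorises_iff[OF fin]) blast
  then show "M m m \<in> GL (d m) \<and> g m = M m m \<and> factorises N d lt (schur m M) g"
    using Mmm gm by simp
next
  assume a: "M m m \<in> GL (d m) \<and> g m = M m m \<and> factorises N d lt (schur m M) g"
  then obtain wp wm where g: "\<forall>i\<in>N. g i \<in> GL (d i)"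
    and wp: "unitriangular N d lt wp" and wm: "unitriangular N d (\<lambda>i j. lt j i) wm"
    and eq: "\<And>i j. i \<in> N \<Longrightarrow> j \<in> N \<Longrightarrow> schur m M i j = block_mult N d (\<lambda>i k. wp i k * g k) wm i j"
    using fin by (subst (asm) factorises_iff) auto
  have gm: "M m m \<in> GL (d m)" "g m = M m m" using a by auto
  note [simp] = minv_dim[OF gm(1)] GL_dim[OF gm(1)]
  \<comment> \<open>The equations for the row and the column of \<open>m\<close> force these blocks:
    the inverse pivot multiplies the column of \<open>m\<close> from the right and the row of
    \<open>m\<close> from the left.\<close>
  define wp' where "wp' = (\<lambda>i j. if j = m then (if i = m then 1\<^sub>m (d m) else M i m * minv (M m m))
     else if i = m then 0\<^sub>m (d m) (d j) else wp i j)"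
  define wm' where "wm' = (\<lambda>i j. if i = m then (if j = m then 1\<^sub>m (d m) else minv (M m m) * M m j)
     else if j = m then 0\<^sub>m (d i) (d m) else wm i j)"
  have up: "unitriangular (insert m N) d lt wp'"
    using wp lt m M minv_GL[OF gm(1)] unfolding unitriangular_def wp'_def
    by (auto intro!: mult_carrier_mat[where n = "d m"])
  have um: "unitriangular (insert m N) d (\<lambda>i j. lt j i) wm'"
    using wm lt m M minv_GL[OF gm(1)] unfolding unitriangular_def wm'_def
    by (auto intro!: mult_carrier_mat[where n = "d m"])
  have c: "wp' i j \<in> carrier_mat (d i) (d j)" "wm' i j \<in> carrier_mat (d i) (d j)"
    if "i \<in> insert m N" "j \<in> insert m N" for i j
    using up um that by (auto simp: unitriangular_def)
  have cg: "g i \<in> carrier_mat (d i) (d i)" if "i \<in> insert m N" for i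
    using g gm that by (auto simp: GL_carrier)
  have "M i j = block_mult (insert m N) d (\<lambda>i k. wp' i k * g k) wm' i j"
    if i: "i \<in> insert m N" and j: "j \<in> insert m N" for i j
  proof -
    have Mc: "M i j \<in> carrier_mat (d i) (d j)" "M i m \<in> carrier_mat (d i) (d m)" "M m j \<in> carrier_mat (d m) (d j)"
      using M i j by auto
    then have [simp]: "dim_row (M i j) = d i" "dim_col (M i j) = d j" "dim_row (M i m) = d i" "dim_col (M i m) = d m"
      "dim_row (M m j) = d m" "dim_col (M m j) = d j" by auto
    have e: "block_mult (insert m N) d (\<lambda>i k. wp' i k * g k) wm' i j =
      wp' i m * g m * wm' m j + block_mult N d (\<lambda>i k. wp' i k * g k) wm' i j"
      using i j by (subst block_mult_insert[OF fin m]) (auto intro!: mult_carrier_mat[where n = "d m"] c cg)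
    show ?thesis
    proof (cases "i = m \<or> j = m")
      case True
      then have z: "block_mult N d (\<lambda>i k. wp' i k * g k) wm' i j = 0\<^sub>m (d i) (d j)"
      proof
        assume im: "i = m"
        show ?thesis
        proof (rule block_mult_zero)
          fix k assume k: "k \<in> N"
          then have "wp' i k = 0\<^sub>m (d i) (d k)" using im m by (auto simp: wp'_def)
          then show "wp' i k * g k * wm' k j = 0\<^sub>m (d i) (d j)"
            using cg[of k] c(2)[of k j] k j by simp
        qed
      next
        assume jm: "j = m"
        show ?thesis
        proof (rule block_mult_zero)
          fix k assume k: "k \<in> N"
          then have "wm' k j = 0\<^sub>m (d k) (d j)" using jm m by (auto simp: wm'_def)
          then show "wp' i k * g k * wm' k j = 0\<^sub>m (d i) (d j)"
            using cg[of k] c(1)[of i k] k i by (simp add: right_mult_zero_mat[of _ "d i" "d k"])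
        qed
      qed
      have "wp' i m * g m * wm' m j = M i j"
        using True minv_cancel[OF gm(1)] minv_GL(4)[OF gm(1)]
        by (auto simp: wp'_def wm'_def gm(2) mat_algebra)
      then show ?thesis unfolding e z using Mc by simp
    next
      case False
      then have ij: "i \<in> N" "j \<in> N" "i \<noteq> m" "j \<noteq> m" using i j by auto
      have "block_mult N d (\<lambda>i k. wp' i k * g k) wm' i j = block_mult N d (\<lambda>i k. wp i k * g k) wm i j"
        by (rule block_mult_cong) (use ij m in \<open>auto simp: wp'_def wm'_def\<close>)
      also have "\<dots> = schur m M i j" using eq ij by simp
      finally have 1: "block_mult N d (\<lambda>i k. wp' i k * g k) wm' i j = schur m M i j" .
      have 2: "wp' i m * g m * wm' m j = M i m * (minv (M m m) * M m j)"
        using ij by (simp add: wp'_def wm'_def gm(2) mat_assoc_dim minv_cancel[OF gm(1)])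
      show ?thesis unfolding e 1 2 schur_def by (rule eq_matI) (simp_all del: index_mult_mat(1))
    qed
  qed
  then show "factorises (insert m N) d lt M g"
    using fin g gm up um by (subst factorises_iff) auto
qed

lemma factorises_empty [simp]: "factorises {} d lt M g"
  unfolding factorises_def unitriangular_def by simp

section \<open>Regular functions and quotients\<close>

text \<open>The membership test of \<open>coord_ring\<close> without extensionality, so that sums,
  products and compositions can be formed without restricting at every step.\<close>

definition regular_on ::
  "('v, 'e) graph \<Rightarrow> ('v \<Rightarrow> nat) \<Rightarrow> ('v, 'e) rep set \<Rightarrow> (('v, 'e) rep \<Rightarrow> complex) \<Rightarrow> bool" where
  "regular_on G d X f \<longleftrightarrow> (\<exists>p\<in>poly_functions G d. \<exists>h\<in>poly_functions G d.
     (\<forall>x\<in>X. h x \<noteq> 0) \<and> (\<forall>x\<in>X. f x = p x / h x))"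

lemma coord_ring_iff: "f \<in> coord_ring G d X \<longleftrightarrow> f \<in> extensional X \<and> regular_on G d X f"
proof
  assume "f \<in> coord_ring G d X"
  then show "f \<in> extensional X \<and> regular_on G d X f"
    unfolding coord_ring_def regular_on_def by force
next
  assume f: "f \<in> extensional X \<and> regular_on G d X f"
  then obtain p h where ph: "p \<in> poly_functions G d" "h \<in> poly_functions G d" "\<forall>x\<in>X. h x \<noteq> 0"
    "\<forall>x\<in>X. f x = p x / h x" unfolding regular_on_def by auto
  then have "f = restrict (\<lambda>x. p x / h x) X" using f by (auto simp: extensional_def restrict_def)
  then show "f \<in> coord_ring G d X" unfolding coord_ring_def using ph by blast
qed

lemma regular_on_poly: "p \<in> poly_functions G d \<Longrightarrow> regular_on G d X p"
  unfolding regular_on_def by (intro bexI[of _ p] bexI[of _ "\<lambda>_. 1"] poly_functions.const) auto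

lemma regular_on_const [simp]: "regular_on G d X (\<lambda>_. a)"
  by (intro regular_on_poly poly_functions.const)

lemma regular_on_cong: "regular_on G d X f \<Longrightarrow> (\<And>x. x \<in> X \<Longrightarrow> f x = g x) \<Longrightarrow> regular_on G d X g"
  unfolding regular_on_def by auto

lemma regular_on_add:
  assumes "regular_on G d X f" "regular_on G d X g"
  shows "regular_on G d X (\<lambda>x. f x + g x)"
proof -
  obtain p h p' h' where ph: "p \<in> poly_functions G d" "h \<in> poly_functions G d" "\<forall>x\<in>X. h x \<noteq> 0"
    "\<forall>x\<in>X. f x = p x / h x" "p' \<in> poly_functions G d" "h' \<in> poly_functions G d" "\<forall>x\<in>X. h' x \<noteq> 0"
    "\<forall>x\<in>X. g x = p' x / h' x" using assms unfolding regular_on_def by auto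
  show ?thesis unfolding regular_on_def
    by (rule bexI[of _ "\<lambda>x. p x * h' x + p' x * h x"], rule bexI[of _ "\<lambda>x. h x * h' x"])
       (use ph in \<open>auto intro!: poly_functions.intros simp: field_simps\<close>)
qed

lemma regular_on_mult:
  assumes "regular_on G d X f" "regular_on G d X g"
  shows "regular_on G d X (\<lambda>x. f x * g x)"
proof -
  obtain p h p' h' where ph: "p \<in> poly_functions G d" "h \<in> poly_functions G d" "\<forall>x\<in>X. h x \<noteq> 0"
    "\<forall>x\<in>X. f x = p x / h x" "p' \<in> poly_functions G d" "h' \<in> poly_functions G d" "\<forall>x\<in>X. h' x \<noteq> 0"
    "\<forall>x\<in>X. g x = p' x / h' x" using assms unfolding regular_on_def by auto
  show ?thesis unfolding regular_on_def
    by (rule bexI[of _ "\<lambda>x. p x * p' x"], rule bexI[of _ "\<lambda>x. h x * h' x"])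
       (use ph in \<open>auto intro!: poly_functions.intros\<close>)
qed

text \<open>If \<open>f\<close> has no zero on \<open>X\<close>, neither has its numerator, so
  numerator and denominator may trade places.\<close>

lemma regular_on_inverse:
  assumes "regular_on G d X f" "\<And>x. x \<in> X \<Longrightarrow> f x \<noteq> 0"
  shows "regular_on G d X (\<lambda>x. 1 / f x)"
proof -
  obtain p h where ph: "p \<in> poly_functions G d" "h \<in> poly_functions G d" "\<forall>x\<in>X. h x \<noteq> 0"
    "\<forall>x\<in>X. f x = p x / h x" using assms unfolding regular_on_def by auto
  show ?thesis unfolding regular_on_def
    by (rule bexI[of _ h], rule bexI[of _ p]) (use ph assms(2) in auto)
qed

lemma regular_on_sum:
  "(\<And>k. k \<in> K \<Longrightarrow> regular_on G d X (f k)) \<Longrightarrow> regular_on G d X (\<lambda>x. \<Sum>k\<in>K. f k x)"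
  by (induction K rule: infinite_finite_induct) (auto intro!: regular_on_add)

lemma regular_on_prod:
  "(\<And>k. k \<in> K \<Longrightarrow> regular_on G d X (f k)) \<Longrightarrow> regular_on G d X (\<lambda>x. \<Prod>k\<in>K. f k x)"
  by (induction K rule: infinite_finite_induct) (auto intro!: regular_on_mult)

section \<open>Matrices whose entries are regular functions\<close>

definition mat_regular ::
  "('v, 'e) graph \<Rightarrow> ('v \<Rightarrow> nat) \<Rightarrow> ('v, 'e) rep set \<Rightarrow> nat \<Rightarrow> nat \<Rightarrow> (('v, 'e) rep \<Rightarrow> complex mat) \<Rightarrow> bool" where
  "mat_regular G d X m n F \<longleftrightarrow> (\<forall>x\<in>X. F x \<in> carrier_mat m n) \<and>
     (\<forall>r<m. \<forall>s<n. regular_on G d X (\<lambda>x. F x $$ (r, s)))"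

lemma mat_regular_one: "mat_regular G d X n n (\<lambda>_. 1\<^sub>m n)"
  unfolding mat_regular_def by simp

lemma mat_regular_add:
  assumes "mat_regular G d X m n A" "mat_regular G d X m n B"
  shows "mat_regular G d X m n (\<lambda>x. A x + B x)"
  unfolding mat_regular_def
proof (intro conjI allI impI ballI)
  fix r s assume rs: "r < m" "s < n"
  then have "regular_on G d X (\<lambda>x. A x $$ (r, s) + B x $$ (r, s))"
    using assms unfolding mat_regular_def by (intro regular_on_add) auto
  then show "regular_on G d X (\<lambda>x. (A x + B x) $$ (r, s))"
    by (rule regular_on_cong) (use assms rs in \<open>auto simp: mat_regular_def\<close>)
qed (use assms in \<open>auto simp: mat_regular_def\<close>)

lemma mat_regular_mult:
  assumes "mat_regular G d X m l A" "mat_regular G d X l n B"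
  shows "mat_regular G d X m n (\<lambda>x. A x * B x)"
  unfolding mat_regular_def
proof (intro conjI allI impI ballI)
  fix r s assume rs: "r < m" "s < n"
  then have "regular_on G d X (\<lambda>x. \<Sum>k = 0..<l. A x $$ (r, k) * B x $$ (k, s))"
    using assms unfolding mat_regular_def by (intro regular_on_sum regular_on_mult) auto
  then show "regular_on G d X (\<lambda>x. (A x * B x) $$ (r, s))"
  proof (rule regular_on_cong)
    fix x assume "x \<in> X"
    then have "A x \<in> carrier_mat m l" "B x \<in> carrier_mat l n" using assms unfolding mat_regular_def by auto
    then show "(\<Sum>k = 0..<l. A x $$ (r, k) * B x $$ (k, s)) = (A x * B x) $$ (r, s)"
      using rs by (simp add: scalar_prod_def)
  qed
next
  fix x assume "x \<in> X"
  then have "A x \<in> carrier_mat m l" "B x \<in> carrier_mat l n" using assms unfolding mat_regular_def by auto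
  then show "A x * B x \<in> carrier_mat m n" by simp
qed

lemma mat_regular_uminus:
  assumes "mat_regular G d X m n A"
  shows "mat_regular G d X m n (\<lambda>x. - A x)"
  unfolding mat_regular_def
proof (intro conjI allI impI ballI)
  fix r s assume rs: "r < m" "s < n"
  then have "regular_on G d X (\<lambda>x. (-1) * A x $$ (r, s))"
    using assms unfolding mat_regular_def by (intro regular_on_mult) auto
  then show "regular_on G d X (\<lambda>x. (- A x) $$ (r, s))"
    by (rule regular_on_cong) (use assms rs in \<open>auto simp: mat_regular_def\<close>)
qed (use assms in \<open>auto simp: mat_regular_def\<close>)

text \<open>The Leibniz expansion is a finite sum of products of entries.\<close>

lemma regular_on_det:
  assumes "mat_regular G d X n n A"
  shows "regular_on G d X (\<lambda>x. det (A x))"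
proof -
  have "regular_on G d X (\<lambda>x. \<Sum>p | p permutes {0..<n}. signof p * (\<Prod>i = 0..<n. A x $$ (i, p i)))"
    using assms unfolding mat_regular_def
    by (intro regular_on_sum regular_on_mult regular_on_prod) (auto dest: permutes_in_image)
  then show ?thesis
    by (rule regular_on_cong) (use assms in \<open>auto simp: mat_regular_def det_def'\<close>)
qed

text \<open>Cramer's rule, which turns the entries of an inverse matrix into fractions with the
  determinant as denominator.\<close>

lemma minv_adj:
  assumes "A \<in> GL n"
  shows "det A \<noteq> 0" "minv A = (1 / det A) \<cdot>\<^sub>m adj_mat A"
proof -
  note A = minv_GL[OF assms]
  have "det A * det (minv A) = 1" using det_mult[OF A(1,2)] unfolding A(3) by (simp only: det_one)
  then show d: "det A \<noteq> 0" by auto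
  have "A * ((1 / det A) \<cdot>\<^sub>m adj_mat A) = (1 / det A) \<cdot>\<^sub>m (det A \<cdot>\<^sub>m 1\<^sub>m n)"
    using mult_smult_distrib[OF A(1) adj_mat(1)[OF A(1)]] adj_mat(2)[OF A(1)] by simp
  also have "\<dots> = 1\<^sub>m n" using d by (intro eq_matI) simp_all
  finally show "minv A = (1 / det A) \<cdot>\<^sub>m adj_mat A"
    using A(1) adj_mat(1)[OF A(1)] by (intro minv_eqI) simp_all
qed

lemma mat_regular_minv:
  assumes "mat_regular G d X n n A" "\<And>x. x \<in> X \<Longrightarrow> A x \<in> GL n"
  shows "mat_regular G d X n n (\<lambda>x. minv (A x))"
  unfolding mat_regular_def
proof (intro conjI allI impI ballI)
  fix r s assume rs: "r < n" "s < n"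
  \<comment> \<open>The entry \<open>(r, s)\<close> of the adjugate is the cofactor at
    \<open>(s, r)\<close>, hence row \<open>s\<close> and column \<open>r\<close> are
    deleted.\<close>
  have "regular_on G d X (\<lambda>x. det (mat_delete (A x) s r))"
  proof (rule regular_on_det[of _ _ _ "n - 1"], unfold mat_regular_def, intro conjI allI impI ballI)
    fix x assume "x \<in> X"
    then show "mat_delete (A x) s r \<in> carrier_mat (n - 1) (n - 1)"
      using assms(1) mat_delete_carrier unfolding mat_regular_def by blast
  next
    fix i j assume ij: "i < n - 1" "j < n - 1"
    then have "regular_on G d X (\<lambda>x. A x $$ (if i < s then i else Suc i, if j < r then j else Suc j))"
      using assms(1) unfolding mat_regular_def by auto
    then show "regular_on G d X (\<lambda>x. mat_delete (A x) s r $$ (i, j))"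
      by (rule regular_on_cong) (use assms(1) ij in \<open>auto simp: mat_delete_def mat_regular_def\<close>)
  qed
  then have "regular_on G d X (\<lambda>x. (1 / det (A x)) * ((-1)^(s + r) * det (mat_delete (A x) s r)))"
    by (intro regular_on_mult regular_on_inverse regular_on_det[OF assms(1)] regular_on_const
        minv_adj(1)[OF assms(2)])
  then show "regular_on G d X (\<lambda>x. minv (A x) $$ (r, s))"
  proof (rule regular_on_cong)
    fix x assume x: "x \<in> X"
    note A = assms(2)[OF x]
    show "(1 / det (A x)) * ((-1)^(s + r) * det (mat_delete (A x) s r)) = minv (A x) $$ (r, s)"
      unfolding minv_adj(2)[OF A] using rs GL_dim[OF A] by (simp add: adj_mat_def cofactor_def)
  qed
qed (use assms minv_GL(2) in blast)

section \<open>Equivariant maps and the quotients they induce\<close>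

definition regular_map ::
  "('v, 'e) graph \<Rightarrow> ('v \<Rightarrow> nat) \<Rightarrow> ('v, 'e) rep set \<Rightarrow> (('v, 'e) rep \<Rightarrow> ('v, 'e) rep) \<Rightarrow> bool" where
  "regular_map G d X \<Phi> \<longleftrightarrow>
     (\<forall>(e, i, j)\<in>arcs G. mat_regular G d X (d i) (d j) (\<lambda>x. \<Phi> x (e, i, j)))"

text \<open>For polynomials this is an induction on their generation. A denominator without zeros on
  \<open>Y\<close> pulls back to one without zeros on \<open>X\<close>, because
  \<open>\<Phi>\<close> maps \<open>X\<close> into \<open>Y\<close>.\<close>

lemma regular_map_pullback:
  assumes \<Phi>: "regular_map G d X \<Phi>" "\<Phi> \<in> X \<rightarrow> Y" and f: "regular_on G d Y f"
  shows "regular_on G d X (\<lambda>x. f (\<Phi> x))"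
proof -
  have p: "regular_on G d X (\<lambda>x. p (\<Phi> x))" if "p \<in> poly_functions G d" for p
    using that
  proof induction
    case (coord e i j r s)
    then show ?case using \<Phi>(1) unfolding regular_map_def mat_regular_def by fastforce
  qed (auto intro: regular_on_add regular_on_mult)
  obtain p h where ph: "p \<in> poly_functions G d" "h \<in> poly_functions G d" "\<forall>x\<in>Y. h x \<noteq> 0"
    "\<forall>x\<in>Y. f x = p x / h x" using f unfolding regular_on_def by auto
  have "regular_on G d X (\<lambda>x. p (\<Phi> x) * (1 / h (\<Phi> x)))"
    using ph(1-3) p \<Phi>(2) by (intro regular_on_mult regular_on_inverse) (auto simp: Pi_iff)
  then show ?thesis by (rule regular_on_cong) (use ph(4) \<Phi>(2) in \<open>auto simp: Pi_iff\<close>)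
qed

text \<open>Elements of the coordinate ring are extensional, so the value of one at
  \<open>gauge_act G h x\<close> is meaningful only if that point stays in \<open>X\<close>.\<close>

definition gauge_stable :: "('v, 'e) graph \<Rightarrow> ('v \<Rightarrow> nat) \<Rightarrow> ('v, 'e) rep set \<Rightarrow> bool" where
  "gauge_stable G d X \<longleftrightarrow> (\<forall>h\<in>gauge_group G d. \<forall>x\<in>X. gauge_act G h x \<in> X)"

definition equivariant_morphism ::
  "('v, 'e) graph \<Rightarrow> ('v \<Rightarrow> nat) \<Rightarrow> ('v, 'e) rep set \<Rightarrow> ('v, 'e) rep set
     \<Rightarrow> (('v, 'e) rep \<Rightarrow> ('v, 'e) rep) \<Rightarrow> bool" where
  "equivariant_morphism G d X Y \<Phi> \<longleftrightarrow> \<Phi> \<in> X \<rightarrow> Y \<and> regular_map G d X \<Phi> \<and>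
     (\<forall>h\<in>gauge_group G d. \<forall>x\<in>X. \<Phi> (gauge_act G h x) = gauge_act G h (\<Phi> x))"

definition equivariantly_isomorphic ::
  "('v, 'e) graph \<Rightarrow> ('v \<Rightarrow> nat) \<Rightarrow> ('v, 'e) rep set \<Rightarrow> ('v, 'e) rep set \<Rightarrow> bool" where
  "equivariantly_isomorphic G d X Y \<longleftrightarrow> (\<exists>\<Phi> \<Psi>. equivariant_morphism G d X Y \<Phi> \<and>
     equivariant_morphism G d Y X \<Psi> \<and> (\<forall>x\<in>X. \<Psi> (\<Phi> x) = x) \<and> (\<forall>y\<in>Y. \<Phi> (\<Psi> y) = y))"

lemma equivariant_morphism_comp:
  assumes "equivariant_morphism G d X Y \<Phi>" "equivariant_morphism G d Y Z \<Psi>"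
  shows "equivariant_morphism G d X Z (\<lambda>x. \<Psi> (\<Phi> x))"
proof -
  have "regular_map G d X (\<lambda>x. \<Psi> (\<Phi> x))"
    unfolding regular_map_def
  proof clarify
    fix e i j assume a: "(e, i, j) \<in> arcs G"
    show "mat_regular G d X (d i) (d j) (\<lambda>x. \<Psi> (\<Phi> x) (e, i, j))"
      unfolding mat_regular_def
    proof (intro conjI ballI allI impI)
      fix x assume "x \<in> X"
      then show "\<Psi> (\<Phi> x) (e, i, j) \<in> carrier_mat (d i) (d j)"
        using assms a unfolding equivariant_morphism_def regular_map_def mat_regular_def by fastforce
    next
      fix r s assume rs: "r < d i" "s < d j"
      show "regular_on G d X (\<lambda>x. \<Psi> (\<Phi> x) (e, i, j) $$ (r, s))"
        by (rule regular_map_pullback[of _ _ _ _ Y "\<lambda>y. \<Psi> y (e, i, j) $$ (r, s)"])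
           (use assms a rs in \<open>fastforce simp: equivariant_morphism_def regular_map_def mat_regular_def\<close>)+
    qed
  qed
  then show ?thesis using assms unfolding equivariant_morphism_def by (simp add: Pi_iff)
qed

lemma equivariantly_isomorphic_trans:
  assumes "equivariantly_isomorphic G d X Y" "equivariantly_isomorphic G d Y Z"
  shows "equivariantly_isomorphic G d X Z"
proof -
  obtain \<Phi> \<Psi> where 1: "equivariant_morphism G d X Y \<Phi>" "equivariant_morphism G d Y X \<Psi>"
    "\<forall>x\<in>X. \<Psi> (\<Phi> x) = x" "\<forall>y\<in>Y. \<Phi> (\<Psi> y) = y" using assms(1) unfolding equivariantly_isomorphic_def by auto
  obtain \<Phi>' \<Psi>' where 2: "equivariant_morphism G d Y Z \<Phi>'" "equivariant_morphism G d Z Y \<Psi>'"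
    "\<forall>x\<in>Y. \<Psi>' (\<Phi>' x) = x" "\<forall>y\<in>Z. \<Phi>' (\<Psi>' y) = y" using assms(2) unfolding equivariantly_isomorphic_def by auto
  have "\<forall>x\<in>X. \<Psi> (\<Psi>' (\<Phi>' (\<Phi> x))) = x" "\<forall>z\<in>Z. \<Phi>' (\<Phi> (\<Psi> (\<Psi>' z))) = z"
    using 1 2 unfolding equivariant_morphism_def by (auto simp: Pi_iff)
  then show ?thesis unfolding equivariantly_isomorphic_def
    using equivariant_morphism_comp[OF 1(1) 2(1)] equivariant_morphism_comp[OF 2(2) 1(2)] by blast
qed

text \<open>The point \<open>gauge_act G h x\<close> is the image under \<open>\<Psi>\<close> of
  \<open>gauge_act G h (\<Phi> x)\<close>, which lies in \<open>Y\<close>.\<close>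

lemma gauge_stable_transfer:
  assumes "equivariantly_isomorphic G d X Y" "gauge_stable G d Y"
  shows "gauge_stable G d X"
proof -
  obtain \<Phi> \<Psi> where 1: "equivariant_morphism G d X Y \<Phi>" "equivariant_morphism G d Y X \<Psi>"
    "\<forall>x\<in>X. \<Psi> (\<Phi> x) = x" using assms(1) unfolding equivariantly_isomorphic_def by auto
  show ?thesis unfolding gauge_stable_def
  proof clarify
    fix h x assume h: "h \<in> gauge_group G d" and x: "x \<in> X"
    then have y: "\<Phi> x \<in> Y" using 1(1) unfolding equivariant_morphism_def by auto
    then have "gauge_act G h (\<Psi> (\<Phi> x)) = \<Psi> (gauge_act G h (\<Phi> x))" "gauge_act G h (\<Phi> x) \<in> Y"
      using 1(2) h assms(2) unfolding equivariant_morphism_def gauge_stable_def by auto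
    then show "gauge_act G h x \<in> X" using 1 x unfolding equivariant_morphism_def by auto
  qed
qed

lemma invariant_ring_closed:
  assumes "gauge_stable G d X"
  shows "restrict (\<lambda>_. a) X \<in> invariant_ring G d X"
    and "f \<in> invariant_ring G d X \<Longrightarrow> g \<in> invariant_ring G d X \<Longrightarrow>
      restrict (\<lambda>x. f x + g x) X \<in> invariant_ring G d X"
    and "f \<in> invariant_ring G d X \<Longrightarrow> g \<in> invariant_ring G d X \<Longrightarrow>
      restrict (\<lambda>x. f x * g x) X \<in> invariant_ring G d X"
proof -
  have *: "restrict f X \<in> invariant_ring G d X" if "regular_on G d X f"
    "\<And>h x. h \<in> gauge_group G d \<Longrightarrow> x \<in> X \<Longrightarrow> f (gauge_act G h x) = f x" for f
    using that assms unfolding invariant_ring_def coord_ring_iff gauge_stable_def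
    by (auto intro: regular_on_cong)
  show "restrict (\<lambda>_. a) X \<in> invariant_ring G d X" by (rule *) auto
  show "restrict (\<lambda>x. f x + g x) X \<in> invariant_ring G d X"
    if "f \<in> invariant_ring G d X" "g \<in> invariant_ring G d X"
    by (rule *) (use that in \<open>auto simp: invariant_ring_def coord_ring_iff intro: regular_on_add\<close>)
  show "restrict (\<lambda>x. f x * g x) X \<in> invariant_ring G d X"
    if "f \<in> invariant_ring G d X" "g \<in> invariant_ring G d X"
    by (rule *) (use that in \<open>auto simp: invariant_ring_def coord_ring_iff intro: regular_on_mult\<close>)
qed

lemma invariant_ring_pullback:
  assumes "equivariant_morphism G d X Y \<Phi>" "gauge_stable G d X" "f \<in> invariant_ring G d Y"
  shows "restrict (f \<circ> \<Phi>) X \<in> invariant_ring G d X"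
proof -
  have "regular_on G d X (\<lambda>x. f (\<Phi> x))"
    by (rule regular_map_pullback[of _ _ _ _ Y])
       (use assms in \<open>auto simp: equivariant_morphism_def invariant_ring_def coord_ring_iff\<close>)
  then show ?thesis
    using assms unfolding invariant_ring_def coord_ring_iff gauge_stable_def equivariant_morphism_def
    by (auto simp: Pi_iff intro: regular_on_cong)
qed

text \<open>Pulling back along \<open>\<Phi>\<close> is a homomorphism of invariant rings, and
  composing a character with it gives a character.\<close>

lemma spec_point_pullback:
  assumes \<Phi>: "equivariant_morphism G d X Y \<Phi>" and X: "gauge_stable G d X" and Y: "gauge_stable G d Y"
    and \<chi>: "\<chi> \<in> spec_points X (invariant_ring G d X)"
  shows "(\<lambda>f\<in>invariant_ring G d Y. \<chi> (restrict (f \<circ> \<Phi>) X)) \<in> spec_points Y (invariant_ring G d Y)"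
proof -
  have im: "\<Phi> x \<in> Y" if "x \<in> X" for x using \<Phi> that unfolding equivariant_morphism_def by auto
  note pb = invariant_ring_pullback[OF \<Phi> X]
  have eq: "restrict (restrict F Y \<circ> \<Phi>) X = restrict (F \<circ> \<Phi>) X" for F :: "_ \<Rightarrow> complex"
    using im by (intro restrict_ext) simp
  have c: "\<chi> (restrict (\<lambda>_. a) X) = a" for a using \<chi> unfolding spec_points_def by auto
  have s: "\<chi> (restrict (\<lambda>x. f x + g x) X) = \<chi> f + \<chi> g" "\<chi> (restrict (\<lambda>x. f x * g x) X) = \<chi> f * \<chi> g"
    if "f \<in> invariant_ring G d X" "g \<in> invariant_ring G d X" for f g
    using \<chi> that unfolding spec_points_def by auto
  have c': "restrict ((\<lambda>_. a) \<circ> \<Phi>) X = restrict (\<lambda>_. a) X" for a :: complex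
    by (auto simp: restrict_def)
  have s': "restrict ((\<lambda>x. f x + g x) \<circ> \<Phi>) X = restrict (\<lambda>x. restrict (f \<circ> \<Phi>) X x + restrict (g \<circ> \<Phi>) X x) X"
    "restrict ((\<lambda>x. f x * g x) \<circ> \<Phi>) X = restrict (\<lambda>x. restrict (f \<circ> \<Phi>) X x * restrict (g \<circ> \<Phi>) X x) X"
    for f g :: "_ \<Rightarrow> complex" by (auto simp: restrict_def)
  have s'': "\<chi> (restrict ((\<lambda>x. f x + g x) \<circ> \<Phi>) X) = \<chi> (restrict (f \<circ> \<Phi>) X) + \<chi> (restrict (g \<circ> \<Phi>) X)"
    "\<chi> (restrict ((\<lambda>x. f x * g x) \<circ> \<Phi>) X) = \<chi> (restrict (f \<circ> \<Phi>) X) * \<chi> (restrict (g \<circ> \<Phi>) X)"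
    if "f \<in> invariant_ring G d Y" "g \<in> invariant_ring G d Y" for f g
    unfolding s' by (rule s[OF pb[OF that(1)] pb[OF that(2)]])+
  show ?thesis unfolding spec_points_def
    using invariant_ring_closed[OF Y] pb by (auto simp: eq c c' s'')
qed

text \<open>Passing to invariants and passing to characters both reverse arrows, so
  \<open>\<Phi>\<close> and \<open>\<Psi>\<close> induce mutually inverse morphisms in their own
  directions. Off the ring a character is \<open>undefined\<close>, which is why \<open>inv'\<close>
  splits into two cases.\<close>

proposition git_quotient_isomorphic:
  fixes G :: "('v, 'e) graph"
  assumes iso: "equivariantly_isomorphic G d X Y" and Y: "gauge_stable G d Y"
  shows "variety_isomorphic (git_quotient G d X) (git_quotient G d Y)"
proof -
  note X = gauge_stable_transfer[OF iso Y]
  obtain \<Phi> \<Psi> where \<Phi>: "equivariant_morphism G d X Y \<Phi>" and \<Psi>: "equivariant_morphism G d Y X \<Psi>"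
    and inv: "\<forall>x\<in>X. \<Psi> (\<Phi> x) = x" "\<forall>y\<in>Y. \<Phi> (\<Psi> y) = y"
    using iso unfolding equivariantly_isomorphic_def by auto
  define pull where "pull = (\<lambda>(Z :: ('v, 'e) rep set) W F (\<chi> :: (('v, 'e) rep \<Rightarrow> complex) \<Rightarrow> complex).
    \<lambda>f\<in>invariant_ring G d W. \<chi> (restrict (f \<circ> F) Z))"
  have mor: "variety_morphism (git_quotient G d Z) (git_quotient G d W) (pull Z W F)"
    if "equivariant_morphism G d Z W F" "gauge_stable G d Z" "gauge_stable G d W" for Z W F
    unfolding variety_morphism_def git_quotient_def spec_def fst_conv snd_conv
  proof (intro conjI ballI)
    show pts: "pull Z W F \<in> spec_points Z (invariant_ring G d Z) \<rightarrow> spec_points W (invariant_ring G d W)"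
      unfolding pull_def using spec_point_pullback[OF that] by blast
    fix u assume "u \<in> (\<lambda>f. restrict (\<lambda>\<chi>. \<chi> f) (spec_points W (invariant_ring G d W))) ` invariant_ring G d W"
    then obtain f where f: "f \<in> invariant_ring G d W"
      "u = restrict (\<lambda>\<chi>. \<chi> f) (spec_points W (invariant_ring G d W))" by auto
    have "restrict (u \<circ> pull Z W F) (spec_points Z (invariant_ring G d Z)) =
        restrict (\<lambda>\<chi>. \<chi> (restrict (f \<circ> F) Z)) (spec_points Z (invariant_ring G d Z))"
      using pts f by (intro restrict_ext) (auto simp: pull_def)
    then show "restrict (u \<circ> pull Z W F) (spec_points Z (invariant_ring G d Z))
      \<in> (\<lambda>f. restrict (\<lambda>\<chi>. \<chi> f) (spec_points Z (invariant_ring G d Z))) ` invariant_ring G d Z"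
      using invariant_ring_pullback[OF that(1,2) f(1)] by blast
  qed
  have inv': "pull W Z F' (pull Z W F \<chi>) = \<chi>"
    if F: "equivariant_morphism G d Z W F" "equivariant_morphism G d W Z F'" "\<forall>x\<in>Z. F' (F x) = x"
      and st: "gauge_stable G d W" and \<chi>: "\<chi> \<in> spec_points Z (invariant_ring G d Z)" for Z W F F' \<chi>
  proof
    fix f
    show "pull W Z F' (pull Z W F \<chi>) f = \<chi> f"
    proof (cases "f \<in> invariant_ring G d Z")
      case True
      then have "f \<in> extensional Z" by (auto simp: invariant_ring_def coord_ring_iff)
      then have "restrict (restrict (f \<circ> F') W \<circ> F) Z = f"
        using F by (intro ext) (auto simp: extensional_def equivariant_morphism_def restrict_def)
      then show ?thesis using True invariant_ring_pullback[OF F(2) st True] unfolding pull_def by simp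
    next
      case False
      then show ?thesis using \<chi> unfolding pull_def spec_points_def extensional_def by auto
    qed
  qed
  show ?thesis unfolding variety_isomorphic_def
    by (rule exI[of _ "pull X Y \<Phi>"], rule exI[of _ "pull Y X \<Psi>"])
       (use mor[OF \<Phi> X Y] mor[OF \<Psi> Y X] inv'[OF \<Phi> \<Psi> inv(1) Y] inv'[OF \<Psi> \<Phi> inv(2) X]
        in \<open>auto simp: git_quotient_def spec_def\<close>)
qed

section \<open>Factorisations for a single edge and for a star\<close>

lemma mat_zero_dim:
  fixes A :: "complex mat"
  shows "dim_row A = n \<Longrightarrow> 0\<^sub>m m n * A = 0\<^sub>m m (dim_col A)"
    and "dim_col A = n \<Longrightarrow> A * 0\<^sub>m n m = 0\<^sub>m (dim_row A) m"
    and "dim_row A = m \<Longrightarrow> dim_col A = n \<Longrightarrow> 0\<^sub>m m n + A = A"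
    and "dim_row A = m \<Longrightarrow> dim_col A = n \<Longrightarrow> A + 0\<^sub>m m n = A"
    and "dim_row A = m \<Longrightarrow> dim_col A = n \<Longrightarrow> A - 0\<^sub>m m n = A"
  by (auto intro: left_mult_zero_mat right_mult_zero_mat left_add_zero_mat right_add_zero_mat eq_matI)

section \<open>The total order of the nodes given by an ordering of the parts\<close>

lemma node_less_asym:
  assumes "distinct (concat ps)" "node_less ps x y"
  shows "\<not> node_less ps y x" "x \<noteq> y"
proof -
  obtain m n where 1: "m < n" "n < length (concat ps)" "concat ps ! m = x" "concat ps ! n = y"
    using assms(2) unfolding node_less_def by auto
  show "x \<noteq> y" using 1 nth_eq_iff_index_eq[OF assms(1), of m n] by auto
  show "\<not> node_less ps y x"
  proof
    assume "node_less ps y x"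
    then obtain m' n' where 2: "m' < n'" "n' < length (concat ps)" "concat ps ! m' = y" "concat ps ! n' = x"
      unfolding node_less_def by auto
    have "m' = n" "n' = m" using 1 2 nth_eq_iff_index_eq[OF assms(1), of m' n] nth_eq_iff_index_eq[OF assms(1), of n' m] by auto
    then show False using 1 2 by simp
  qed
qed

lemma node_less_total:
  assumes "x \<in> set (concat ps)" "y \<in> set (concat ps)" "x \<noteq> y"
  shows "node_less ps x y \<or> node_less ps y x"
proof -
  obtain m n where "m < length (concat ps)" "concat ps ! m = x" "n < length (concat ps)" "concat ps ! n = y"
    using assms(1,2) unfolding in_set_conv_nth by blast
  moreover then have "m < n \<or> n < m" using assms(3) by (metis linorder_neqE_nat)
  ultimately show ?thesis unfolding node_less_def by blast
qed

lemma node_less_trans: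
  assumes "distinct (concat ps)" "node_less ps x y" "node_less ps y z"
  shows "node_less ps x z"
proof -
  obtain m n where 1: "m < n" "n < length (concat ps)" "concat ps ! m = x" "concat ps ! n = y"
    using assms(2) unfolding node_less_def by auto
  obtain m' n' where 2: "m' < n'" "n' < length (concat ps)" "concat ps ! m' = y" "concat ps ! n' = z"
    using assms(3) unfolding node_less_def by auto
  have "m' = n" using 1 2 nth_eq_iff_index_eq[OF assms(1), of m' n] by auto
  then show ?thesis unfolding node_less_def using 1 2 by (intro exI[of _ m] exI[of _ n']) auto
qed

lemma node_less_append:
  assumes "x \<in> set (concat ps)" "y \<in> set (concat qs)"
  shows "node_less (ps @ qs) x y"
proof -
  obtain m n where *: "m < length (concat ps)" "concat ps ! m = x" "n < length (concat qs)" "concat qs ! n = y"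
    using assms unfolding in_set_conv_nth by blast
  then show ?thesis unfolding node_less_def
    by (intro exI[of _ m] exI[of _ "length (concat ps) + n"]) (auto simp: nth_append)
qed

abbreviation tri_product :: "'v set \<Rightarrow> ('v \<Rightarrow> nat) \<Rightarrow> ('v \<Rightarrow> 'v \<Rightarrow> bool) \<Rightarrow> 'v block_mat \<Rightarrow> 'v block_mat" where
  "tri_product N d lt v \<equiv> block_mult N d (tri_part d (\<lambda>i j. lt j i) v) (tri_part d lt v)"

lemma tri_part_carrier:
  assumes "\<And>x y. x \<in> N \<Longrightarrow> y \<in> N \<Longrightarrow> v x y \<in> carrier_mat (d x) (d y)" "x \<in> N" "y \<in> N"
  shows "tri_part d lt v x y \<in> carrier_mat (d x) (d y)"
  using assms by (auto simp: tri_part_def)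

lemma tri_product_two:
  assumes v: "\<And>x y. x \<in> {i, j} \<Longrightarrow> y \<in> {i, j} \<Longrightarrow> v x y \<in> carrier_mat (d x) (d y)"
    and "i \<noteq> j" "x \<in> {i, j}" "y \<in> {i, j}"
  shows "tri_product {i, j} d lt v x y =
    tri_part d (\<lambda>i j. lt j i) v x i * tri_part d lt v i y + tri_part d (\<lambda>i j. lt j i) v x j * tri_part d lt v j y"
proof -
  have c: "tri_part d l v a b \<in> carrier_mat (d a) (d b)" if "a \<in> {i, j}" "b \<in> {i, j}" for a b l
    by (rule tri_part_carrier[where N = "{i, j}"]) (use v that in auto)
  have [simp]: "dim_row (tri_part d l v a b) = d a" "dim_col (tri_part d l v a b) = d b"
    if "a \<in> {i, j}" "b \<in> {i, j}" for a b l using carrier_matD[OF c[OF that]] by auto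
  show ?thesis using assms(2-)
    by (subst block_mult_insert; (intro c)?; simp add: mat_zero_dim)+
qed

lemma tri_product_three:
  assumes v: "\<And>x y. x \<in> {i, j, k} \<Longrightarrow> y \<in> {i, j, k} \<Longrightarrow> v x y \<in> carrier_mat (d x) (d y)"
    and "i \<noteq> j" "i \<noteq> k" "j \<noteq> k" "x \<in> {i, j, k}" "y \<in> {i, j, k}"
  shows "tri_product {i, j, k} d lt v x y =
    tri_part d (\<lambda>i j. lt j i) v x i * tri_part d lt v i y + (tri_part d (\<lambda>i j. lt j i) v x j * tri_part d lt v j y
      + tri_part d (\<lambda>i j. lt j i) v x k * tri_part d lt v k y)"
proof -
  have c: "tri_part d l v a b \<in> carrier_mat (d a) (d b)" if "a \<in> {i, j, k}" "b \<in> {i, j, k}" for a b l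
    by (rule tri_part_carrier[where N = "{i, j, k}"]) (use v that in auto)
  have [simp]: "dim_row (tri_part d l v a b) = d a" "dim_col (tri_part d l v a b) = d b"
    if "a \<in> {i, j, k}" "b \<in> {i, j, k}" for a b l using carrier_matD[OF c[OF that]] by auto
  show ?thesis using assms(2-)
    by (subst block_mult_insert; (intro c)?; simp add: mat_zero_dim)+
qed

lemma factorises_two:
  assumes lt: "lt x y" "\<not> lt y x" and xy: "x \<noteq> y"
    and M: "M x x \<in> carrier_mat (d x) (d x)" "M x y \<in> carrier_mat (d x) (d y)"
      "M y x \<in> carrier_mat (d y) (d x)" "M y y \<in> carrier_mat (d y) (d y)"
  shows "factorises {x, y} d lt M g \<longleftrightarrow> M y y \<in> GL (d y) \<and> g y = M y y \<and>
    schur y M x x \<in> GL (d x) \<and> g x = schur y M x x"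
proof -
  have "factorises {x, y} d lt M g \<longleftrightarrow> M y y \<in> GL (d y) \<and> g y = M y y \<and> factorises {x} d lt (schur y M) g"
    using factorises_insert[of "{x}" y lt M d g] lt xy M by (auto simp: insert_commute)
  moreover have "factorises {x} d lt (schur y M) g \<longleftrightarrow> schur y M x x \<in> GL (d x) \<and> g x = schur y M x x"
    if "M y y \<in> GL (d y)"
  proof -
    have "schur y M x x \<in> carrier_mat (d x) (d x)"
      using M minv_dim[OF that] unfolding schur_def by (intro carrier_matI) simp_all
    then show ?thesis using factorises_insert[of "{}" x lt "schur y M" d g] by simp
  qed
  ultimately show ?thesis by blast
qed

lemma factorises_three:
  assumes lt: "lt x y" "\<not> lt y x" "lt x z" "\<not> lt z x" "lt y z" "\<not> lt z y"
    and xy: "x \<noteq> y" "x \<noteq> z" "y \<noteq> z"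
    and M: "\<And>a b. a \<in> {x, y, z} \<Longrightarrow> b \<in> {x, y, z} \<Longrightarrow> M a b \<in> carrier_mat (d a) (d b)"
  shows "factorises {x, y, z} d lt M g \<longleftrightarrow> M z z \<in> GL (d z) \<and> g z = M z z \<and>
    schur z M y y \<in> GL (d y) \<and> g y = schur z M y y \<and>
    schur y (schur z M) x x \<in> GL (d x) \<and> g x = schur y (schur z M) x x"
proof -
  have [simp]: "{x, y, z} = insert z {x, y}" by auto
  have 1: "factorises {x, y, z} d lt M g \<longleftrightarrow> M z z \<in> GL (d z) \<and> g z = M z z \<and> factorises {x, y} d lt (schur z M) g"
    using factorises_insert[of "{x, y}" z lt M d g] lt xy M by auto
  have "schur z M a b \<in> carrier_mat (d a) (d b)" if "M z z \<in> GL (d z)" "a \<in> {x, y}" "b \<in> {x, y}" for a b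
    unfolding schur_def using that M[of a b] M[of a z] M[of z b] minv_GL(2)[OF that(1)]
    by (intro carrier_matI) auto
  then show ?thesis using 1 factorises_two[of lt x y "schur z M" d g] lt xy by auto
qed

abbreviation one_plus :: "('v \<Rightarrow> nat) \<Rightarrow> 'v block_mat \<Rightarrow> 'v \<Rightarrow> 'v \<Rightarrow> complex mat" where
  "one_plus d v x y \<equiv> 1\<^sub>m (d x) + v x y * v y x"

text \<open>For \<open>x < y\<close> the product is the block matrix with rows
  \<open>(1, v x y)\<close> and \<open>(v y x, 1 + v y x * v x y)\<close>. Its Schur complement at
  \<open>x\<close> is \<open>1 - v x y * (1 + v y x * v x y)^-1 * v y x\<close>, which
  \<open>one_plus_swap\<close> identifies with the inverse of
  \<open>1 + v x y * v y x\<close>.\<close>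

lemma factorises_edge:
  assumes v: "\<And>a b. a \<in> {x, y} \<Longrightarrow> b \<in> {x, y} \<Longrightarrow> v a b \<in> carrier_mat (d a) (d b)"
    and lt: "lt x y" "\<not> lt y x" and xy: "x \<noteq> y"
  shows "factorises {x, y} d lt (tri_product {x, y} d lt v) g \<longleftrightarrow>
    one_plus d v x y \<in> GL (d x) \<and> one_plus d v y x \<in> GL (d y) \<and> g y = one_plus d v y x \<and> g x = minv (one_plus d v x y)"
proof -
  let ?M = "tri_product {x, y} d lt v"
  have vc: "v x y \<in> carrier_mat (d x) (d y)" "v y x \<in> carrier_mat (d y) (d x)" using v by auto
  then have [simp]: "dim_row (v x y) = d x" "dim_col (v x y) = d y" "dim_row (v y x) = d y" "dim_col (v y x) = d x"
    by auto
  have comm: "v y x * v x y + 1\<^sub>m (d y) = one_plus d v y x"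
    by (rule comm_add_mat[of _ "d y" "d y"]) (intro carrier_matI; simp)+
  have T: "?M a b = tri_part d (\<lambda>i j. lt j i) v a x * tri_part d lt v x b
      + tri_part d (\<lambda>i j. lt j i) v a y * tri_part d lt v y b" if "a \<in> {x, y}" "b \<in> {x, y}" for a b
    by (rule tri_product_two) (use v xy that in auto)
  have M: "?M x x = 1\<^sub>m (d x)" "?M x y = v x y" "?M y x = v y x" "?M y y = one_plus d v y x"
    using lt xy by (subst T; simp add: tri_part_def mat_algebra mat_zero_dim comm)+
  have sw: "minv (one_plus d v x y) = schur y ?M x x" "one_plus d v x y \<in> GL (d x)" if "one_plus d v y x \<in> GL (d y)"
    using one_plus_swap[OF vc(2,1) that] by (simp_all add: schur_def M)
  have "factorises {x, y} d lt ?M g \<longleftrightarrow> ?M y y \<in> GL (d y) \<and> g y = ?M y y \<and>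
    schur y ?M x x \<in> GL (d x) \<and> g x = schur y ?M x x"
    using lt xy by (intro factorises_two) simp_all
  then show ?thesis using sw minv_GL(5)[OF sw(2)] unfolding M by metis
qed

text \<open>When the centre \<open>x\<close> of the star precedes its leaves, the substitution
  \<open>v\<^sub>x\<^sub>y \<mapsto> (1 + v\<^sub>x\<^sub>z v\<^sub>z\<^sub>x)\<^sup>-\<^sup>1 v\<^sub>x\<^sub>y\<close> decouples the two edges.\<close>

lemma factorises_star_first:
  assumes v: "\<And>a b. a \<in> {x, y, z} \<Longrightarrow> b \<in> {x, y, z} \<Longrightarrow> v a b \<in> carrier_mat (d a) (d b)"
    and lt: "lt x y" "\<not> lt y x" "lt x z" "\<not> lt z x" "lt y z" "\<not> lt z y"
    and xy: "x \<noteq> y" "x \<noteq> z" "y \<noteq> z" and v0: "v y z = 0\<^sub>m (d y) (d z)" "v z y = 0\<^sub>m (d z) (d y)"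
    and u: "u = minv (one_plus d v x z) * v x y"
  shows "factorises {x, y, z} d lt (tri_product {x, y, z} d lt v) g \<longleftrightarrow>
    one_plus d v x z \<in> GL (d x) \<and> one_plus d v z x \<in> GL (d z) \<and>
    1\<^sub>m (d x) + u * v y x \<in> GL (d x) \<and> 1\<^sub>m (d y) + v y x * u \<in> GL (d y) \<and>
    g z = one_plus d v z x \<and> g y = 1\<^sub>m (d y) + v y x * u \<and>
    g x = minv (1\<^sub>m (d x) + u * v y x) * minv (one_plus d v x z)"
proof -
  let ?M = "tri_product {x, y, z} d lt v"
  have vc: "v x y \<in> carrier_mat (d x) (d y)" "v y x \<in> carrier_mat (d y) (d x)"
    "v x z \<in> carrier_mat (d x) (d z)" "v z x \<in> carrier_mat (d z) (d x)" using v by auto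
  then have [simp]: "dim_row (v x y) = d x" "dim_col (v x y) = d y" "dim_row (v y x) = d y" "dim_col (v y x) = d x"
    "dim_row (v x z) = d x" "dim_col (v x z) = d z" "dim_row (v z x) = d z" "dim_col (v z x) = d x"
    by auto
  have comm: "v a x * v x a + 1\<^sub>m (d a) = 1\<^sub>m (d a) + v a x * v x a" if "a \<in> {y, z}" for a
    by (rule comm_add_mat[of _ "d a" "d a"]; intro carrier_matI; use that in auto)
  have T: "?M a b = tri_part d (\<lambda>i j. lt j i) v a x * tri_part d lt v x b
      + (tri_part d (\<lambda>i j. lt j i) v a y * tri_part d lt v y b
      + tri_part d (\<lambda>i j. lt j i) v a z * tri_part d lt v z b)" if "a \<in> {x, y, z}" "b \<in> {x, y, z}" for a b
    by (rule tri_product_three) (use v xy that in auto)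
  have M: "?M x x = 1\<^sub>m (d x)" "?M x y = v x y" "?M y x = v y x" "?M y y = one_plus d v y x"
     "?M x z = v x z" "?M z x = v z x" "?M z z = one_plus d v z x" "?M y z = v y x * v x z" "?M z y = v z x * v x y"
    using lt xy v0 by (subst T; simp add: tri_part_def mat_algebra mat_zero_dim comm)+
  have fac: "factorises {x, y, z} d lt ?M g \<longleftrightarrow> ?M z z \<in> GL (d z) \<and> g z = ?M z z \<and>
    schur z ?M y y \<in> GL (d y) \<and> g y = schur z ?M y y \<and>
    schur y (schur z ?M) x x \<in> GL (d x) \<and> g x = schur y (schur z ?M) x x"
    using lt xy by (intro factorises_three) simp_all
  show ?thesis
  proof (cases "one_plus d v z x \<in> GL (d z)")
    case False
    then show ?thesis unfolding fac M by blast
  next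
    case True
    note z = one_plus_swap[OF vc(4,3) True]
    note [simp] = minv_dim[OF z(1)] minv_dim[OF True]
    have uc: "u \<in> carrier_mat (d x) (d y)" unfolding u by (intro carrier_matI) simp_all
    then have [simp]: "dim_row u = d x" "dim_col u = d y" by auto
    \<comment> \<open>Write \<open>e\<close> for \<open>minv (one_plus d v x z)\<close>. Eliminating
      \<open>z\<close> leaves the matrix of a single edge with arrows \<open>u\<close> and
      \<open>v y x\<close>, its column of \<open>x\<close> multiplied by \<open>e\<close>: the rows
      are \<open>(e, u)\<close> and \<open>(v y x * e, 1 + v y x * u)\<close>.\<close>
    have xx: "schur z ?M x x = minv (one_plus d v x z)"
      unfolding schur_def M z(2) ..
    have "schur z ?M x y = (1\<^sub>m (d x) - v x z * (minv (one_plus d v z x) * v z x)) * v x y"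
      unfolding schur_def M by (simp add: mat_algebra)
    then have S: "schur z ?M x y = u" unfolding u z(2) .
    have "schur z ?M y x = v y x * (1\<^sub>m (d x) - v x z * (minv (one_plus d v z x) * v z x))"
      unfolding schur_def M by (simp add: mat_algebra)
    then have S': "schur z ?M y x = v y x * minv (one_plus d v x z)" unfolding z(2) .
    have "schur z ?M y y = 1\<^sub>m (d y) + v y x * ((1\<^sub>m (d x) - v x z * (minv (one_plus d v z x) * v z x)) * v x y)"
      unfolding schur_def M by (rule eq_matI) (simp_all add: mat_algebra del: index_mult_mat(1))
    then have yy: "schur z ?M y y = 1\<^sub>m (d y) + v y x * u" unfolding u z(2) .
    show ?thesis
    proof (cases "1\<^sub>m (d y) + v y x * u \<in> GL (d y)")
      case False
      then show ?thesis unfolding fac yy by blast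
    next
      case y: True
      note y' = one_plus_swap[OF vc(2) uc y]
      note [simp] = minv_dim[OF y] minv_dim[OF y'(1)]
      \<comment> \<open>The right factor \<open>minv (one_plus d v x z)\<close> comes out of the
        Schur complement; what remains is the inverse known from a single edge.\<close>
      have xx': "schur y (schur z ?M) x x = minv (1\<^sub>m (d x) + u * v y x) * minv (one_plus d v x z)"
        unfolding schur_def[of y "schur z ?M"] xx S S' yy y'(2) by (simp add: mat_algebra)
      have "minv (1\<^sub>m (d x) + u * v y x) * minv (one_plus d v x z) \<in> GL (d x)"
        by (rule minv_mult(1)[OF minv_GL(5)[OF y'(1)] minv_GL(5)[OF z(1)]])
      then show ?thesis unfolding fac yy xx' M using True z(1) y y'(1) by blast
    qed
  qed
qed

text \<open>When the centre \<open>x\<close> comes last, the substitution is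
  \<open>v\<^sub>x\<^sub>z \<mapsto> (1 + v\<^sub>x\<^sub>y v\<^sub>y\<^sub>x)\<^sup>-\<^sup>1 v\<^sub>x\<^sub>z\<close>.\<close>

lemma factorises_star_last:
  assumes v: "\<And>a b. a \<in> {y, z, x} \<Longrightarrow> b \<in> {y, z, x} \<Longrightarrow> v a b \<in> carrier_mat (d a) (d b)"
    and lt: "lt y x" "\<not> lt x y" "lt z x" "\<not> lt x z" "lt y z" "\<not> lt z y"
    and xy: "x \<noteq> y" "x \<noteq> z" "y \<noteq> z" and v0: "v y z = 0\<^sub>m (d y) (d z)" "v z y = 0\<^sub>m (d z) (d y)"
    and u: "u = minv (one_plus d v x y) * v x z"
  shows "factorises {y, z, x} d lt (tri_product {y, z, x} d lt v) g \<longleftrightarrow>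
    one_plus d v x y \<in> GL (d x) \<and> one_plus d v y x \<in> GL (d y) \<and>
    1\<^sub>m (d x) + u * v z x \<in> GL (d x) \<and> 1\<^sub>m (d z) + v z x * u \<in> GL (d z) \<and>
    g z = minv (1\<^sub>m (d z) + v z x * u) \<and> g y = minv (one_plus d v y x) \<and>
    g x = one_plus d v x y * (1\<^sub>m (d x) + u * v z x)"
proof -
  let ?M = "tri_product {y, z, x} d lt v"
  let ?E = "one_plus d v x y"
  have vc: "v x y \<in> carrier_mat (d x) (d y)" "v y x \<in> carrier_mat (d y) (d x)"
    "v x z \<in> carrier_mat (d x) (d z)" "v z x \<in> carrier_mat (d z) (d x)" using v by auto
  then have [simp]: "dim_row (v x y) = d x" "dim_col (v x y) = d y" "dim_row (v y x) = d y" "dim_col (v y x) = d x"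
    "dim_row (v x z) = d x" "dim_col (v x z) = d z" "dim_row (v z x) = d z" "dim_col (v z x) = d x"
    by auto
  have sum: "v x y * v y x + (v x z * v z x + 1\<^sub>m (d x)) = ?E + v x z * v z x"
    by (rule eq_matI) (simp_all del: index_mult_mat(1))
  have T: "?M a b = tri_part d (\<lambda>i j. lt j i) v a y * tri_part d lt v y b
      + (tri_part d (\<lambda>i j. lt j i) v a z * tri_part d lt v z b
      + tri_part d (\<lambda>i j. lt j i) v a x * tri_part d lt v x b)" if "a \<in> {y, z, x}" "b \<in> {y, z, x}" for a b
    by (rule tri_product_three) (use v xy that in auto)
  have M: "?M y y = 1\<^sub>m (d y)" "?M z z = 1\<^sub>m (d z)" "?M y z = 0\<^sub>m (d y) (d z)" "?M z y = 0\<^sub>m (d z) (d y)"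
     "?M y x = v y x" "?M z x = v z x" "?M x y = v x y" "?M x z = v x z" "?M x x = ?E + v x z * v z x"
    using lt xy v0 by (subst T; simp add: tri_part_def mat_algebra mat_zero_dim sum)+
  have fac: "factorises {y, z, x} d lt ?M g \<longleftrightarrow> ?M x x \<in> GL (d x) \<and> g x = ?M x x \<and>
    schur x ?M z z \<in> GL (d z) \<and> g z = schur x ?M z z \<and>
    schur z (schur x ?M) y y \<in> GL (d y) \<and> g y = schur z (schur x ?M) y y"
    using lt xy by (intro factorises_three) simp_all
  have sxz: "schur x ?M z z = 1\<^sub>m (d z) - v z x * (minv (?M x x) * v x z)"
    by (simp add: schur_def M(2,6,8))
  have Ec: "?E \<in> carrier_mat (d x) (d x)" by (intro carrier_matI) simp_all
  show ?thesis
  proof (cases "?E \<in> GL (d x)")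
    case False
    \<comment> \<open>Invertibility of \<open>?E\<close> is forced: if the first two pivots are
      invertible, exchanging factors makes \<open>1 - minv (?M x x) * v x z * v z x\<close>
      invertible, and this matrix is \<open>minv (?M x x) * ?E\<close>.\<close>
    have "\<not> (?M x x \<in> GL (d x) \<and> schur x ?M z z \<in> GL (d z))"
    proof
      assume a: "?M x x \<in> GL (d x) \<and> schur x ?M z z \<in> GL (d z)"
      note [simp] = minv_dim[OF conjunct1[OF a]] GL_dim[OF conjunct1[OF a]]
      have "1\<^sub>m (d x) - (minv (?M x x) * v x z) * v z x \<in> GL (d x)"
        by (rule one_minus_swap[of "v z x" "d z"]) (use a vc in \<open>auto simp: sxz intro!: carrier_matI\<close>)
      moreover have "1\<^sub>m (d x) - (minv (?M x x) * v x z) * v z x = minv (?M x x) * (?M x x - v x z * v z x)"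
        using minv_GL(4)[OF conjunct1[OF a]] by (simp add: mat_algebra)
      moreover have "?M x x - v x z * v z x = ?E"
        unfolding M by (rule eq_matI) (simp_all del: index_mult_mat(1))
      ultimately have "minv (?M x x) * ?E \<in> GL (d x)" by simp
      then have "?E \<in> GL (d x)" by (rule GL_mult_cancel[OF minv_GL(5)[OF conjunct1[OF a]] Ec])
      then show False using False by simp
    qed
    then show ?thesis unfolding fac using False by blast
  next
    case E: True
    note [simp] = minv_dim[OF E]
    note y = one_plus_swap[OF vc(1,2) E]
    have uc: "u \<in> carrier_mat (d x) (d z)" unfolding u by (intro carrier_matI) simp_all
    then have [simp]: "dim_row u = d x" "dim_col u = d z" by auto
    let ?F = "1\<^sub>m (d x) + u * v z x"
    \<comment> \<open>The choice of \<open>u\<close> makes the pivot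
      \<open>?E + v x z * v z x\<close> at \<open>x\<close> factor as
      \<open>?E * ?F\<close>.\<close>
    have Eu: "?E * u = v x z" unfolding u by (rule minv_cancel(1)[OF E]) simp
    have Fc: "?F \<in> carrier_mat (d x) (d x)" by (intro carrier_matI) simp_all
    have "?E * ?F = ?E * 1\<^sub>m (d x) + (?E * u) * v z x"
      using Ec by (simp add: mat_distrib_dim(1) mat_assoc_dim del: right_mult_one_mat)
    then have xx: "?M x x = ?E * ?F" unfolding M Eu by simp
    show ?thesis
    proof (cases "?F \<in> GL (d x)")
      case False
      then have "?M x x \<notin> GL (d x)" unfolding xx using GL_mult_cancel[OF E Fc] by blast
      then show ?thesis unfolding fac using False by blast
    next
      case F: True
      note [simp] = minv_dim[OF F]
      note z = one_plus_swap[OF uc vc(4) F]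
      note [simp] = minv_dim[OF z(1)] minv_dim[OF y(1)]
      have xxGL: "?M x x \<in> GL (d x)" and xxi: "minv (?M x x) = minv ?F * minv ?E"
        unfolding xx by (rule minv_mult[OF E F])+
      have zz: "schur x ?M z z = minv (1\<^sub>m (d z) + v z x * u)"
        unfolding sxz xxi z(2) by (simp add: mat_assoc_dim flip: u)
      have yz: "schur x ?M y z = - (v y x * (minv ?F * u))"
        unfolding schur_def xxi M(3,5,8) by (rule eq_matI) (simp_all add: mat_assoc_dim del: index_mult_mat(1) flip: u)
      have zy: "schur x ?M z y = - (v z x * (minv ?F * (minv ?E * v x y)))"
        unfolding schur_def xxi M(4,6,7) by (rule eq_matI) (simp_all add: mat_assoc_dim del: index_mult_mat(1))
      \<comment> \<open>The expansion collapses because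
        \<open>(1 + v z x * u) * v z x = v z x * ?F\<close>: this cancels one factor
        \<open>minv ?F\<close>, and then the two correction terms combine to \<open>?F\<close>,
        which cancels the other.\<close>
      have "schur z (schur x ?M) y y = 1\<^sub>m (d y) - v y x * (minv ?F * (minv ?E * v x y))
          - v y x * (minv ?F * (u * ((1\<^sub>m (d z) + v z x * u) * (v z x * (minv ?F * (minv ?E * v x y))))))"
        unfolding schur_def[of z "schur x ?M"] zz yz zy minv_minv[OF z(1)]
        unfolding schur_def[of x ?M] xxi M(1,5,7)
        by (rule eq_matI) (simp_all add: mat_assoc_dim del: index_mult_mat(1))
      also have "(1\<^sub>m (d z) + v z x * u) * (v z x * (minv ?F * (minv ?E * v x y))) = v z x * (?F * (minv ?F * (minv ?E * v x y)))"
        by (simp add: mat_algebra)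
      also have "?F * (minv ?F * (minv ?E * v x y)) = minv ?E * v x y"
        by (rule minv_cancel[OF F]) simp
      also have "1\<^sub>m (d y) - v y x * (minv ?F * (minv ?E * v x y)) - v y x * (minv ?F * (u * (v z x * (minv ?E * v x y))))
         = 1\<^sub>m (d y) - v y x * (minv ?F * (?F * (minv ?E * v x y)))"
        by (rule eq_matI) (simp_all add: mat_algebra del: index_mult_mat(1))
      also have "minv ?F * (?F * (minv ?E * v x y)) = minv ?E * v x y"
        by (rule minv_cancel[OF F]) simp
      also have "1\<^sub>m (d y) - v y x * (minv ?E * v x y) = minv (one_plus d v y x)"
        unfolding y(2) ..
      finally have yy: "schur z (schur x ?M) y y = minv (one_plus d v y x)" .
      show ?thesis unfolding fac zz yy using E F y(1) z(1) xxGL minv_GL(5)[OF z(1)] minv_GL(5)[OF y(1)]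
        unfolding xx by blast
    qed
  qed
qed

section \<open>Representations of a triangle\<close>

definition the_edge :: "('v, 'e) graph \<Rightarrow> 'v \<Rightarrow> 'v \<Rightarrow> 'e" where
  "the_edge G x y = (THE e. e \<in> edges G \<and> ends G e = {x, y})"

definition arrow :: "('v, 'e) graph \<Rightarrow> ('v, 'e) rep \<Rightarrow> 'v block_mat" where
  "arrow G \<rho> x y = \<rho> (the_edge G x y, x, y)"

definition edge_contribution ::
  "('v \<Rightarrow> 'v \<Rightarrow> bool) \<Rightarrow> ('v \<Rightarrow> nat) \<Rightarrow> 'v block_mat \<Rightarrow> 'v \<Rightarrow> 'v \<Rightarrow> complex mat" where
  "edge_contribution lt d v x y = (if lt x y then minv (one_plus d v x y) else one_plus d v x y)"

text \<open>The common model for all colourings with at least two colours: only an orientation of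
  the edges survives, and \<open>lt\<close> may be cyclic. The equation at a node is imposed for
  both orders of its two factors; for nonzero \<open>q x\<close> these are equivalent by
  \<open>GL_commute_scalar\<close>.\<close>

definition edge_fibre ::
  "('v, 'e) graph \<Rightarrow> ('v \<Rightarrow> 'v \<Rightarrow> bool) \<Rightarrow> ('v \<Rightarrow> complex) \<Rightarrow> ('v \<Rightarrow> nat) \<Rightarrow> ('v, 'e) rep set" where
  "edge_fibre G lt q d = {\<rho> \<in> Rep G d.
     (\<forall>x\<in>nodes G. \<forall>y\<in>nodes G. x \<noteq> y \<longrightarrow> one_plus d (arrow G \<rho>) x y \<in> GL (d x)) \<and>
     (\<forall>x\<in>nodes G. \<forall>y\<in>nodes G. \<forall>z\<in>nodes G. x \<noteq> y \<longrightarrow> x \<noteq> z \<longrightarrow> y \<noteq> z \<longrightarrow>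
        edge_contribution lt d (arrow G \<rho>) x y * edge_contribution lt d (arrow G \<rho>) x z = q x \<cdot>\<^sub>m 1\<^sub>m (d x))}"

lemma edge_fibre_cong:
  assumes "\<And>x y. x \<in> nodes G \<Longrightarrow> y \<in> nodes G \<Longrightarrow> x \<noteq> y \<Longrightarrow> lt x y = lt' x y"
  shows "edge_fibre G lt q d = edge_fibre G lt' q d"
  unfolding edge_fibre_def edge_contribution_def using assms by (intro Collect_cong) (simp cong: conj_cong)

locale triangle_graph =
  fixes G :: "('v, 'e) graph"
  assumes triangle: "triangle G"
begin

lemma the_edge:
  assumes "x \<in> nodes G" "y \<in> nodes G" "x \<noteq> y"
  shows "the_edge G x y \<in> edges G" "ends G (the_edge G x y) = {x, y}"
    "\<And>e. e \<in> edges G \<Longrightarrow> ends G e = {x, y} \<Longrightarrow> e = the_edge G x y"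
proof -
  have "card {e \<in> edges G. ends G e = {x, y}} = 1"
    using triangle assms unfolding triangle_def num_edges_def by blast
  then obtain e where e: "{e \<in> edges G. ends G e = {x, y}} = {e}" by (rule card_1_singletonE)
  then have "the_edge G x y = e" unfolding the_edge_def by (intro the_equality) blast+
  then show "the_edge G x y \<in> edges G" "ends G (the_edge G x y) = {x, y}"
    "\<And>e. e \<in> edges G \<Longrightarrow> ends G e = {x, y} \<Longrightarrow> e = the_edge G x y" using e by blast+
qed

lemma the_edge_commute: "the_edge G x y = the_edge G y x"
  unfolding the_edge_def by (simp add: insert_commute)

lemma edge_cases:
  assumes "e \<in> edges G"
  obtains x y where "x \<in> nodes G" "y \<in> nodes G" "x \<noteq> y" "e = the_edge G x y"
proof -
  have "ends G e \<subseteq> nodes G" "card (ends G e) = 2"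
    using triangle assms unfolding triangle_def fin_graph_def by auto
  then obtain x y where "ends G e = {x, y}" "x \<noteq> y" "x \<in> nodes G" "y \<in> nodes G"
    by (auto simp: card_2_iff)
  then show thesis using that the_edge(3) assms by blast
qed

lemma the_edge_eq_iff:
  assumes "x \<in> nodes G" "y \<in> nodes G" "x \<noteq> y" "a \<in> nodes G" "b \<in> nodes G" "a \<noteq> b"
  shows "the_edge G x y = the_edge G a b \<longleftrightarrow> {x, y} = {a, b}"
  using the_edge[OF assms(1-3)] the_edge[OF assms(4-6)] by metis

lemma arcs_iff: "(e, x, y) \<in> arcs G \<longleftrightarrow> x \<in> nodes G \<and> y \<in> nodes G \<and> x \<noteq> y \<and> e = the_edge G x y"
proof
  assume a: "(e, x, y) \<in> arcs G"
  then have "e \<in> edges G" and e: "ends G e = {x, y}" unfolding arcs_def by auto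
  then have "{x, y} \<subseteq> nodes G" "card {x, y} = 2"
    using triangle unfolding triangle_def fin_graph_def by auto
  then have "x \<in> nodes G" "y \<in> nodes G" "x \<noteq> y" by auto
  then show "x \<in> nodes G \<and> y \<in> nodes G \<and> x \<noteq> y \<and> e = the_edge G x y"
    using the_edge(3)[OF _ _ _ \<open>e \<in> edges G\<close> e] by simp
qed (auto simp: arcs_def the_edge)

lemma nodes_obtain:
  assumes "x \<in> nodes G" "y \<in> nodes G" "x \<noteq> y"
  obtains z where "nodes G = {x, y, z}" "z \<noteq> x" "z \<noteq> y"
proof -
  have fin: "finite (nodes G)" and c: "card (nodes G) = 3"
    using triangle unfolding triangle_def fin_graph_def by auto
  then have "card (nodes G - {x, y}) = 1" using assms by (simp add: card_Diff_subset)
  then obtain z where "nodes G - {x, y} = {z}" by (rule card_1_singletonE)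
  then have "nodes G = {x, y, z}" "z \<noteq> x" "z \<noteq> y" using assms by auto
  then show thesis by (rule that)
qed

lemma nodes_three: obtains x y z where "nodes G = {x, y, z}" "x \<noteq> y" "x \<noteq> z" "y \<noteq> z"
  using triangle unfolding triangle_def card_3_iff by metis

lemma arrow_carrier:
  assumes "\<rho> \<in> Rep G d" "x \<in> nodes G" "y \<in> nodes G" "x \<noteq> y"
  shows "arrow G \<rho> x y \<in> carrier_mat (d x) (d y)"
proof -
  have "(the_edge G x y, x, y) \<in> arcs G" using assms by (simp add: arcs_iff)
  from PiE_mem[OF assms(1)[unfolded Rep_def] this] show ?thesis by (simp add: arrow_def)
qed

lemma arrow_dim:
  assumes "\<rho> \<in> Rep G d" "x \<in> nodes G" "y \<in> nodes G" "x \<noteq> y"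
  shows "dim_row (arrow G \<rho> x y) = d x" "dim_col (arrow G \<rho> x y) = d y"
  using arrow_carrier[OF assms] by auto

lemma Rep_I:
  assumes "\<rho> \<in> extensional (arcs G)"
    "\<And>x y. x \<in> nodes G \<Longrightarrow> y \<in> nodes G \<Longrightarrow> x \<noteq> y \<Longrightarrow> arrow G \<rho> x y \<in> carrier_mat (d x) (d y)"
  shows "\<rho> \<in> Rep G d"
  using assms unfolding Rep_def PiE_def Pi_def arrow_def by (auto simp: arcs_iff)

lemma arrow_gauge_act:
  assumes "x \<in> nodes G" "y \<in> nodes G" "x \<noteq> y"
  shows "arrow G (gauge_act G h \<rho>) x y = h x * arrow G \<rho> x y * minv (h y)"
  using assms by (simp add: arrow_def gauge_act_def arcs_iff)

lemma gauge_group_GL: "h \<in> gauge_group G d \<Longrightarrow> x \<in> nodes G \<Longrightarrow> h x \<in> GL (d x)"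
  unfolding gauge_group_def by (rule PiE_mem)

lemma gauge_act_Rep:
  assumes "\<rho> \<in> Rep G d" "h \<in> gauge_group G d"
  shows "gauge_act G h \<rho> \<in> Rep G d"
proof (rule Rep_I)
  show "gauge_act G h \<rho> \<in> extensional (arcs G)" by (simp add: gauge_act_def)
  fix x y assume xy: "x \<in> nodes G" "y \<in> nodes G" "x \<noteq> y"
  show "arrow G (gauge_act G h \<rho>) x y \<in> carrier_mat (d x) (d y)"
    unfolding arrow_gauge_act[OF xy]
    using GL_dim[OF gauge_group_GL[OF assms(2) xy(1)]] minv_dim[OF gauge_group_GL[OF assms(2) xy(2)]]
    by (intro carrier_matI) simp_all
qed

lemma GL_conj:
  assumes h: "h \<in> GL n" and A: "A \<in> GL n"
  shows "h * A * minv h \<in> GL n" "minv (h * A * minv h) = h * minv A * minv h"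
proof -
  show "h * A * minv h \<in> GL n" by (intro minv_mult(1) h A minv_GL(5))
  show "minv (h * A * minv h) = h * minv A * minv h"
    using minv_mult(2)[OF minv_mult(1)[OF h A] minv_GL(5)[OF h]] minv_mult(2)[OF h A] minv_minv[OF h]
      minv_dim[OF A] minv_dim[OF h] GL_dim[OF h] by (simp add: mat_assoc_dim)
qed

text \<open>The path from \<open>x\<close> to \<open>y\<close> and back is closed, so the group
  element at \<open>y\<close> cancels.\<close>

lemma one_plus_gauge_act:
  assumes \<rho>: "\<rho> \<in> Rep G d" and h: "h \<in> gauge_group G d" and xy: "x \<in> nodes G" "y \<in> nodes G" "x \<noteq> y"
  shows "one_plus d (arrow G (gauge_act G h \<rho>)) x y = h x * one_plus d (arrow G \<rho>) x y * minv (h x)"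
proof -
  note hx = gauge_group_GL[OF h xy(1)] and hy = gauge_group_GL[OF h xy(2)]
  note [simp] = GL_dim[OF hx] GL_dim[OF hy] minv_dim[OF hx] minv_dim[OF hy]
    arrow_dim[OF \<rho> xy] arrow_dim[OF \<rho> xy(2,1) xy(3)[symmetric]]
  show ?thesis
    unfolding arrow_gauge_act[OF xy] arrow_gauge_act[OF xy(2,1) xy(3)[symmetric]]
    by (simp add: mat_algebra minv_cancel[OF hy] minv_GL(3)[OF hx])
qed

lemma edge_fibreD:
  assumes "\<rho> \<in> edge_fibre G lt q d"
  shows "\<rho> \<in> Rep G d"
    "\<And>x y. x \<in> nodes G \<Longrightarrow> y \<in> nodes G \<Longrightarrow> x \<noteq> y \<Longrightarrow> one_plus d (arrow G \<rho>) x y \<in> GL (d x)"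
  using assms unfolding edge_fibre_def by auto

lemma edge_contribution_GL:
  assumes "one_plus d v x y \<in> GL (d x)"
  shows "edge_contribution lt d v x y \<in> GL (d x)"
  using assms minv_GL(5) unfolding edge_contribution_def by simp

text \<open>The contributions at \<open>x\<close> are conjugated by \<open>h x\<close>, and
  conjugation fixes scalar matrices.\<close>

lemma gauge_stable_edge_fibre: "gauge_stable G d (edge_fibre G lt q d)"
  unfolding gauge_stable_def
proof (intro ballI)
  fix h \<rho> assume h: "h \<in> gauge_group G d" and \<rho>: "\<rho> \<in> edge_fibre G lt q d"
  note R = edge_fibreD[OF \<rho>]
  have c: "edge_contribution lt d (arrow G (gauge_act G h \<rho>)) x y
      = h x * edge_contribution lt d (arrow G \<rho>) x y * minv (h x)"
    if "x \<in> nodes G" "y \<in> nodes G" "x \<noteq> y" for x y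
    unfolding edge_contribution_def one_plus_gauge_act[OF R(1) h that]
    using GL_conj(2)[OF gauge_group_GL[OF h that(1)] R(2)[OF that]] by simp
  show "gauge_act G h \<rho> \<in> edge_fibre G lt q d"
    unfolding edge_fibre_def
  proof (intro CollectI conjI ballI impI)
    show "gauge_act G h \<rho> \<in> Rep G d" by (rule gauge_act_Rep[OF R(1) h])
    fix x y assume xy: "x \<in> nodes G" "y \<in> nodes G" "x \<noteq> y"
    show "one_plus d (arrow G (gauge_act G h \<rho>)) x y \<in> GL (d x)"
      unfolding one_plus_gauge_act[OF R(1) h xy] by (rule GL_conj(1)[OF gauge_group_GL[OF h xy(1)] R(2)[OF xy]])
  next
    fix x y z assume n: "x \<in> nodes G" "y \<in> nodes G" "z \<in> nodes G" "x \<noteq> y" "x \<noteq> z" "y \<noteq> z"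
    let ?A = "edge_contribution lt d (arrow G \<rho>) x y" and ?B = "edge_contribution lt d (arrow G \<rho>) x z"
    note H = gauge_group_GL[OF h n(1)]
    have GLs: "?A \<in> GL (d x)" "?B \<in> GL (d x)"
      by (rule edge_contribution_GL, rule R(2); fact n)+
    note [simp] = GL_dim[OF H] minv_dim[OF H] GL_dim[OF GLs(1)] GL_dim[OF GLs(2)]
    have AB: "?A * ?B = q x \<cdot>\<^sub>m 1\<^sub>m (d x)" using \<rho> n unfolding edge_fibre_def by blast
    have "h x * ?A * minv (h x) * (h x * ?B * minv (h x)) = h x * (?A * ?B * minv (h x))"
      by (simp add: mat_assoc_dim minv_cancel[OF H])
    also have "\<dots> = q x \<cdot>\<^sub>m (h x * minv (h x))"
      unfolding AB using minv_GL(1,2)[OF H]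
      by (simp add: mult_smult_distrib[of _ "d x" "d x"] mult_smult_assoc_mat[of _ "d x" "d x"])
    finally show "edge_contribution lt d (arrow G (gauge_act G h \<rho>)) x y *
        edge_contribution lt d (arrow G (gauge_act G h \<rho>)) x z = q x \<cdot>\<^sub>m 1\<^sub>m (d x)"
      unfolding c[OF n(1,2,4)] c[OF n(1,3,5)] minv_GL(3)[OF H] .
  qed
qed

section \<open>Isomorphisms that change a single arrow\<close>

definition set_arrow :: "'v \<Rightarrow> 'v \<Rightarrow> complex mat \<Rightarrow> ('v, 'e) rep \<Rightarrow> ('v, 'e) rep" where
  "set_arrow x y u \<rho> = \<rho>((the_edge G x y, x, y) := u)"

lemma arrow_set_arrow [simp]:
  "arrow G (set_arrow x y u \<rho>) a b = (if a = x \<and> b = y then u else arrow G \<rho> a b)"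
  unfolding arrow_def set_arrow_def by auto

lemma set_arrow_set_arrow [simp]: "set_arrow x y u (set_arrow x y u' \<rho>) = set_arrow x y u \<rho>"
  by (simp add: set_arrow_def)

lemma set_arrow_same: "u = arrow G \<rho> x y \<Longrightarrow> set_arrow x y u \<rho> = \<rho>"
  by (simp add: set_arrow_def arrow_def)

lemma set_arrow_Rep:
  assumes "\<rho> \<in> Rep G d" "x \<in> nodes G" "y \<in> nodes G" "x \<noteq> y" "u \<in> carrier_mat (d x) (d y)"
  shows "set_arrow x y u \<rho> \<in> Rep G d"
proof (rule Rep_I)
  show "set_arrow x y u \<rho> \<in> extensional (arcs G)"
    using assms(1-4) unfolding Rep_def PiE_def extensional_def set_arrow_def by (auto simp: arcs_iff)
qed (use assms arrow_carrier[OF assms(1)] in auto)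

lemma mat_regular_arrow:
  assumes "X \<subseteq> Rep G d" "x \<in> nodes G" "y \<in> nodes G" "x \<noteq> y"
  shows "mat_regular G d X (d x) (d y) (\<lambda>\<rho>. arrow G \<rho> x y)"
  unfolding mat_regular_def
proof (intro conjI ballI allI impI)
  show "arrow G \<rho> x y \<in> carrier_mat (d x) (d y)" if "\<rho> \<in> X" for \<rho>
    using arrow_carrier[OF _ assms(2-4)] that assms(1) by blast
  show "regular_on G d X (\<lambda>\<rho>. arrow G \<rho> x y $$ (r, s))" if "r < d x" "s < d y" for r s
    unfolding arrow_def using assms that by (intro regular_on_poly poly_functions.coord) (simp_all add: arcs_iff)
qed

lemma mat_regular_one_plus:
  assumes "X \<subseteq> Rep G d" "x \<in> nodes G" "y \<in> nodes G" "x \<noteq> y"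
  shows "mat_regular G d X (d x) (d x) (\<lambda>\<rho>. one_plus d (arrow G \<rho>) x y)"
  by (intro mat_regular_add mat_regular_one mat_regular_mult[where l = "d y"] mat_regular_arrow)
     (use assms in auto)

text \<open>Only the new arrow has to be checked: the others are coordinates, and the group acts on
  them as before.\<close>

lemma set_arrow_morphism:
  assumes X: "X \<subseteq> Rep G d" and xy: "x \<in> nodes G" "y \<in> nodes G" "x \<noteq> y"
    and U: "mat_regular G d X (d x) (d y) U"
    and eqv: "\<And>h \<rho>. h \<in> gauge_group G d \<Longrightarrow> \<rho> \<in> X \<Longrightarrow> U (gauge_act G h \<rho>) = h x * U \<rho> * minv (h y)"
    and Y: "\<And>\<rho>. \<rho> \<in> X \<Longrightarrow> set_arrow x y (U \<rho>) \<rho> \<in> Y"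
  shows "equivariant_morphism G d X Y (\<lambda>\<rho>. set_arrow x y (U \<rho>) \<rho>)"
  unfolding equivariant_morphism_def
proof (intro conjI ballI)
  show "(\<lambda>\<rho>. set_arrow x y (U \<rho>) \<rho>) \<in> X \<rightarrow> Y" using Y by blast
  show "regular_map G d X (\<lambda>\<rho>. set_arrow x y (U \<rho>) \<rho>)"
    unfolding regular_map_def
  proof clarify
    fix e a b assume "(e, a, b) \<in> arcs G"
    then have ab: "a \<in> nodes G" "b \<in> nodes G" "a \<noteq> b" "e = the_edge G a b" by (auto simp: arcs_iff)
    have "(\<lambda>\<rho>. set_arrow x y (U \<rho>) \<rho> (e, a, b)) = (if a = x \<and> b = y then U else (\<lambda>\<rho>. arrow G \<rho> a b))"
      unfolding ab(4) set_arrow_def arrow_def by auto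
    then show "mat_regular G d X (d a) (d b) (\<lambda>\<rho>. set_arrow x y (U \<rho>) \<rho> (e, a, b))"
      using U mat_regular_arrow[OF X ab(1-3)] by auto
  qed
  fix h \<rho> assume h: "h \<in> gauge_group G d" and \<rho>: "\<rho> \<in> X"
  show "set_arrow x y (U (gauge_act G h \<rho>)) (gauge_act G h \<rho>) = gauge_act G h (set_arrow x y (U \<rho>) \<rho>)"
    unfolding eqv[OF h \<rho>] using xy
    by (intro ext) (auto simp: set_arrow_def gauge_act_def restrict_def arcs_iff)
qed

lemma equivariantly_isomorphic_refl:
  assumes "X \<subseteq> Rep G d"
  shows "equivariantly_isomorphic G d X X"
proof -
  have "mat_regular G d X (d a) (d b) (\<lambda>\<rho>. \<rho> (e, a, b))" if "(e, a, b) \<in> arcs G" for e a b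
    using that mat_regular_arrow[OF assms] unfolding arrow_def by (auto simp: arcs_iff)
  then have "equivariant_morphism G d X X (\<lambda>\<rho>. \<rho>)"
    unfolding equivariant_morphism_def regular_map_def by auto
  then show ?thesis unfolding equivariantly_isomorphic_def by auto
qed

lemma minv_one_plus_arrow_gauge_act:
  assumes \<rho>: "\<rho> \<in> Rep G d" and h: "h \<in> gauge_group G d"
    and n: "x \<in> nodes G" "y \<in> nodes G" "x \<noteq> y" "z \<in> nodes G" "x \<noteq> z"
    and E: "one_plus d (arrow G \<rho>) x z \<in> GL (d x)"
  shows "minv (one_plus d (arrow G (gauge_act G h \<rho>)) x z) * arrow G (gauge_act G h \<rho>) x y
      = h x * (minv (one_plus d (arrow G \<rho>) x z) * arrow G \<rho> x y) * minv (h y)"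
    "one_plus d (arrow G (gauge_act G h \<rho>)) x z * arrow G (gauge_act G h \<rho>) x y
      = h x * (one_plus d (arrow G \<rho>) x z * arrow G \<rho> x y) * minv (h y)"
proof -
  note hx = gauge_group_GL[OF h n(1)] and hy = gauge_group_GL[OF h n(2)]
  have d: "dim_row (one_plus d (arrow G \<rho>) x z) = d x" "dim_col (one_plus d (arrow G \<rho>) x z) = d x"
    using GL_dim[OF E] by auto
  note [simp] = GL_dim[OF hx] GL_dim[OF hy] minv_dim[OF hx] minv_dim[OF hy] arrow_dim[OF \<rho> n(1-3)] minv_dim[OF E]
  show "minv (one_plus d (arrow G (gauge_act G h \<rho>)) x z) * arrow G (gauge_act G h \<rho>) x y
      = h x * (minv (one_plus d (arrow G \<rho>) x z) * arrow G \<rho> x y) * minv (h y)"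
    unfolding one_plus_gauge_act[OF \<rho> h n(1,4,5)] GL_conj(2)[OF hx E] arrow_gauge_act[OF n(1-3)]
    by (simp add: mat_assoc_dim minv_cancel[OF hx])
  show "one_plus d (arrow G (gauge_act G h \<rho>)) x z * arrow G (gauge_act G h \<rho>) x y
      = h x * (one_plus d (arrow G \<rho>) x z * arrow G \<rho> x y) * minv (h y)"
    unfolding one_plus_gauge_act[OF \<rho> h n(1,4,5)] arrow_gauge_act[OF n(1-3)]
    using d by (simp add: mat_assoc_dim minv_cancel[OF hx] del: index_add_mat)
qed

text \<open>The factor \<open>one_plus d (arrow G \<rho>) x z\<close> does not involve the arrow
  that is changed, so it is the same before and after, and multiplying by it undoes multiplying by
  its inverse.\<close>

lemma rescaling_isomorphism:
  assumes X: "X \<subseteq> Rep G d" and n: "x \<in> nodes G" "y \<in> nodes G" "z \<in> nodes G" "x \<noteq> y" "x \<noteq> z" "y \<noteq> z"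
    and iff: "\<And>\<rho>. \<rho> \<in> Rep G d \<Longrightarrow> \<rho> \<in> X \<longleftrightarrow> one_plus d (arrow G \<rho>) x z \<in> GL (d x) \<and>
      set_arrow x y (minv (one_plus d (arrow G \<rho>) x z) * arrow G \<rho> x y) \<rho> \<in> edge_fibre G lt q d"
  shows "equivariantly_isomorphic G d X (edge_fibre G lt q d)"
proof -
  let ?Y = "edge_fibre G lt q d"
  let ?E = "\<lambda>\<rho>. one_plus d (arrow G \<rho>) x z"
  define \<Phi> where "\<Phi> = (\<lambda>\<rho>. set_arrow x y (minv (?E \<rho>) * arrow G \<rho> x y) \<rho>)"
  define \<Psi> where "\<Psi> = (\<lambda>\<rho>. set_arrow x y (?E \<rho> * arrow G \<rho> x y) \<rho>)"
  have Y: "?Y \<subseteq> Rep G d" using edge_fibreD(1) by blast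
  have E: "?E \<rho> \<in> GL (d x)" if "\<rho> \<in> X \<union> ?Y" for \<rho>
    using that iff X edge_fibreD(2)[OF _ n(1,3,5)] by blast
  have ar: "dim_row (arrow G \<rho> x y) = d x" if "\<rho> \<in> X \<union> ?Y" for \<rho>
    using arrow_dim[OF _ n(1,2,4)] that X Y by blast
  have E': "?E (set_arrow x y u \<rho>) = ?E \<rho>" for u \<rho> using n by simp
  have inv1: "\<Psi> (\<Phi> \<rho>) = \<rho>" if "\<rho> \<in> X" for \<rho>
    unfolding \<Phi>_def \<Psi>_def E' set_arrow_set_arrow
    by (rule set_arrow_same) (simp add: minv_cancel(1)[OF E ar] that)
  have inv2: "\<Phi> (\<Psi> \<rho>) = \<rho>" if "\<rho> \<in> ?Y" for \<rho>
    unfolding \<Phi>_def \<Psi>_def E' set_arrow_set_arrow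
    by (rule set_arrow_same) (simp add: minv_cancel(2)[OF E ar] that)
  have "\<Psi> \<rho> \<in> X" if "\<rho> \<in> ?Y" for \<rho>
  proof -
    have "\<Psi> \<rho> \<in> Rep G d" unfolding \<Psi>_def
    proof (rule set_arrow_Rep)
      show "?E \<rho> * arrow G \<rho> x y \<in> carrier_mat (d x) (d y)"
        using GL_carrier[OF E] arrow_carrier[OF _ n(1,2,4)] that Y by (intro mult_carrier_mat[where n = "d x"]) blast+
    qed (use that Y n in auto)
    moreover have "?E (\<Psi> \<rho>) \<in> GL (d x)" using E[of \<rho>] that unfolding \<Psi>_def E' by blast
    ultimately show ?thesis using iff inv2[OF that] that unfolding \<Phi>_def by simp
  qed
  then have \<Psi>: "equivariant_morphism G d ?Y X \<Psi>"
    unfolding \<Psi>_def using Y n E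
    by (intro set_arrow_morphism mat_regular_mult[where l = "d x"] mat_regular_one_plus mat_regular_arrow
        minv_one_plus_arrow_gauge_act(2)) blast+
  have \<Phi>: "equivariant_morphism G d X ?Y \<Phi>"
    unfolding \<Phi>_def using X n E iff
    by (intro set_arrow_morphism mat_regular_mult[where l = "d x"] mat_regular_minv mat_regular_one_plus mat_regular_arrow
        minv_one_plus_arrow_gauge_act(1)) blast+
  show ?thesis unfolding equivariantly_isomorphic_def using \<Phi> \<Psi> inv1 inv2 by blast
qed

text \<open>Reversing the orientation of the edge \<open>xy\<close> is undone by the involution
  \<open>v\<^sub>x\<^sub>y \<mapsto> - (1 + v\<^sub>x\<^sub>y v\<^sub>y\<^sub>x)\<^sup>-\<^sup>1 v\<^sub>x\<^sub>y\<close>, which inverts \<open>1 + v\<^sub>x\<^sub>y v\<^sub>y\<^sub>x\<close> and \<open>1 + v\<^sub>y\<^sub>x v\<^sub>x\<^sub>y\<close>.\<close>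

lemma one_plus_flip:
  assumes A: "A \<in> carrier_mat m n" and B: "B \<in> carrier_mat n m" and I: "1\<^sub>m m + A * B \<in> GL m"
  shows "1\<^sub>m m + - (minv (1\<^sub>m m + A * B) * A) * B = minv (1\<^sub>m m + A * B)"
    "1\<^sub>m n + B * - (minv (1\<^sub>m m + A * B) * A) = minv (1\<^sub>m n + B * A)"
    "- (minv (minv (1\<^sub>m m + A * B)) * - (minv (1\<^sub>m m + A * B) * A)) = A"
proof -
  let ?X = "1\<^sub>m m + A * B"
  note [simp] = minv_dim[OF I]
  have [simp]: "dim_row A = m" "dim_col A = n" "dim_row B = n" "dim_col B = m" using A B by auto
  have "minv ?X = minv ?X * (?X - A * B)"
  proof -
    have "?X - A * B = 1\<^sub>m m" by (rule eq_matI) (simp_all del: index_mult_mat(1))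
    then show ?thesis by (simp add: mat_one_dim)
  qed
  also have "\<dots> = 1\<^sub>m m - minv ?X * (A * B)" using minv_GL(4)[OF I] by (simp add: mat_distrib_dim(3))
  also have "\<dots> = 1\<^sub>m m + - (minv ?X * A) * B" by (rule eq_matI) (simp_all add: mat_assoc_dim del: index_mult_mat(1))
  finally show "1\<^sub>m m + - (minv ?X * A) * B = minv ?X" ..
  show "1\<^sub>m n + B * - (minv ?X * A) = minv (1\<^sub>m n + B * A)"
    unfolding one_plus_swap(2)[OF A B I] by (rule eq_matI) (simp_all add: mat_assoc_dim del: index_mult_mat(1))
  have "?X * - (minv ?X * A) = - (?X * (minv ?X * A))" by (rule uminus_mult_right_mat) simp
  also have "\<dots> = - A" using minv_cancel(1)[OF I, of A] by simp
  finally show "- (minv (minv ?X) * - (minv ?X * A)) = A" unfolding minv_minv[OF I] by simp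
qed

text \<open>The involution inverts \<open>one_plus\<close> at both ends of the edge, while the
  orientation decides at which end an inverse is taken. Reversing it compensates the involution, so
  every contribution is preserved. The same map serves in both directions, hence the auxiliary
  statement for arbitrary \<open>l\<close> and \<open>l'\<close>.\<close>

lemma flip_isomorphism:
  assumes n: "x \<in> nodes G" "y \<in> nodes G" "x \<noteq> y"
    and lt: "lt' x y = (\<not> lt x y)" "lt' y x = (\<not> lt y x)"
    and lt': "\<And>a b. {a, b} \<noteq> {x, y} \<Longrightarrow> lt' a b = lt a b"
  shows "equivariantly_isomorphic G d (edge_fibre G lt q d) (edge_fibre G lt' q d)"
proof -
  let ?E = "\<lambda>\<rho>. one_plus d (arrow G \<rho>) x y"
  define \<Phi> where "\<Phi> = (\<lambda>\<rho>. set_arrow x y (- (minv (?E \<rho>) * arrow G \<rho> x y)) \<rho>)"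
  have main: "equivariant_morphism G d (edge_fibre G l q d) (edge_fibre G l' q d) \<Phi> \<and>
     (\<forall>\<rho>\<in>edge_fibre G l q d. \<Phi> (\<Phi> \<rho>) = \<rho>)"
    if l: "l' x y = (\<not> l x y)" "l' y x = (\<not> l y x)" "\<And>a b. {a, b} \<noteq> {x, y} \<Longrightarrow> l' a b = l a b" for l l'
  proof -
    let ?X = "edge_fibre G l q d"
    have X: "?X \<subseteq> Rep G d" using edge_fibreD(1) by blast
    have E: "?E \<rho> \<in> GL (d x)" if "\<rho> \<in> ?X" for \<rho>
      using that edge_fibreD(2)[OF _ n] by blast
    have fl: "1\<^sub>m (d x) + - (minv (?E \<rho>) * arrow G \<rho> x y) * arrow G \<rho> y x = minv (?E \<rho>)"
      "1\<^sub>m (d y) + arrow G \<rho> y x * - (minv (?E \<rho>) * arrow G \<rho> x y) = minv (one_plus d (arrow G \<rho>) y x)"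
      "- (minv (minv (?E \<rho>)) * - (minv (?E \<rho>) * arrow G \<rho> x y)) = arrow G \<rho> x y"
      if "\<rho> \<in> ?X" for \<rho>
      using one_plus_flip[of "arrow G \<rho> x y" "d x" "d y" "arrow G \<rho> y x"]
        arrow_carrier[OF edge_fibreD(1)[OF that] n] arrow_carrier[OF edge_fibreD(1)[OF that] n(2,1) n(3)[symmetric]]
        E[OF that] by simp_all
    have op: "?E (\<Phi> \<rho>) = minv (?E \<rho>)" "one_plus d (arrow G (\<Phi> \<rho>)) y x = minv (one_plus d (arrow G \<rho>) y x)"
      if "\<rho> \<in> ?X" for \<rho>
      using fl(1,2)[OF that] n unfolding \<Phi>_def by simp_all
    have op': "one_plus d (arrow G (\<Phi> \<rho>)) a b = one_plus d (arrow G \<rho>) a b" if "{a, b} \<noteq> {x, y}" for a b \<rho>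
    proof -
      have "\<not> (a = x \<and> b = y)" "\<not> (b = x \<and> a = y)" using that by auto
      then show ?thesis unfolding \<Phi>_def arrow_set_arrow by (simp only: if_False)
    qed
    have ctr: "edge_contribution l' d (arrow G (\<Phi> \<rho>)) a b = edge_contribution l d (arrow G \<rho>) a b"
      if "\<rho> \<in> ?X" for \<rho> a b
    proof (cases "{a, b} = {x, y}")
      case True
      then consider "a = x" "b = y" | "a = y" "b = x" by (auto simp: doubleton_eq_iff)
      then show ?thesis
        using op[OF that] l(1,2) minv_minv[OF E[OF that]] minv_minv[OF edge_fibreD(2)[OF that n(2,1) n(3)[symmetric]]]
        unfolding edge_contribution_def by cases auto
    next
      case False
      then show ?thesis using op'[OF False] l(3)[OF False] unfolding edge_contribution_def by simp
    qed
    have im: "\<Phi> \<rho> \<in> edge_fibre G l' q d" if \<rho>: "\<rho> \<in> ?X" for \<rho>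
    proof -
      have "- (minv (?E \<rho>) * arrow G \<rho> x y) \<in> carrier_mat (d x) (d y)"
        using minv_dim[OF E[OF \<rho>]] arrow_dim[OF _ n, of \<rho> d] \<rho> X by (intro carrier_matI) auto
      then have "\<Phi> \<rho> \<in> Rep G d" unfolding \<Phi>_def using \<rho> X n by (intro set_arrow_Rep) auto
      moreover have "one_plus d (arrow G (\<Phi> \<rho>)) a b \<in> GL (d a)" if ab: "a \<in> nodes G" "b \<in> nodes G" "a \<noteq> b" for a b
      proof (cases "{a, b} = {x, y}")
        case True
        then consider "a = x" "b = y" | "a = y" "b = x" by (auto simp: doubleton_eq_iff)
        then show ?thesis
        proof cases
          case 1
          show ?thesis unfolding 1 op(1)[OF \<rho>] by (rule minv_GL(5)[OF E[OF \<rho>]])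
        next
          case 2
          show ?thesis unfolding 2 op(2)[OF \<rho>]
            by (rule minv_GL(5)[OF edge_fibreD(2)[OF \<rho> n(2,1) n(3)[symmetric]]])
        qed
      next
        case False
        then show ?thesis unfolding op'[OF False] by (intro edge_fibreD(2)[OF \<rho>] ab)
      qed
      ultimately show ?thesis using \<rho> ctr[OF \<rho>] unfolding edge_fibre_def by auto
    qed
    have "equivariant_morphism G d ?X (edge_fibre G l' q d) \<Phi>"
      unfolding \<Phi>_def
    proof (rule set_arrow_morphism[OF X n])
      show "mat_regular G d ?X (d x) (d y) (\<lambda>\<rho>. - (minv (?E \<rho>) * arrow G \<rho> x y))"
        using X n E by (intro mat_regular_uminus mat_regular_mult[where l = "d x"] mat_regular_minv
          mat_regular_one_plus mat_regular_arrow)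
      show "set_arrow x y (- (minv (?E \<rho>) * arrow G \<rho> x y)) \<rho> \<in> edge_fibre G l' q d" if "\<rho> \<in> ?X" for \<rho>
        using im[OF that] unfolding \<Phi>_def .
      fix h \<rho> assume h: "h \<in> gauge_group G d" and \<rho>: "\<rho> \<in> ?X"
      then have \<rho>': "\<rho> \<in> Rep G d" using X by blast
      note hx = gauge_group_GL[OF h n(1)] and hy = gauge_group_GL[OF h n(2)]
      note [simp] = GL_dim[OF hx] minv_dim[OF hy] minv_dim[OF E[OF \<rho>]] arrow_dim[OF \<rho>' n]
      show "- (minv (?E (gauge_act G h \<rho>)) * arrow G (gauge_act G h \<rho>) x y) =
          h x * - (minv (?E \<rho>) * arrow G \<rho> x y) * minv (h y)"
        unfolding minv_one_plus_arrow_gauge_act(1)[OF \<rho>' h n n(2,3) E[OF \<rho>]] by simp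
    qed
    moreover have "\<Phi> (\<Phi> \<rho>) = \<rho>" if "\<rho> \<in> ?X" for \<rho>
    proof -
      have "\<Phi> (\<Phi> \<rho>) = set_arrow x y (- (minv (?E (\<Phi> \<rho>)) * arrow G (\<Phi> \<rho>) x y)) (\<Phi> \<rho>)"
        unfolding \<Phi>_def ..
      also have "\<dots> = set_arrow x y (- (minv (minv (?E \<rho>)) * - (minv (?E \<rho>) * arrow G \<rho> x y))) \<rho>"
        unfolding op(1)[OF that] by (simp add: \<Phi>_def)
      also have "\<dots> = \<rho>"
        by (rule set_arrow_same) (rule fl(3)[OF that])
      finally show ?thesis .
    qed
    ultimately show ?thesis by blast
  qed
  have 1: "equivariant_morphism G d (edge_fibre G lt q d) (edge_fibre G lt' q d) \<Phi> \<and>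
     (\<forall>\<rho>\<in>edge_fibre G lt q d. \<Phi> (\<Phi> \<rho>) = \<rho>)"
    by (rule main) (use lt lt' in auto)
  have 2: "equivariant_morphism G d (edge_fibre G lt' q d) (edge_fibre G lt q d) \<Phi> \<and>
     (\<forall>\<rho>\<in>edge_fibre G lt' q d. \<Phi> (\<Phi> \<rho>) = \<rho>)"
    by (rule main) (use lt lt' in auto)
  show ?thesis unfolding equivariantly_isomorphic_def using 1 2 by blast
qed

lemma edge_fibre_isomorphic:
  assumes lt: "\<And>x y. x \<in> nodes G \<Longrightarrow> y \<in> nodes G \<Longrightarrow> x \<noteq> y \<Longrightarrow> lt x y \<longleftrightarrow> \<not> lt y x"
    and lt': "\<And>x y. x \<in> nodes G \<Longrightarrow> y \<in> nodes G \<Longrightarrow> x \<noteq> y \<Longrightarrow> lt' x y \<longleftrightarrow> \<not> lt' y x"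
  shows "equivariantly_isomorphic G d (edge_fibre G lt q d) (edge_fibre G lt' q d)"
proof -
  \<comment> \<open>\<open>mix P l\<close> takes the orientation of the edge \<open>P\<close> from
    \<open>lt'\<close> and all others from \<open>l\<close>, so that one edge is reoriented at a
    time. The intermediate orientations can be cyclic.\<close>
  define mix where "mix = (\<lambda>P l x y. if {x, y} = P then lt' x y else l x y)"
    for P :: "'v set" and l :: "'v \<Rightarrow> 'v \<Rightarrow> bool"
  have step: "equivariantly_isomorphic G d (edge_fibre G l q d) (edge_fibre G (mix {x, y} l) q d)"
    if xy: "x \<in> nodes G" "y \<in> nodes G" "x \<noteq> y" and l: "l x y \<longleftrightarrow> \<not> l y x" for l x y
  proof (cases "l x y = lt' x y")
    case True
    then have "mix {x, y} l = l" using l lt'[OF xy] by (auto simp: mix_def fun_eq_iff doubleton_eq_iff)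
    then show ?thesis using equivariantly_isomorphic_refl[of "edge_fibre G l q d" d] edge_fibreD(1) by auto
  next
    case False
    then show ?thesis
      by (intro flip_isomorphism[OF xy]) (use l lt'[OF xy] in \<open>auto simp: mix_def insert_commute\<close>)
  qed
  obtain x y z where N: "nodes G = {x, y, z}" "x \<noteq> y" "x \<noteq> z" "y \<noteq> z" by (rule nodes_three)
  let ?l = "mix {y, z} (mix {x, z} (mix {x, y} lt))"
  have L: "lt x y = (\<not> lt y x)" "lt x z = (\<not> lt z x)" "lt y z = (\<not> lt z y)"
    by (rule lt; use N in simp)+
  have 1: "equivariantly_isomorphic G d (edge_fibre G lt q d) (edge_fibre G (mix {x, y} lt) q d)"
    by (rule step) (use N L in auto)
  have 2: "equivariantly_isomorphic G d (edge_fibre G (mix {x, y} lt) q d) (edge_fibre G (mix {x, z} (mix {x, y} lt)) q d)"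
    by (rule step) (use N L in \<open>auto simp: mix_def doubleton_eq_iff\<close>)
  have 3: "equivariantly_isomorphic G d (edge_fibre G (mix {x, z} (mix {x, y} lt)) q d) (edge_fibre G ?l q d)"
    by (rule step) (use N L in \<open>auto simp: mix_def doubleton_eq_iff\<close>)
  have "edge_fibre G ?l q d = edge_fibre G lt' q d"
    by (rule edge_fibre_cong) (use N in \<open>auto simp: mix_def insert_commute\<close>)
  then show ?thesis
    using equivariantly_isomorphic_trans[OF equivariantly_isomorphic_trans[OF 1 2] 3] by simp
qed

end

section \<open>Moment fibres of the colourings with two or three colours\<close>

lemma node_less_partition:
  assumes "is_ordering H ps"
  shows "distinct (concat ps)" "set (concat ps) = nodes H"
  using assms unfolding is_ordering_def complete_multipartite_def partition_on_def by auto

text \<open>A solution \<open>g\<close> is arbitrary off the nodes of its colour, so the definite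
  description is over the value at \<open>x\<close> and not over \<open>g\<close>.\<close>

lemma colour_moment_eq:
  assumes "\<And>g. colour_factorises G \<kappa> \<omega> d \<rho> c g \<Longrightarrow> g x = A" "\<exists>g. colour_factorises G \<kappa> \<omega> d \<rho> c g"
  shows "colour_moment G \<kappa> \<omega> d \<rho> c x = A"
  unfolding colour_moment_def using assms by (intro the_equality) auto

context triangle_graph
begin

text \<open>Each edge is oriented by the order that belongs to its own colour. As different colours
  carry unrelated orders, this is an orientation of the triangle and in general not an order of its
  nodes.\<close>

definition colour_less :: "('e \<Rightarrow> 'c) \<Rightarrow> ('v, 'c) choices \<Rightarrow> 'v \<Rightarrow> 'v \<Rightarrow> bool" where
  "colour_less \<kappa> \<omega> x y = node_less (part_order \<omega> (\<kappa> (the_edge G x y))) x y"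

lemma mono_nodes_iff:
  "x \<in> nodes (mono_subgraph G \<kappa> c) \<longleftrightarrow> x \<in> nodes G \<and> (\<exists>y\<in>nodes G. y \<noteq> x \<and> \<kappa> (the_edge G x y) = c)"
proof
  assume "x \<in> nodes (mono_subgraph G \<kappa> c)"
  then obtain e where e: "e \<in> edges G" "\<kappa> e = c" "x \<in> ends G e" unfolding mono_subgraph_def by auto
  obtain a b where ab: "a \<in> nodes G" "b \<in> nodes G" "a \<noteq> b" "e = the_edge G a b" by (rule edge_cases[OF e(1)])
  then have "x = a \<or> x = b" using e the_edge(2)[OF ab(1-3)] by auto
  then show "x \<in> nodes G \<and> (\<exists>y\<in>nodes G. y \<noteq> x \<and> \<kappa> (the_edge G x y) = c)"
    using ab e the_edge_commute by metis
next
  assume a: "x \<in> nodes G \<and> (\<exists>y\<in>nodes G. y \<noteq> x \<and> \<kappa> (the_edge G x y) = c)"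
  then obtain y where y: "x \<in> nodes G" "y \<in> nodes G" "x \<noteq> y" "\<kappa> (the_edge G x y) = c" by auto
  have "the_edge G x y \<in> {e \<in> edges G. \<kappa> e = c}" "x \<in> ends G (the_edge G x y)"
    using y(4) by (simp_all add: the_edge(1,2)[OF y(1-3)])
  then show "x \<in> nodes (mono_subgraph G \<kappa> c)" unfolding mono_subgraph_def by (simp del: mem_Collect_eq) blast
qed

lemma edge_map_eq:
  assumes "x \<in> nodes G" "y \<in> nodes G"
  shows "edge_map G \<kappa> d \<rho> c x y =
    (if x \<noteq> y \<and> \<kappa> (the_edge G x y) = c then arrow G \<rho> x y else 0\<^sub>m (d x) (d y))"
proof (cases "x = y")
  case True
  have "\<not> (\<exists>e\<in>edges G. \<kappa> e = c \<and> ends G e = {x, y})"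
    using triangle True unfolding triangle_def fin_graph_def by force
  then have "edge_map G \<kappa> d \<rho> c x y = 0\<^sub>m (d x) (d y)" unfolding edge_map_def by (rule if_not_P)
  then show ?thesis using True by simp
next
  case False
  note e = the_edge[OF assms False]
  have 1: "(\<exists>e\<in>edges G. \<kappa> e = c \<and> ends G e = {x, y}) \<longleftrightarrow> \<kappa> (the_edge G x y) = c" using e by metis
  have 2: "(THE e. e \<in> edges G \<and> \<kappa> e = c \<and> ends G e = {x, y}) = the_edge G x y" if "\<kappa> (the_edge G x y) = c"
    using e that by (intro the_equality) blast+
  show ?thesis unfolding edge_map_def 1 using 2 False by (simp add: arrow_def)
qed

lemma edge_map_carrier:
  assumes "\<rho> \<in> Rep G d" "x \<in> nodes G" "y \<in> nodes G"
  shows "edge_map G \<kappa> d \<rho> c x y \<in> carrier_mat (d x) (d y)"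
  unfolding edge_map_eq[OF assms(2,3)] using arrow_carrier[OF assms] by simp

lemma colour_less_iff:
  assumes "valid_choices G \<kappa> \<omega>" "x \<in> nodes G" "y \<in> nodes G" "x \<noteq> y"
  shows "colour_less \<kappa> \<omega> x y \<longleftrightarrow> \<not> colour_less \<kappa> \<omega> y x"
proof -
  let ?c = "\<kappa> (the_edge G x y)"
  have "is_ordering (mono_subgraph G \<kappa> ?c) (part_order \<omega> ?c)"
    using assms(1) the_edge(1)[OF assms(2-4)] unfolding valid_choices_def by auto
  note o = node_less_partition[OF this]
  have "x \<in> set (concat (part_order \<omega> ?c))" "y \<in> set (concat (part_order \<omega> ?c))"
    unfolding o(2) mono_nodes_iff using assms the_edge_commute by metis+
  then show ?thesis
    using node_less_total[of x _ y] node_less_asym(1)[OF o(1)] assms(4)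
    unfolding colour_less_def the_edge_commute[of y x] by metis
qed

text \<open>Either end may be the smaller one; exchanging the names of the ends reduces to an
  increasing pair.\<close>

lemma colour_factorises_edge:
  assumes \<omega>: "valid_choices G \<kappa> \<omega>" and n: "x \<in> nodes G" "y \<in> nodes G" "x \<noteq> y" and \<rho>: "\<rho> \<in> Rep G d"
    and c: "\<kappa> (the_edge G x y) = c" and N: "nodes (mono_subgraph G \<kappa> c) = {x, y}"
  shows "colour_factorises G \<kappa> \<omega> d \<rho> c g \<longleftrightarrow>
    (one_plus d (arrow G \<rho>) x y \<in> GL (d x) \<and> one_plus d (arrow G \<rho>) y x \<in> GL (d y)) \<and>
    g x = edge_contribution (colour_less \<kappa> \<omega>) d (arrow G \<rho>) x y \<and>
    g y = edge_contribution (colour_less \<kappa> \<omega>) d (arrow G \<rho>) y x"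
proof -
  have main: "colour_factorises G \<kappa> \<omega> d \<rho> c g \<longleftrightarrow>
    (one_plus d (arrow G \<rho>) a b \<in> GL (d a) \<and> one_plus d (arrow G \<rho>) b a \<in> GL (d b)) \<and>
    g b = one_plus d (arrow G \<rho>) b a \<and> g a = minv (one_plus d (arrow G \<rho>) a b)"
    if ab: "a \<in> nodes G" "b \<in> nodes G" "a \<noteq> b" "{a, b} = {x, y}" "colour_less \<kappa> \<omega> a b" for a b
  proof -
    let ?v = "edge_map G \<kappa> d \<rho> c" and ?lt = "node_less (part_order \<omega> c)"
    have cab: "\<kappa> (the_edge G a b) = c" "\<kappa> (the_edge G b a) = c"
      using c the_edge_commute ab(3,4) by (metis doubleton_eq_iff)+
    have lt: "?lt a b" "\<not> ?lt b a"
      using colour_less_iff[OF \<omega> ab(1-3)] ab(5) unfolding colour_less_def cab by auto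
    have v: "?v a b = arrow G \<rho> a b" "?v b a = arrow G \<rho> b a"
      using ab cab by (simp_all add: edge_map_eq)
    have "factorises {a, b} d ?lt (tri_product {a, b} d ?lt ?v) g \<longleftrightarrow>
      one_plus d ?v a b \<in> GL (d a) \<and> one_plus d ?v b a \<in> GL (d b) \<and> g b = one_plus d ?v b a \<and> g a = minv (one_plus d ?v a b)"
      by (rule factorises_edge) (use ab(1-3) lt edge_map_carrier[OF \<rho>] in auto)
    then show ?thesis
      unfolding colour_factorises_def colour_product_def Let_def N ab(4)[symmetric] v by blast
  qed
  show ?thesis
  proof (cases "colour_less \<kappa> \<omega> x y")
    case True
    then show ?thesis using main[OF n refl True] colour_less_iff[OF \<omega> n]
      unfolding edge_contribution_def by auto
  next
    case False
    then have "colour_less \<kappa> \<omega> y x" using colour_less_iff[OF \<omega> n] by simp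
    from main[OF n(2,1) n(3)[symmetric] insert_commute this] show ?thesis
      using False \<open>colour_less \<kappa> \<omega> y x\<close> unfolding edge_contribution_def by auto
  qed
qed

lemma moment_map_single:
  assumes \<omega>: "valid_choices G \<kappa> \<omega>" and x: "x \<in> nodes G"
    and cs: "{c \<in> \<kappa> ` edges G. x \<in> nodes (mono_subgraph G \<kappa> c)} = {c}"
    and A: "colour_moment G \<kappa> \<omega> d \<rho> c x = A" "A \<in> carrier_mat (d x) (d x)"
  shows "moment_map G \<kappa> \<omega> d \<rho> x = A"
proof -
  let ?l = "filter (\<lambda>c. x \<in> nodes (mono_subgraph G \<kappa> c)) (colour_order \<omega> x)"
  have l: "set ?l = {c}" "distinct ?l" using \<omega> x cs unfolding valid_choices_def by auto
  then have "length ?l = 1" using distinct_card[OF l(2)] by simp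
  then obtain a where "?l = [a]" by (metis One_nat_def length_0_conv length_Suc_conv)
  then have "?l = [c]" using l(1) by simp
  then show ?thesis unfolding moment_map_def using A by simp
qed

text \<open>The colour list at \<open>x\<close> filters to \<open>[c, c']\<close> or
  \<open>[c', c]\<close>, so the moment map is \<open>A * B\<close> or \<open>B * A\<close>, and one
  equals the nonzero scalar exactly when the other does.\<close>

lemma moment_map_pair:
  assumes \<omega>: "valid_choices G \<kappa> \<omega>" and x: "x \<in> nodes G" "q \<noteq> 0"
    and cs: "{c \<in> \<kappa> ` edges G. x \<in> nodes (mono_subgraph G \<kappa> c)} = {c, c'}" "c \<noteq> c'"
    and A: "colour_moment G \<kappa> \<omega> d \<rho> c x = A" "A \<in> GL (d x)"
    and B: "colour_moment G \<kappa> \<omega> d \<rho> c' x = B" "B \<in> GL (d x)"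
  shows "moment_map G \<kappa> \<omega> d \<rho> x = q \<cdot>\<^sub>m 1\<^sub>m (d x) \<longleftrightarrow> A * B = q \<cdot>\<^sub>m 1\<^sub>m (d x)"
proof -
  let ?l = "filter (\<lambda>c. x \<in> nodes (mono_subgraph G \<kappa> c)) (colour_order \<omega> x)"
  have l: "set ?l = {c, c'}" "distinct ?l" using \<omega> x cs unfolding valid_choices_def by auto
  then have "length ?l = 2" using cs(2) distinct_card[OF l(2)] by simp
  then obtain a b where ab: "?l = [a, b]" by (metis (no_types) length_0_conv length_Suc_conv numeral_2_eq_2)
  have "set [a, b] = {c, c'}" using l(1) unfolding ab .
  then have "?l = [c, c'] \<or> ?l = [c', c]" unfolding ab using cs(2) by (auto simp: doubleton_eq_iff)
  then show ?thesis
  proof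
    assume "?l = [c, c']"
    then show ?thesis unfolding moment_map_def using A B GL_carrier[OF B(2)] by simp
  next
    assume "?l = [c', c]"
    then have "moment_map G \<kappa> \<omega> d \<rho> x = B * A" unfolding moment_map_def using A B GL_carrier[OF A(2)] by simp
    then show ?thesis using GL_commute_scalar[OF A(2) B(2) _ x(2)] GL_commute_scalar[OF B(2) A(2) _ x(2)] by auto
  qed
qed

text \<open>An equality of sets and not just an isomorphism: each colour class is a single edge with
  an explicit factorisation, and exactly two colours meet at each node.\<close>

proposition moment_fibre_three_colours:
  assumes inj: "inj_on \<kappa> (edges G)" and \<omega>: "valid_choices G \<kappa> \<omega>" and q: "\<And>x. x \<in> nodes G \<Longrightarrow> q x \<noteq> 0"
  shows "moment_fibre G \<kappa> \<omega> q d = edge_fibre G (colour_less \<kappa> \<omega>) q d"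
proof -
  let ?ec = "\<lambda>\<rho>. edge_contribution (colour_less \<kappa> \<omega>) d (arrow G \<rho>)"
  have eqk: "\<kappa> (the_edge G x y) = \<kappa> (the_edge G a b) \<longleftrightarrow> {x, y} = {a, b}"
    if "x \<in> nodes G" "y \<in> nodes G" "x \<noteq> y" "a \<in> nodes G" "b \<in> nodes G" "a \<noteq> b" for x y a b
    using inj_on_eq_iff[OF inj the_edge(1)[OF that(1-3)] the_edge(1)[OF that(4-6)]] the_edge_eq_iff[OF that] by simp
  have N: "nodes (mono_subgraph G \<kappa> (\<kappa> (the_edge G x y))) = {x, y}"
    if xy: "x \<in> nodes G" "y \<in> nodes G" "x \<noteq> y" for x y
  proof (rule Set.set_eqI)
    fix a
    have "a \<in> nodes (mono_subgraph G \<kappa> (\<kappa> (the_edge G x y))) \<longleftrightarrow>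
        a \<in> nodes G \<and> (\<exists>b\<in>nodes G. b \<noteq> a \<and> {a, b} = {x, y})"
      unfolding mono_nodes_iff using eqk[OF _ _ _ xy] by metis
    also have "\<dots> \<longleftrightarrow> a \<in> {x, y}" using xy by (auto simp: doubleton_eq_iff)
    finally show "a \<in> nodes (mono_subgraph G \<kappa> (\<kappa> (the_edge G x y))) \<longleftrightarrow> a \<in> {x, y}" .
  qed
  note cf = colour_factorises_edge[OF \<omega> _ _ _ _ refl N]
  have "\<rho> \<in> moment_fibre G \<kappa> \<omega> q d \<longleftrightarrow> \<rho> \<in> edge_fibre G (colour_less \<kappa> \<omega>) q d" for \<rho>
  proof (cases "\<rho> \<in> Rep G d \<and> (\<forall>x\<in>nodes G. \<forall>y\<in>nodes G. x \<noteq> y \<longrightarrow> one_plus d (arrow G \<rho>) x y \<in> GL (d x))")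
    case False
    have "\<exists>x y. x \<in> nodes G \<and> y \<in> nodes G \<and> x \<noteq> y \<and> one_plus d (arrow G \<rho>) x y \<notin> GL (d x)" if "\<rho> \<in> Rep G d"
      using False that by blast
    moreover have "\<exists>g. colour_factorises G \<kappa> \<omega> d \<rho> (\<kappa> (the_edge G x y)) g"
      if "\<rho> \<in> Rep_star G \<kappa> \<omega> d" "x \<in> nodes G" "y \<in> nodes G" "x \<noteq> y" for x y
      using that the_edge(1)[OF that(2-4)] unfolding Rep_star_def by blast
    ultimately have "\<rho> \<notin> Rep_star G \<kappa> \<omega> d"
      using cf unfolding Rep_star_def by (metis (no_types, lifting) mem_Collect_eq)
    then show ?thesis using False unfolding moment_fibre_def edge_fibre_def by blast
  next
    case True
    then have \<rho>: "\<rho> \<in> Rep G d" and E: "\<And>x y. x \<in> nodes G \<Longrightarrow> y \<in> nodes G \<Longrightarrow> x \<noteq> y \<Longrightarrow> one_plus d (arrow G \<rho>) x y \<in> GL (d x)"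
      by blast+
    have cf': "colour_factorises G \<kappa> \<omega> d \<rho> (\<kappa> (the_edge G x y)) g \<longleftrightarrow> g x = ?ec \<rho> x y \<and> g y = ?ec \<rho> y x"
      if "x \<in> nodes G" "y \<in> nodes G" "x \<noteq> y" for x y g
      using cf[OF that \<rho> that, of g] E[OF that] E[OF that(2,1) that(3)[symmetric]] by blast
    have ex: "\<exists>g. colour_factorises G \<kappa> \<omega> d \<rho> (\<kappa> (the_edge G x y)) g"
      if "x \<in> nodes G" "y \<in> nodes G" "x \<noteq> y" for x y
      unfolding cf'[OF that] using that(3)
      by (intro exI[of _ "\<lambda>a. if a = x then ?ec \<rho> x y else ?ec \<rho> y x"]) auto
    have cm: "colour_moment G \<kappa> \<omega> d \<rho> (\<kappa> (the_edge G x y)) x = ?ec \<rho> x y"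
      if "x \<in> nodes G" "y \<in> nodes G" "x \<noteq> y" for x y
      by (rule colour_moment_eq) (use ex[OF that] cf'[OF that] in auto)
    have star: "\<rho> \<in> Rep_star G \<kappa> \<omega> d"
      unfolding Rep_star_def
    proof (intro CollectI conjI ballI \<rho>)
      fix c assume "c \<in> \<kappa> ` edges G"
      then obtain e where e: "e \<in> edges G" "c = \<kappa> e" by blast
      obtain x y where "x \<in> nodes G" "y \<in> nodes G" "x \<noteq> y" "e = the_edge G x y" by (rule edge_cases[OF e(1)])
      then show "\<exists>g. colour_factorises G \<kappa> \<omega> d \<rho> c g" unfolding e(2) using ex by simp
    qed
    have mm: "moment_map G \<kappa> \<omega> d \<rho> x = q x \<cdot>\<^sub>m 1\<^sub>m (d x) \<longleftrightarrow> ?ec \<rho> x y * ?ec \<rho> x z = q x \<cdot>\<^sub>m 1\<^sub>m (d x)"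
      if n: "x \<in> nodes G" "y \<in> nodes G" "z \<in> nodes G" "x \<noteq> y" "x \<noteq> z" "y \<noteq> z" for x y z
    proof (rule moment_map_pair[OF \<omega> n(1) q[OF n(1)] _ _ cm[OF n(1,2,4)] _ cm[OF n(1,3,5)]])
      obtain w where w: "nodes G = {x, y, w}" "w \<noteq> x" "w \<noteq> y" by (rule nodes_obtain[OF n(1,2,4)])
      then have N3: "nodes G = {x, y, z}" using n by auto
      show "\<kappa> (the_edge G x y) \<noteq> \<kappa> (the_edge G x z)"
        using eqk[OF n(1,2,4) n(1,3,5)] n by (auto simp: doubleton_eq_iff)
      show "{c \<in> \<kappa> ` edges G. x \<in> nodes (mono_subgraph G \<kappa> c)} = {\<kappa> (the_edge G x y), \<kappa> (the_edge G x z)}"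
        using the_edge(1)[OF n(1,2,4)] the_edge(1)[OF n(1,3,5)] n unfolding mono_nodes_iff N3 by auto
      show "?ec \<rho> x y \<in> GL (d x)" "?ec \<rho> x z \<in> GL (d x)"
        by (rule edge_contribution_GL, rule E; fact n)+
    qed
    have two: "\<exists>y z. y \<in> nodes G \<and> z \<in> nodes G \<and> x \<noteq> y \<and> x \<noteq> z \<and> y \<noteq> z" if "x \<in> nodes G" for x
    proof -
      obtain a b c where "nodes G = {a, b, c}" "a \<noteq> b" "a \<noteq> c" "b \<noteq> c" by (rule nodes_three)
      then show ?thesis using that by auto
    qed
    have "(\<forall>x\<in>nodes G. moment_map G \<kappa> \<omega> d \<rho> x = q x \<cdot>\<^sub>m 1\<^sub>m (d x)) \<longleftrightarrow>
      (\<forall>x\<in>nodes G. \<forall>y\<in>nodes G. \<forall>z\<in>nodes G. x \<noteq> y \<longrightarrow> x \<noteq> z \<longrightarrow> y \<noteq> z \<longrightarrow>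
        ?ec \<rho> x y * ?ec \<rho> x z = q x \<cdot>\<^sub>m 1\<^sub>m (d x))" (is "?L \<longleftrightarrow> ?R")
    proof
      assume ?L
      then show ?R using mm by blast
    next
      assume R: ?R
      show ?L
      proof
        fix x assume x: "x \<in> nodes G"
        obtain y z where yz: "y \<in> nodes G" "z \<in> nodes G" "x \<noteq> y" "x \<noteq> z" "y \<noteq> z" using two[OF x] by blast
        then show "moment_map G \<kappa> \<omega> d \<rho> x = q x \<cdot>\<^sub>m 1\<^sub>m (d x)" using R x mm[OF x yz] by blast
      qed
    qed
    then show ?thesis
      unfolding moment_fibre_def edge_fibre_def using True star by simp
  qed
  then show ?thesis by blast
qed


text \<open>Isolates what the two positions of the centre of the star have in common. Here
  \<open>\<rho>'\<close> is the rescaled representation in which the star of colour \<open>c\<close>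
  has become two independent edges, as \<open>star\<close> records. The arrows between
  \<open>y\<close> and \<open>z\<close> are unchanged, so the other colour may be evaluated on
  \<open>\<rho>'\<close> too.\<close>

lemma two_colour_fibre_iff:
  assumes \<omega>: "valid_choices G \<kappa> \<omega>" and q: "\<And>x. x \<in> nodes G \<Longrightarrow> q x \<noteq> 0"
    and N: "nodes G = {x, y, z}" "x \<noteq> y" "x \<noteq> z" "y \<noteq> z"
    and c: "\<kappa> (the_edge G x y) = c" "\<kappa> (the_edge G x z) = c" "\<kappa> (the_edge G y z) \<noteq> c"
    and \<rho>: "\<rho> \<in> Rep G d" and \<rho>': "\<rho>' \<in> Rep G d"
    and same: "arrow G \<rho>' y z = arrow G \<rho> y z" "arrow G \<rho>' z y = arrow G \<rho> z y"
    and star: "\<And>g. colour_factorises G \<kappa> \<omega> d \<rho> c g \<longleftrightarrow>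
      (one_plus d (arrow G \<rho>') x y \<in> GL (d x) \<and> one_plus d (arrow G \<rho>') y x \<in> GL (d y) \<and>
       one_plus d (arrow G \<rho>') x z \<in> GL (d x) \<and> one_plus d (arrow G \<rho>') z x \<in> GL (d z)) \<and>
      g x = edge_contribution (colour_less \<kappa> \<omega>) d (arrow G \<rho>') x y * edge_contribution (colour_less \<kappa> \<omega>) d (arrow G \<rho>') x z \<and>
      g y = edge_contribution (colour_less \<kappa> \<omega>) d (arrow G \<rho>') y x \<and>
      g z = edge_contribution (colour_less \<kappa> \<omega>) d (arrow G \<rho>') z x"
  shows "\<rho> \<in> moment_fibre G \<kappa> \<omega> q d \<longleftrightarrow> \<rho>' \<in> edge_fibre G (colour_less \<kappa> \<omega>) q d"
proof -
  let ?ec = "edge_contribution (colour_less \<kappa> \<omega>) d (arrow G \<rho>')"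
  let ?E = "one_plus d (arrow G \<rho>')"
  define c' where "c' = \<kappa> (the_edge G y z)"
  have cs: "\<kappa> (the_edge G y x) = c" "\<kappa> (the_edge G z x) = c" "\<kappa> (the_edge G z y) = c'" "\<kappa> (the_edge G y z) = c'"
    using c the_edge_commute unfolding c'_def by metis+
  have ne: "c \<noteq> c'" using c(3) unfolding c'_def by simp
  have n: "x \<in> nodes G" "y \<in> nodes G" "z \<in> nodes G" using N by auto
  have col: "\<kappa> ` edges G = {c, c'}"
  proof -
    have "\<kappa> e \<in> {c, c'}" if e: "e \<in> edges G" for e
    proof -
      obtain a b where "a \<in> nodes G" "b \<in> nodes G" "a \<noteq> b" "e = the_edge G a b" by (rule edge_cases[OF e])
      then show ?thesis unfolding N(1) using c cs by auto
    qed
    moreover have "c \<in> \<kappa> ` edges G" using the_edge(1)[OF n(1,2) N(2)] c(1) by blast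
    moreover have "c' \<in> \<kappa> ` edges G" using the_edge(1)[OF n(2,3) N(4)] cs(4) by blast
    ultimately show ?thesis by blast
  qed
  have Nc1: "nodes (mono_subgraph G \<kappa> c) = {x, y, z}"
    by (rule Set.set_eqI, unfold mono_nodes_iff N(1)) (use N(2-) c(1,2) cs ne in auto)
  have Nc2: "nodes (mono_subgraph G \<kappa> c') = {y, z}"
    by (rule Set.set_eqI, unfold mono_nodes_iff N(1)) (use N(2-) c(1,2) cs ne in auto)
  note Nc = Nc1 Nc2
  have n2: "y \<in> nodes G" "z \<in> nodes G" "y \<noteq> z" using n N by auto
  have edge: "colour_factorises G \<kappa> \<omega> d \<rho> c' g \<longleftrightarrow> (?E y z \<in> GL (d y) \<and> ?E z y \<in> GL (d z)) \<and> g y = ?ec y z \<and> g z = ?ec z y" for g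
    using colour_factorises_edge[OF \<omega> n2 \<rho> cs(4) Nc(2), of g] unfolding edge_contribution_def same .
  have ex: "(\<exists>g. colour_factorises G \<kappa> \<omega> d \<rho> c g) \<longleftrightarrow>
      ?E x y \<in> GL (d x) \<and> ?E y x \<in> GL (d y) \<and> ?E x z \<in> GL (d x) \<and> ?E z x \<in> GL (d z)"
  proof
    assume a: "?E x y \<in> GL (d x) \<and> ?E y x \<in> GL (d y) \<and> ?E x z \<in> GL (d x) \<and> ?E z x \<in> GL (d z)"
    show "\<exists>g. colour_factorises G \<kappa> \<omega> d \<rho> c g"
      unfolding star using a N(2-)
      by (intro exI[of _ "\<lambda>a. if a = x then ?ec x y * ?ec x z else ?ec a x"]) simp
  qed (use star in blast)
  have ex': "(\<exists>g. colour_factorises G \<kappa> \<omega> d \<rho> c' g) \<longleftrightarrow> ?E y z \<in> GL (d y) \<and> ?E z y \<in> GL (d z)"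
  proof
    assume a: "?E y z \<in> GL (d y) \<and> ?E z y \<in> GL (d z)"
    show "\<exists>g. colour_factorises G \<kappa> \<omega> d \<rho> c' g"
      unfolding edge using a N(2-)
      by (intro exI[of _ "\<lambda>a. if a = y then ?ec y z else ?ec z y"]) simp
  qed (use edge in blast)
  define allGL where "allGL \<longleftrightarrow> (\<forall>a\<in>nodes G. \<forall>b\<in>nodes G. a \<noteq> b \<longrightarrow> ?E a b \<in> GL (d a))"
  have all: "allGL \<longleftrightarrow> (?E x y \<in> GL (d x) \<and> ?E y x \<in> GL (d y) \<and> ?E x z \<in> GL (d x) \<and> ?E z x \<in> GL (d z)) \<and>
      (?E y z \<in> GL (d y) \<and> ?E z y \<in> GL (d z))"
    unfolding allGL_def N(1) using N(2-) by auto
  have RS: "\<rho> \<in> Rep_star G \<kappa> \<omega> d \<longleftrightarrow> allGL"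
    unfolding Rep_star_def col all using ex ex' \<rho> by simp
  show ?thesis
  proof (cases allGL)
    case False
    then show ?thesis using RS unfolding moment_fibre_def edge_fibre_def allGL_def by blast
  next
    case True
    then have E: "?E a b \<in> GL (d a)" if "a \<in> nodes G" "b \<in> nodes G" "a \<noteq> b" for a b
      using that unfolding allGL_def by blast
    have ecGL: "?ec a b \<in> GL (d a)" if "a \<in> nodes G" "b \<in> nodes G" "a \<noteq> b" for a b
      by (rule edge_contribution_GL) (rule E[OF that])
    have exs: "\<exists>g. colour_factorises G \<kappa> \<omega> d \<rho> c g" "\<exists>g. colour_factorises G \<kappa> \<omega> d \<rho> c' g"
      using True unfolding ex ex' all by blast+
    have cm: "colour_moment G \<kappa> \<omega> d \<rho> c x = ?ec x y * ?ec x z" "colour_moment G \<kappa> \<omega> d \<rho> c y = ?ec y x"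
      "colour_moment G \<kappa> \<omega> d \<rho> c z = ?ec z x"
      by (rule colour_moment_eq[OF _ exs(1)]; use star in blast)+
    have cm': "colour_moment G \<kappa> \<omega> d \<rho> c' y = ?ec y z" "colour_moment G \<kappa> \<omega> d \<rho> c' z = ?ec z y"
      by (rule colour_moment_eq[OF _ exs(2)]; use edge in blast)+
    have at: "{k \<in> \<kappa> ` edges G. x \<in> nodes (mono_subgraph G \<kappa> k)} = {c}"
      "{k \<in> \<kappa> ` edges G. y \<in> nodes (mono_subgraph G \<kappa> k)} = {c, c'}"
      "{k \<in> \<kappa> ` edges G. z \<in> nodes (mono_subgraph G \<kappa> k)} = {c, c'}"
      unfolding col using Nc N(2-) by auto
    \<comment> \<open>Only the colour \<open>c\<close> occurs at the centre, and its component is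
      already the product of both contributions.\<close>
    have mx: "moment_map G \<kappa> \<omega> d \<rho> x = ?ec x y * ?ec x z"
      by (rule moment_map_single[OF \<omega> n(1) at(1) cm(1)]) 
         (intro mult_carrier_mat[where n = "d x"] GL_carrier ecGL; use n N in simp)
    have my: "moment_map G \<kappa> \<omega> d \<rho> y = q y \<cdot>\<^sub>m 1\<^sub>m (d y) \<longleftrightarrow> ?ec y x * ?ec y z = q y \<cdot>\<^sub>m 1\<^sub>m (d y)"
      by (rule moment_map_pair[OF \<omega> n(2) q[OF n(2)] at(2) ne cm(2) _ cm'(1)]; rule ecGL; use n N in simp)
    have mz: "moment_map G \<kappa> \<omega> d \<rho> z = q z \<cdot>\<^sub>m 1\<^sub>m (d z) \<longleftrightarrow> ?ec z x * ?ec z y = q z \<cdot>\<^sub>m 1\<^sub>m (d z)"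
      by (rule moment_map_pair[OF \<omega> n(3) q[OF n(3)] at(3) ne cm(3) _ cm'(2)]; rule ecGL; use n N in simp)
    \<comment> \<open>\<open>edge_fibre\<close> asks for both orders of the factors, while the
      moment map supplies one.\<close>
    have sw: "?ec a b * ?ec a b' = q a \<cdot>\<^sub>m 1\<^sub>m (d a) \<longleftrightarrow> ?ec a b' * ?ec a b = q a \<cdot>\<^sub>m 1\<^sub>m (d a)"
      if "a \<in> nodes G" "b \<in> nodes G" "a \<noteq> b" "b' \<in> nodes G" "a \<noteq> b'" for a b b'
      using GL_commute_scalar[OF ecGL[OF that(1-3)] ecGL[OF that(1,4,5)] _ q[OF that(1)]]
        GL_commute_scalar[OF ecGL[OF that(1,4,5)] ecGL[OF that(1-3)] _ q[OF that(1)]] by blast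
    have "(\<forall>a\<in>nodes G. moment_map G \<kappa> \<omega> d \<rho> a = q a \<cdot>\<^sub>m 1\<^sub>m (d a)) \<longleftrightarrow>
       ?ec x y * ?ec x z = q x \<cdot>\<^sub>m 1\<^sub>m (d x) \<and> ?ec y x * ?ec y z = q y \<cdot>\<^sub>m 1\<^sub>m (d y) \<and> ?ec z x * ?ec z y = q z \<cdot>\<^sub>m 1\<^sub>m (d z)"
      unfolding N(1) using mx my mz by simp
    also have "\<dots> \<longleftrightarrow> (\<forall>a\<in>nodes G. \<forall>b\<in>nodes G. \<forall>b'\<in>nodes G. a \<noteq> b \<longrightarrow> a \<noteq> b' \<longrightarrow> b \<noteq> b' \<longrightarrow>
        ?ec a b * ?ec a b' = q a \<cdot>\<^sub>m 1\<^sub>m (d a))"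
      using sw[OF n(1,2) N(2) n(3) N(3)] sw[OF n(2,1) N(2)[symmetric] n(3) N(4)]
        sw[OF n(3,1) N(3)[symmetric] n(2) N(4)[symmetric]]
      unfolding N(1) using N(2-) by auto
    finally show ?thesis using True RS \<rho>' unfolding moment_fibre_def edge_fibre_def allGL_def by simp
  qed
qed

text \<open>The larger leaf \<open>z\<close> is eliminated before \<open>y\<close>, so its factor
  rescales the arrow from \<open>y\<close> to the centre.\<close>

lemma two_colours_star_first:
  assumes \<omega>: "valid_choices G \<kappa> \<omega>" and q: "\<And>x. x \<in> nodes G \<Longrightarrow> q x \<noteq> 0"
    and N: "nodes G = {x, y, z}" "x \<noteq> y" "x \<noteq> z" "y \<noteq> z"
    and c: "\<kappa> (the_edge G x y) = c" "\<kappa> (the_edge G x z) = c" "\<kappa> (the_edge G y z) \<noteq> c"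
    and lt: "node_less (part_order \<omega> c) x y" "node_less (part_order \<omega> c) x z" "node_less (part_order \<omega> c) y z"
    and dist: "distinct (concat (part_order \<omega> c))" and Nc: "nodes (mono_subgraph G \<kappa> c) = {x, y, z}"
  shows "equivariantly_isomorphic G d (moment_fibre G \<kappa> \<omega> q d) (edge_fibre G (colour_less \<kappa> \<omega>) q d)"
proof (rule rescaling_isomorphism[where x = x and y = y and z = z])
  show "moment_fibre G \<kappa> \<omega> q d \<subseteq> Rep G d" unfolding moment_fibre_def Rep_star_def by blast
  show "x \<in> nodes G" "y \<in> nodes G" "z \<in> nodes G" "x \<noteq> y" "x \<noteq> z" "y \<noteq> z" using N by auto
  note n = this
  fix \<rho> assume \<rho>: "\<rho> \<in> Rep G d"
  let ?v = "edge_map G \<kappa> d \<rho> c" and ?lt = "node_less (part_order \<omega> c)"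
  define u where "u = minv (one_plus d (arrow G \<rho>) x z) * arrow G \<rho> x y"
  define \<rho>' where "\<rho>' = set_arrow x y u \<rho>"
  note as = node_less_asym(1)[OF dist]
  have cyx: "\<kappa> (the_edge G y x) = c" "\<kappa> (the_edge G z x) = c" "\<kappa> (the_edge G z y) \<noteq> c"
    using c the_edge_commute by metis+
  have v: "?v x y = arrow G \<rho> x y" "?v y x = arrow G \<rho> y x" "?v x z = arrow G \<rho> x z" "?v z x = arrow G \<rho> z x"
    "?v y z = 0\<^sub>m (d y) (d z)" "?v z y = 0\<^sub>m (d z) (d y)"
    using n c cyx by (simp_all add: edge_map_eq)
  have u': "u = minv (one_plus d ?v x z) * ?v x y" unfolding u_def v ..
  have cl: "colour_less \<kappa> \<omega> x y" "colour_less \<kappa> \<omega> x z" "\<not> colour_less \<kappa> \<omega> y x" "\<not> colour_less \<kappa> \<omega> z x"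
    unfolding colour_less_def c cyx using lt as by auto
  have "factorises {x, y, z} d ?lt (tri_product {x, y, z} d ?lt ?v) g \<longleftrightarrow>
    one_plus d ?v x z \<in> GL (d x) \<and> one_plus d ?v z x \<in> GL (d z) \<and>
    1\<^sub>m (d x) + u * ?v y x \<in> GL (d x) \<and> 1\<^sub>m (d y) + ?v y x * u \<in> GL (d y) \<and>
    g z = one_plus d ?v z x \<and> g y = 1\<^sub>m (d y) + ?v y x * u \<and>
    g x = minv (1\<^sub>m (d x) + u * ?v y x) * minv (one_plus d ?v x z)" for g
    by (rule factorises_star_first[where v = ?v and d = d and x = x and y = y and z = z and u = u, OF _ _ _ _ _ _ _ _ _ _ _ _ u'])
       (use edge_map_carrier[OF \<rho>] n lt as v(5,6) in auto)
  then have F: "colour_factorises G \<kappa> \<omega> d \<rho> c g \<longleftrightarrow>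
    one_plus d (arrow G \<rho>) x z \<in> GL (d x) \<and> one_plus d (arrow G \<rho>) z x \<in> GL (d z) \<and>
    1\<^sub>m (d x) + u * arrow G \<rho> y x \<in> GL (d x) \<and> 1\<^sub>m (d y) + arrow G \<rho> y x * u \<in> GL (d y) \<and>
    g z = one_plus d (arrow G \<rho>) z x \<and> g y = 1\<^sub>m (d y) + arrow G \<rho> y x * u \<and>
    g x = minv (1\<^sub>m (d x) + u * arrow G \<rho> y x) * minv (one_plus d (arrow G \<rho>) x z)" for g
    unfolding colour_factorises_def colour_product_def Let_def Nc v .
  have E': "one_plus d (arrow G \<rho>') x z = one_plus d (arrow G \<rho>) x z" "one_plus d (arrow G \<rho>') z x = one_plus d (arrow G \<rho>) z x"
    "one_plus d (arrow G \<rho>') x y = 1\<^sub>m (d x) + u * arrow G \<rho> y x" "one_plus d (arrow G \<rho>') y x = 1\<^sub>m (d y) + arrow G \<rho> y x * u"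
    unfolding \<rho>'_def using N(2-) by simp_all
  show "\<rho> \<in> moment_fibre G \<kappa> \<omega> q d \<longleftrightarrow> one_plus d (arrow G \<rho>) x z \<in> GL (d x) \<and>
      set_arrow x y (minv (one_plus d (arrow G \<rho>) x z) * arrow G \<rho> x y) \<rho> \<in> edge_fibre G (colour_less \<kappa> \<omega>) q d"
    unfolding u_def[symmetric] \<rho>'_def[symmetric]
  proof (cases "one_plus d (arrow G \<rho>) x z \<in> GL (d x)")
    case False
    moreover have "c \<in> \<kappa> ` edges G" using the_edge(1)[OF n(1,2,4)] c(1) by blast
    ultimately have "\<rho> \<notin> moment_fibre G \<kappa> \<omega> q d" unfolding moment_fibre_def Rep_star_def using F by blast
    then show "\<rho> \<in> moment_fibre G \<kappa> \<omega> q d \<longleftrightarrow> one_plus d (arrow G \<rho>) x z \<in> GL (d x) \<and> \<rho>' \<in> edge_fibre G (colour_less \<kappa> \<omega>) q d"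
      using False by blast
  next
    case True
    have R': "\<rho>' \<in> Rep G d" unfolding \<rho>'_def u_def
      by (rule set_arrow_Rep[OF \<rho> n(1,2,4)])
         (use minv_dim[OF True] arrow_dim[OF \<rho> n(1,2,4)] in \<open>intro carrier_matI; simp\<close>)
    have "\<rho> \<in> moment_fibre G \<kappa> \<omega> q d \<longleftrightarrow> \<rho>' \<in> edge_fibre G (colour_less \<kappa> \<omega>) q d"
    proof (rule two_colour_fibre_iff[OF \<omega> _ N c \<rho> R'])
      show "q a \<noteq> 0" if "a \<in> nodes G" for a by (rule q[OF that])
      show "arrow G \<rho>' y z = arrow G \<rho> y z" "arrow G \<rho>' z y = arrow G \<rho> z y"
        unfolding \<rho>'_def using N(2-) by simp_all
      show "colour_factorises G \<kappa> \<omega> d \<rho> c g \<longleftrightarrow>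
      (one_plus d (arrow G \<rho>') x y \<in> GL (d x) \<and> one_plus d (arrow G \<rho>') y x \<in> GL (d y) \<and>
       one_plus d (arrow G \<rho>') x z \<in> GL (d x) \<and> one_plus d (arrow G \<rho>') z x \<in> GL (d z)) \<and>
      g x = edge_contribution (colour_less \<kappa> \<omega>) d (arrow G \<rho>') x y * edge_contribution (colour_less \<kappa> \<omega>) d (arrow G \<rho>') x z \<and>
      g y = edge_contribution (colour_less \<kappa> \<omega>) d (arrow G \<rho>') y x \<and>
      g z = edge_contribution (colour_less \<kappa> \<omega>) d (arrow G \<rho>') z x" for g
        unfolding F edge_contribution_def E' using cl by (simp only: if_True if_False) blast
    qed
    then show "\<rho> \<in> moment_fibre G \<kappa> \<omega> q d \<longleftrightarrow> one_plus d (arrow G \<rho>) x z \<in> GL (d x) \<and> \<rho>' \<in> edge_fibre G (colour_less \<kappa> \<omega>) q d"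
      using True by blast
  qed
qed

text \<open>The centre is now eliminated before both leaves, and the leaves exchange roles: the
  factor of the smaller leaf \<open>y\<close> rescales the arrow from \<open>z\<close> to the
  centre.\<close>

lemma two_colours_star_last:
  assumes \<omega>: "valid_choices G \<kappa> \<omega>" and q: "\<And>x. x \<in> nodes G \<Longrightarrow> q x \<noteq> 0"
    and N: "nodes G = {x, y, z}" "x \<noteq> y" "x \<noteq> z" "y \<noteq> z"
    and c: "\<kappa> (the_edge G x y) = c" "\<kappa> (the_edge G x z) = c" "\<kappa> (the_edge G y z) \<noteq> c"
    and lt: "node_less (part_order \<omega> c) y x" "node_less (part_order \<omega> c) z x" "node_less (part_order \<omega> c) y z"
    and dist: "distinct (concat (part_order \<omega> c))" and Nc: "nodes (mono_subgraph G \<kappa> c) = {x, y, z}"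
  shows "equivariantly_isomorphic G d (moment_fibre G \<kappa> \<omega> q d) (edge_fibre G (colour_less \<kappa> \<omega>) q d)"
proof (rule rescaling_isomorphism[where x = x and y = z and z = y])
  show "moment_fibre G \<kappa> \<omega> q d \<subseteq> Rep G d" unfolding moment_fibre_def Rep_star_def by blast
  show "x \<in> nodes G" "z \<in> nodes G" "y \<in> nodes G" "x \<noteq> z" "x \<noteq> y" "z \<noteq> y" using N by auto
  note n = this
  fix \<rho> assume \<rho>: "\<rho> \<in> Rep G d"
  let ?v = "edge_map G \<kappa> d \<rho> c" and ?lt = "node_less (part_order \<omega> c)"
  define u where "u = minv (one_plus d (arrow G \<rho>) x y) * arrow G \<rho> x z"
  define \<rho>' where "\<rho>' = set_arrow x z u \<rho>"
  note as = node_less_asym(1)[OF dist]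
  have cyx: "\<kappa> (the_edge G y x) = c" "\<kappa> (the_edge G z x) = c" "\<kappa> (the_edge G z y) \<noteq> c"
    using c the_edge_commute by metis+
  have v: "?v x y = arrow G \<rho> x y" "?v y x = arrow G \<rho> y x" "?v x z = arrow G \<rho> x z" "?v z x = arrow G \<rho> z x"
    "?v y z = 0\<^sub>m (d y) (d z)" "?v z y = 0\<^sub>m (d z) (d y)"
    using n c cyx by (simp_all add: edge_map_eq)
  have u': "u = minv (one_plus d ?v x y) * ?v x z" unfolding u_def v ..
  have cl: "\<not> colour_less \<kappa> \<omega> x y" "\<not> colour_less \<kappa> \<omega> x z" "colour_less \<kappa> \<omega> y x" "colour_less \<kappa> \<omega> z x"
    unfolding colour_less_def c cyx using lt as by auto
  have Nc': "nodes (mono_subgraph G \<kappa> c) = {y, z, x}" using Nc by auto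
  have "factorises {y, z, x} d ?lt (tri_product {y, z, x} d ?lt ?v) g \<longleftrightarrow>
    one_plus d ?v x y \<in> GL (d x) \<and> one_plus d ?v y x \<in> GL (d y) \<and>
    1\<^sub>m (d x) + u * ?v z x \<in> GL (d x) \<and> 1\<^sub>m (d z) + ?v z x * u \<in> GL (d z) \<and>
    g z = minv (1\<^sub>m (d z) + ?v z x * u) \<and> g y = minv (one_plus d ?v y x) \<and>
    g x = one_plus d ?v x y * (1\<^sub>m (d x) + u * ?v z x)" for g
    by (rule factorises_star_last[where v = ?v and d = d and x = x and y = y and z = z and u = u, OF _ _ _ _ _ _ _ _ _ _ _ _ u'])
       (use edge_map_carrier[OF \<rho>] n lt as v(5,6) in auto)
  then have F: "colour_factorises G \<kappa> \<omega> d \<rho> c g \<longleftrightarrow>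
    one_plus d (arrow G \<rho>) x y \<in> GL (d x) \<and> one_plus d (arrow G \<rho>) y x \<in> GL (d y) \<and>
    1\<^sub>m (d x) + u * arrow G \<rho> z x \<in> GL (d x) \<and> 1\<^sub>m (d z) + arrow G \<rho> z x * u \<in> GL (d z) \<and>
    g z = minv (1\<^sub>m (d z) + arrow G \<rho> z x * u) \<and> g y = minv (one_plus d (arrow G \<rho>) y x) \<and>
    g x = one_plus d (arrow G \<rho>) x y * (1\<^sub>m (d x) + u * arrow G \<rho> z x)" for g
    unfolding colour_factorises_def colour_product_def Let_def Nc' v .
  have E': "one_plus d (arrow G \<rho>') x y = one_plus d (arrow G \<rho>) x y" "one_plus d (arrow G \<rho>') y x = one_plus d (arrow G \<rho>) y x"
    "one_plus d (arrow G \<rho>') x z = 1\<^sub>m (d x) + u * arrow G \<rho> z x" "one_plus d (arrow G \<rho>') z x = 1\<^sub>m (d z) + arrow G \<rho> z x * u"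
    unfolding \<rho>'_def using N(2-) by simp_all
  show "\<rho> \<in> moment_fibre G \<kappa> \<omega> q d \<longleftrightarrow> one_plus d (arrow G \<rho>) x y \<in> GL (d x) \<and>
      set_arrow x z (minv (one_plus d (arrow G \<rho>) x y) * arrow G \<rho> x z) \<rho> \<in> edge_fibre G (colour_less \<kappa> \<omega>) q d"
    unfolding u_def[symmetric] \<rho>'_def[symmetric]
  proof (cases "one_plus d (arrow G \<rho>) x y \<in> GL (d x)")
    case False
    moreover have "c \<in> \<kappa> ` edges G" using the_edge(1)[OF n(1,2,4)] c(2) by blast
    ultimately have "\<rho> \<notin> moment_fibre G \<kappa> \<omega> q d" unfolding moment_fibre_def Rep_star_def using F by blast
    then show "\<rho> \<in> moment_fibre G \<kappa> \<omega> q d \<longleftrightarrow> one_plus d (arrow G \<rho>) x y \<in> GL (d x) \<and> \<rho>' \<in> edge_fibre G (colour_less \<kappa> \<omega>) q d"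
      using False by blast
  next
    case True
    have R': "\<rho>' \<in> Rep G d" unfolding \<rho>'_def u_def
      by (rule set_arrow_Rep[OF \<rho> n(1,2,4)])
         (use minv_dim[OF True] arrow_dim[OF \<rho> n(1,2,4)] in \<open>intro carrier_matI; simp\<close>)
    have "\<rho> \<in> moment_fibre G \<kappa> \<omega> q d \<longleftrightarrow> \<rho>' \<in> edge_fibre G (colour_less \<kappa> \<omega>) q d"
    proof (rule two_colour_fibre_iff[OF \<omega> _ N c \<rho> R'])
      show "q a \<noteq> 0" if "a \<in> nodes G" for a by (rule q[OF that])
      show "arrow G \<rho>' y z = arrow G \<rho> y z" "arrow G \<rho>' z y = arrow G \<rho> z y"
        unfolding \<rho>'_def using N(2-) by simp_all
      show "colour_factorises G \<kappa> \<omega> d \<rho> c g \<longleftrightarrow>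
      (one_plus d (arrow G \<rho>') x y \<in> GL (d x) \<and> one_plus d (arrow G \<rho>') y x \<in> GL (d y) \<and>
       one_plus d (arrow G \<rho>') x z \<in> GL (d x) \<and> one_plus d (arrow G \<rho>') z x \<in> GL (d z)) \<and>
      g x = edge_contribution (colour_less \<kappa> \<omega>) d (arrow G \<rho>') x y * edge_contribution (colour_less \<kappa> \<omega>) d (arrow G \<rho>') x z \<and>
      g y = edge_contribution (colour_less \<kappa> \<omega>) d (arrow G \<rho>') y x \<and>
      g z = edge_contribution (colour_less \<kappa> \<omega>) d (arrow G \<rho>') z x" for g
        unfolding F edge_contribution_def E' using cl by (simp only: if_True if_False) blast
    qed
    then show "\<rho> \<in> moment_fibre G \<kappa> \<omega> q d \<longleftrightarrow> one_plus d (arrow G \<rho>) x y \<in> GL (d x) \<and> \<rho>' \<in> edge_fibre G (colour_less \<kappa> \<omega>) q d"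
      using True by blast
  qed
qed

text \<open>The unjoined nodes \<open>y\<close> and \<open>z\<close> share a part, and
  \<open>x\<close> lies in another one. Parts are consecutive blocks of the order, so a centre
  between its leaves cannot occur.\<close>

lemma star_order:
  assumes o: "is_ordering H ps" and H: "nodes H = {x, y, z}" "num_edges H x y = 1" "num_edges H x z = 1" "num_edges H y z = 0"
  shows "node_less ps x y \<and> node_less ps x z \<or> node_less ps y x \<and> node_less ps z x"
proof -
  have cm: "complete_multipartite H (set ` set ps)" using o unfolding is_ordering_def by blast
  have e: "num_edges H i j = (if \<exists>p\<in>set ` set ps. i \<in> p \<and> j \<in> p then 0 else 1)"
    if "i \<in> {x, y, z}" "j \<in> {x, y, z}" for i j
    using cm that unfolding complete_multipartite_def H(1) by blast
  have "\<exists>p\<in>set ` set ps. y \<in> p \<and> z \<in> p" using e[of y z] H(4) by (metis insertCI zero_neq_one)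
  then obtain p where p: "p \<in> set ps" "y \<in> set p" "z \<in> set p" by auto
  have xp: "x \<notin> set p" using e[of x y] H(2) p by (metis image_eqI insertCI zero_neq_one)
  obtain as bs where ps: "ps = as @ p # bs" using split_list[OF p(1)] by blast
  have "x \<in> set (concat ps)" using node_less_partition(2)[OF o] H(1) by simp
  then consider "x \<in> set (concat as)" | "x \<in> set (concat bs)" using xp unfolding ps by auto
  then show ?thesis
  proof cases
    case 1
    then show ?thesis using node_less_append[of x as _ "p # bs"] p unfolding ps by simp
  next
    case 2
    then show ?thesis using node_less_append[of _ "as @ [p]" x bs] p unfolding ps by simp
  qed
qed

lemma edges_eq:
  assumes N: "nodes G = {x, y, z}" "x \<noteq> y" "x \<noteq> z" "y \<noteq> z"
  shows "edges G = {the_edge G x y, the_edge G x z, the_edge G y z}"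
proof -
  have com: "the_edge G y x = the_edge G x y" "the_edge G z x = the_edge G x z" "the_edge G z y = the_edge G y z"
    by (rule the_edge_commute)+
  have "e \<in> {the_edge G x y, the_edge G x z, the_edge G y z}" if e: "e \<in> edges G" for e
  proof -
    obtain a b where "a \<in> nodes G" "b \<in> nodes G" "a \<noteq> b" "e = the_edge G a b" by (rule edge_cases[OF e])
    then show ?thesis unfolding N(1) using com by auto
  qed
  moreover have "x \<in> nodes G" "y \<in> nodes G" "z \<in> nodes G" using N by auto
  ultimately show ?thesis using the_edge(1) N(2-) by blast
qed

lemma mono_num_edges:
  assumes "a \<in> nodes G" "b \<in> nodes G"
  shows "num_edges (mono_subgraph G \<kappa> c) a b = (if a \<noteq> b \<and> \<kappa> (the_edge G a b) = c then 1 else 0)"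
proof (cases "a = b")
  case True
  have "ends G e \<noteq> {a, b}" if "e \<in> edges G" for e
    using triangle True that unfolding triangle_def fin_graph_def by force
  then have "{e \<in> edges (mono_subgraph G \<kappa> c). ends (mono_subgraph G \<kappa> c) e = {a, b}} = {}"
    unfolding mono_subgraph_def by simp
  then have "num_edges (mono_subgraph G \<kappa> c) a b = 0" unfolding num_edges_def by (simp only: card.empty)
  then show ?thesis using True by simp
next
  case False
  have "e \<in> edges G \<and> \<kappa> e = c \<and> ends G e = {a, b} \<longleftrightarrow> e = the_edge G a b \<and> \<kappa> (the_edge G a b) = c" for e
    using the_edge[OF assms False] by blast
  then have "{e \<in> edges (mono_subgraph G \<kappa> c). ends (mono_subgraph G \<kappa> c) e = {a, b}} =
      (if \<kappa> (the_edge G a b) = c then {the_edge G a b} else {})" (is "?S = ?T")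
    unfolding mono_subgraph_def by simp
  then have "num_edges (mono_subgraph G \<kappa> c) a b = card ?T" unfolding num_edges_def by (rule arg_cong)
  then show ?thesis using False by simp
qed

text \<open>Any two edges of a triangle meet, so the two edges of equal colour form a star;
  \<open>x\<close> is its centre.\<close>

lemma two_colours_edges:
  assumes "card (\<kappa> ` edges G) = 2"
  obtains x y z c where "nodes G = {x, y, z}" "x \<noteq> y" "x \<noteq> z" "y \<noteq> z"
    "\<kappa> (the_edge G x y) = c" "\<kappa> (the_edge G x z) = c" "\<kappa> (the_edge G y z) \<noteq> c"
proof -
  obtain x y z where N: "nodes G = {x, y, z}" "x \<noteq> y" "x \<noteq> z" "y \<noteq> z" by (rule nodes_three)
  have n: "x \<in> nodes G" "y \<in> nodes G" "z \<in> nodes G" using N by auto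
  let ?a = "\<kappa> (the_edge G x y)" and ?b = "\<kappa> (the_edge G x z)" and ?c = "\<kappa> (the_edge G y z)"
  have com: "the_edge G y x = the_edge G x y" "the_edge G z x = the_edge G x z" "the_edge G z y = the_edge G y z"
    by (rule the_edge_commute)+
  have im: "\<kappa> ` edges G = {?a, ?b, ?c}" unfolding edges_eq[OF N] by simp
  have card: "card {?a, ?b, ?c} = 2" using assms unfolding im .
  then consider "?a = ?b" "?c \<noteq> ?a" | "?a = ?c" "?b \<noteq> ?a" | "?b = ?c" "?a \<noteq> ?b"
    by (cases "?a = ?b"; cases "?a = ?c"; cases "?b = ?c") auto
  then show thesis
  proof cases
    case 1
    show thesis by (rule that[of x y z ?a]) (use 1 N in auto)
  next
    case 2
    show thesis by (rule that[of y x z ?a]) (use 2 N com in auto)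
  next
    case 3
    show thesis by (rule that[of z x y ?b]) (use 3 N com in auto)
  qed
qed

text \<open>Naming the leaves in increasing order leaves only the two positions of the centre
  allowed by \<open>star_order\<close>.\<close>

proposition two_colours_equivariantly_isomorphic:
  assumes two: "card (\<kappa> ` edges G) = 2" and \<omega>: "valid_choices G \<kappa> \<omega>" and q: "\<And>x. x \<in> nodes G \<Longrightarrow> q x \<noteq> 0"
  shows "equivariantly_isomorphic G d (moment_fibre G \<kappa> \<omega> q d) (edge_fibre G (colour_less \<kappa> \<omega>) q d)"
proof -
  obtain x y z c where N: "nodes G = {x, y, z}" "x \<noteq> y" "x \<noteq> z" "y \<noteq> z"
    and c: "\<kappa> (the_edge G x y) = c" "\<kappa> (the_edge G x z) = c" "\<kappa> (the_edge G y z) \<noteq> c"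
    by (rule two_colours_edges[OF two])
  have n: "x \<in> nodes G" "y \<in> nodes G" "z \<in> nodes G" using N by auto
  have cyx: "\<kappa> (the_edge G y x) = c" "\<kappa> (the_edge G z x) = c" "\<kappa> (the_edge G z y) \<noteq> c"
    using c the_edge_commute by metis+
  have Nc: "nodes (mono_subgraph G \<kappa> c) = {x, y, z}"
    by (rule Set.set_eqI, unfold mono_nodes_iff N(1), use N(2-) c cyx in auto)
  have "c \<in> \<kappa> ` edges G" using the_edge(1)[OF n(1,2) N(2)] c(1) by blast
  then have o: "is_ordering (mono_subgraph G \<kappa> c) (part_order \<omega> c)"
    using \<omega> unfolding valid_choices_def by blast
  note dist = node_less_partition(1)[OF o]
  have yz: "node_less (part_order \<omega> c) y z \<or> node_less (part_order \<omega> c) z y"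
    by (rule node_less_total) (use node_less_partition(2)[OF o] Nc N in auto)
  have N': "nodes G = {x, z, y}" and Nc': "nodes (mono_subgraph G \<kappa> c) = {x, z, y}" using N(1) Nc by auto
  have "node_less (part_order \<omega> c) x y \<and> node_less (part_order \<omega> c) x z \<or>
      node_less (part_order \<omega> c) y x \<and> node_less (part_order \<omega> c) z x"
    by (rule star_order[OF o Nc]) (use n N c in \<open>simp_all add: mono_num_edges\<close>)
  then show ?thesis
  proof
    assume a: "node_less (part_order \<omega> c) x y \<and> node_less (part_order \<omega> c) x z"
    from yz show ?thesis
    proof
      assume "node_less (part_order \<omega> c) y z"
      with a show ?thesis by (intro two_colours_star_first[OF \<omega> q N c _ _ _ dist Nc]) auto
    next
      assume "node_less (part_order \<omega> c) z y"
      with a show ?thesis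
        by (intro two_colours_star_first[OF \<omega> q N' N(3,2) N(4)[symmetric] c(2,1) cyx(3) _ _ _ dist Nc']) auto
    qed
  next
    assume a: "node_less (part_order \<omega> c) y x \<and> node_less (part_order \<omega> c) z x"
    from yz show ?thesis
    proof
      assume "node_less (part_order \<omega> c) y z"
      with a show ?thesis by (intro two_colours_star_last[OF \<omega> q N c _ _ _ dist Nc]) auto
    next
      assume "node_less (part_order \<omega> c) z y"
      with a show ?thesis
        by (intro two_colours_star_last[OF \<omega> q N' N(3,2) N(4)[symmetric] c(2,1) cyx(3) _ _ _ dist Nc']) auto
    qed
  qed
qed

text \<open>Both moment fibres reduce to an \<open>edge_fibre\<close>. The orientations coming from
  the two systems of choices may differ, and \<open>edge_fibre_isomorphic\<close> reconciles
  them.\<close>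

proposition two_three_colours_isomorphic:
  assumes "card (\<kappa> ` edges G) = 2" "inj_on \<kappa>' (edges G)"
    and "valid_choices G \<kappa> \<omega>" "valid_choices G \<kappa>' \<omega>'" "admissible G q d"
  shows "variety_isomorphic (quiver_variety G \<kappa> \<omega> q d) (quiver_variety G \<kappa>' \<omega>' q d)"
proof -
  have q: "q x \<noteq> 0" if "x \<in> nodes G" for x using assms(5) that unfolding admissible_def by blast
  have three: "moment_fibre G \<kappa>' \<omega>' q d = edge_fibre G (colour_less \<kappa>' \<omega>') q d"
    by (rule moment_fibre_three_colours[OF assms(2,4)]) (rule q)
  have "equivariantly_isomorphic G d (moment_fibre G \<kappa> \<omega> q d) (edge_fibre G (colour_less \<kappa> \<omega>) q d)"
    by (rule two_colours_equivariantly_isomorphic[OF assms(1,3)]) (rule q)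
  moreover have "equivariantly_isomorphic G d (edge_fibre G (colour_less \<kappa> \<omega>) q d) (edge_fibre G (colour_less \<kappa>' \<omega>') q d)"
    by (rule edge_fibre_isomorphic; rule colour_less_iff[OF assms(3)] colour_less_iff[OF assms(4)])
  ultimately have "equivariantly_isomorphic G d (moment_fibre G \<kappa> \<omega> q d) (moment_fibre G \<kappa>' \<omega>' q d)"
    unfolding three by (rule equivariantly_isomorphic_trans)
  then show ?thesis
    unfolding quiver_variety_def
    by (rule git_quotient_isomorphic) (simp add: three gauge_stable_edge_fibre)
qed

end

section \<open>Equivalence classes of colourings\<close>

text \<open>The recoloured class contains an edge \<open>e\<close>, and since it is star-shaped some
  edge \<open>f\<close> lies outside it. The colour of \<open>f\<close> is kept, and the new colour
  of \<open>e\<close> avoids all old ones, so \<open>e\<close> and \<open>f\<close> differ in colour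
  before and after.\<close>

lemma recolouring_not_constant:
  assumes r: "recolouring H \<kappa> \<kappa>'" and ns: "\<And>c. (\<forall>e\<in>edges H. \<kappa> e = c) \<Longrightarrow> \<not> star_shaped (mono_subgraph H \<kappa> c)"
  shows "card (\<kappa> ` edges H) \<noteq> 1" "card (\<kappa>' ` edges H) \<noteq> 1"
proof -
  obtain c where c: "star_shaped (mono_subgraph H \<kappa> c)" "\<forall>e\<in>edges H. \<kappa> e \<noteq> c \<longrightarrow> \<kappa>' e = \<kappa> e"
    "\<forall>e\<in>edges H. \<kappa> e = c \<longrightarrow> \<kappa>' e \<notin> \<kappa> ` edges H"
    using r unfolding recolouring_def by blast
  have "\<exists>e. e \<in> edges H \<and> \<kappa> e = c" using c(1) unfolding star_shaped_def mono_subgraph_def by simp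
  then obtain e where e: "e \<in> edges H" "\<kappa> e = c" by blast
  obtain f where f: "f \<in> edges H" "\<kappa> f \<noteq> c" using c(1) ns by blast
  have "\<kappa>' e \<noteq> \<kappa>' f" using c(2,3) e f by (metis image_eqI)
  then show "card (\<kappa>' ` edges H) \<noteq> 1" using e(1) f(1) by (metis card_1_singletonE image_eqI singletonD)
  show "card (\<kappa> ` edges H) \<noteq> 1" using e f by (metis card_1_singletonE image_eqI singletonD)
qed

lemma relabelling_card:
  assumes "relabelling H \<kappa> \<kappa>'"
  shows "card (\<kappa>' ` edges H) = card (\<kappa> ` edges H)"
proof -
  obtain \<sigma> where \<sigma>: "inj_on \<sigma> (\<kappa> ` edges H)" "\<forall>e\<in>edges H. \<kappa>' e = \<sigma> (\<kappa> e)"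
    using assms unfolding relabelling_def by blast
  then have "\<kappa>' ` edges H = \<sigma> ` (\<kappa> ` edges H)" by (auto simp: image_image)
  then show ?thesis using card_image[OF \<sigma>(1)] by simp
qed

context triangle_graph
begin

text \<open>The parts of a colour class are the classes of the relation "equal or not joined in
  colour \<open>c\<close>" on its nodes; only transitivity is in question.\<close>

lemma colourings_UNIV: "(colourings G :: ('e \<Rightarrow> 'c) set) = UNIV"
proof -
  have "\<exists>P. complete_multipartite (mono_subgraph G \<kappa> c) P" for \<kappa> :: "'e \<Rightarrow> 'c" and c
  proof -
    let ?N = "nodes (mono_subgraph G \<kappa> c)"
    define r where "r = {(a, b). a \<in> ?N \<and> b \<in> ?N \<and> (a = b \<or> \<kappa> (the_edge G a b) \<noteq> c)}"
    have sub: "a \<in> nodes G" if "a \<in> ?N" for a using that unfolding mono_nodes_iff by blast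
    have tr: "(a, b') \<in> r" if ab: "(a, b) \<in> r" "(b, b') \<in> r" for a b b'
    proof (cases "a = b \<or> b = b' \<or> a = b'")
      case True
      then show ?thesis using ab unfolding r_def by auto
    next
      case False
      have N: "a \<in> ?N" "b \<in> ?N" "b' \<in> ?N" "\<kappa> (the_edge G a b) \<noteq> c" "\<kappa> (the_edge G b b') \<noteq> c"
        using ab False unfolding r_def by auto
      obtain w where w: "nodes G = {a, b, w}" "w \<noteq> a" "w \<noteq> b"
        by (rule nodes_obtain[OF sub[OF N(1)] sub[OF N(2)]]) (use False in auto)
      then have "nodes G = {a, b, b'}" using sub[OF N(3)] False by auto
      \<comment> \<open>A node of the class has a neighbour in colour \<open>c\<close>. For three
        distinct nodes, \<open>b\<close> would have none, so this case is contradictory.\<close>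
      moreover obtain t where "t \<in> nodes G" "t \<noteq> b" "\<kappa> (the_edge G b t) = c" using N(2) unfolding mono_nodes_iff by blast
      ultimately show ?thesis using N(4,5) the_edge_commute[of a b] by auto
    qed
    have sy: "(b, a) \<in> r" if "(a, b) \<in> r" for a b
      using that the_edge_commute[of a b] unfolding r_def by auto
    have eq: "equiv ?N r"
    proof (rule equivI)
      show "refl_on ?N r" by (auto simp: refl_on_def r_def)
      show "r \<subseteq> ?N \<times> ?N" by (auto simp: r_def)
      show "sym r" by (rule symI) (rule sy)
      show "trans r" by (rule transI) (rule tr)
    qed
    have "(\<exists>p\<in>?N // r. a \<in> p \<and> b \<in> p) \<longleftrightarrow> a = b \<or> \<kappa> (the_edge G a b) \<noteq> c" if ab: "a \<in> ?N" "b \<in> ?N" for a b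
    proof -
      have "(\<exists>p\<in>?N // r. a \<in> p \<and> b \<in> p) \<longleftrightarrow> (a, b) \<in> r"
      proof
        assume "\<exists>p\<in>?N // r. a \<in> p \<and> b \<in> p"
        then show "(a, b) \<in> r" using in_quotient_imp_in_rel[OF eq] by auto
      next
        assume "(a, b) \<in> r"
        then show "\<exists>p\<in>?N // r. a \<in> p \<and> b \<in> p"
          using quotientI[OF ab(1), of r] equiv_class_self[OF eq ab(1)] by (intro bexI[of _ "r `` {a}"]) auto
      qed
      then show ?thesis using ab unfolding r_def by auto
    qed
    then have "complete_multipartite (mono_subgraph G \<kappa> c) (?N // r)"
      unfolding complete_multipartite_def using partition_on_quotient[OF eq] sub by (auto simp: mono_num_edges)
    then show ?thesis by blast
  qed
  then have "is_colouring G \<kappa>" for \<kappa> :: "'e \<Rightarrow> 'c" unfolding is_colouring_def by (intro ballI)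
  then show ?thesis unfolding colourings_def by auto
qed

text \<open>The three edges of a triangle have no common node.\<close>

lemma constant_not_star_shaped:
  assumes "\<forall>e\<in>edges G. \<kappa> e = c"
  shows "\<not> star_shaped (mono_subgraph G \<kappa> c)"
proof
  assume "star_shaped (mono_subgraph G \<kappa> c)"
  then obtain i where i: "\<forall>e\<in>edges G. i \<in> ends G e"
    using assms unfolding star_shaped_def mono_subgraph_def by auto
  obtain x y z where N: "nodes G = {x, y, z}" "x \<noteq> y" "x \<noteq> z" "y \<noteq> z" by (rule nodes_three)
  have n: "x \<in> nodes G" "y \<in> nodes G" "z \<in> nodes G" using N by auto
  note e = the_edge(1,2)[OF n(1,2) N(2)] the_edge(1,2)[OF n(1,3) N(3)] the_edge(1,2)[OF n(2,3) N(4)]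
  have "i \<in> {x, y}" "i \<in> {x, z}" "i \<in> {y, z}" using i e by metis+
  then show False using N(2-) by auto
qed

lemma card_colours: "card (\<kappa> ` edges G) \<in> {1, 2, 3}" and card_edges: "card (edges G) = 3"
proof -
  obtain x y z where N: "nodes G = {x, y, z}" "x \<noteq> y" "x \<noteq> z" "y \<noteq> z" by (rule nodes_three)
  have n: "x \<in> nodes G" "y \<in> nodes G" "z \<in> nodes G" using N by auto
  have "the_edge G x y \<noteq> the_edge G x z" "the_edge G x y \<noteq> the_edge G y z" "the_edge G x z \<noteq> the_edge G y z"
    using n N(2-) by (simp_all add: the_edge_eq_iff doubleton_eq_iff)
  then show c3: "card (edges G) = 3" unfolding edges_eq[OF N] by simp
  then have fin: "finite (edges G)" by (metis card.infinite zero_neq_numeral)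
  have "edges G \<noteq> {}" using c3 by auto
  then have "card (\<kappa> ` edges G) \<noteq> 0" using fin by simp
  moreover have "card (\<kappa> ` edges G) \<le> 3" using card_image_le[OF fin, of \<kappa>] c3 by simp
  ultimately show "card (\<kappa> ` edges G) \<in> {1, 2, 3}" by auto
qed

lemma three_colours_inj_on: "card (\<kappa> ` edges G) = 3 \<Longrightarrow> inj_on \<kappa> (edges G)"
  using card_edges by (intro eq_card_imp_inj_on) (auto intro: card_ge_0_finite)

text \<open>Being monochromatic is the complete invariant: relabelling preserves the number of
  colours, recolouring relates only colourings with several colours, and recolouring its star takes
  a colouring with two colours to one with three. The infinite set of colours supplies the new
  ones.\<close>

lemma colouring_equiv_iff:
  fixes \<kappa> \<kappa>' :: "'e \<Rightarrow> 'c"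
  assumes inf: "infinite (UNIV :: 'c set)"
  shows "(\<kappa>, \<kappa>') \<in> colouring_equiv G \<longleftrightarrow> (card (\<kappa> ` edges G) = 1 \<longleftrightarrow> card (\<kappa>' ` edges G) = 1)"
proof -
  let ?R = "\<lambda>\<kappa>\<^sub>1 \<kappa>\<^sub>2 :: 'e \<Rightarrow> 'c. relabelling G \<kappa>\<^sub>1 \<kappa>\<^sub>2 \<or> recolouring G \<kappa>\<^sub>1 \<kappa>\<^sub>2"
  have E: "(\<kappa>\<^sub>1, \<kappa>\<^sub>2) \<in> colouring_equiv G \<longleftrightarrow> equivclp ?R \<kappa>\<^sub>1 \<kappa>\<^sub>2" for \<kappa>\<^sub>1 \<kappa>\<^sub>2 :: "'e \<Rightarrow> 'c"
    unfolding colouring_equiv_def colourings_UNIV by simp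
  have inv: "card (\<kappa>\<^sub>1 ` edges G) = 1 \<longleftrightarrow> card (\<kappa>\<^sub>2 ` edges G) = 1" if "?R \<kappa>\<^sub>1 \<kappa>\<^sub>2" for \<kappa>\<^sub>1 \<kappa>\<^sub>2 :: "'e \<Rightarrow> 'c"
    using that
  proof
    assume "relabelling G \<kappa>\<^sub>1 \<kappa>\<^sub>2"
    from relabelling_card[OF this] show ?thesis by simp
  next
    assume "recolouring G \<kappa>\<^sub>1 \<kappa>\<^sub>2"
    from recolouring_not_constant[OF this constant_not_star_shaped] show ?thesis by simp
  qed
  have fwd: "card (\<kappa>\<^sub>1 ` edges G) = 1 \<longleftrightarrow> card (\<kappa>\<^sub>2 ` edges G) = 1" if "equivclp ?R \<kappa>\<^sub>1 \<kappa>\<^sub>2" for \<kappa>\<^sub>1 \<kappa>\<^sub>2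
    using that by (induction rule: equivclp_induct) (use inv in blast)+
  have one: "equivclp ?R \<kappa>\<^sub>1 \<kappa>\<^sub>2" if o: "card (\<kappa>\<^sub>1 ` edges G) = 1" "card (\<kappa>\<^sub>2 ` edges G) = 1" for \<kappa>\<^sub>1 \<kappa>\<^sub>2
  proof -
    obtain a where "\<kappa>\<^sub>1 ` edges G = {a}" using o(1) by (rule card_1_singletonE)
    moreover obtain b where "\<kappa>\<^sub>2 ` edges G = {b}" using o(2) by (rule card_1_singletonE)
    ultimately have "relabelling G \<kappa>\<^sub>1 \<kappa>\<^sub>2" unfolding relabelling_def by (intro exI[of _ "\<lambda>_. b"]) auto
    then show ?thesis by (intro r_into_equivclp) blast
  qed
  have three: "equivclp ?R \<kappa>\<^sub>1 \<kappa>\<^sub>2" if "inj_on \<kappa>\<^sub>1 (edges G)" "inj_on \<kappa>\<^sub>2 (edges G)" for \<kappa>\<^sub>1 \<kappa>\<^sub>2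
  proof -
    have "relabelling G \<kappa>\<^sub>1 \<kappa>\<^sub>2" unfolding relabelling_def
      by (intro exI[of _ "\<lambda>c. \<kappa>\<^sub>2 (inv_into (edges G) \<kappa>\<^sub>1 c)"])
         (use that in \<open>auto simp: inj_on_def inv_into_f_f\<close>)
    then show ?thesis by (intro r_into_equivclp) blast
  qed
  have two: "\<exists>\<kappa>\<^sub>2. inj_on \<kappa>\<^sub>2 (edges G) \<and> equivclp ?R \<kappa>\<^sub>1 \<kappa>\<^sub>2" if nc: "card (\<kappa>\<^sub>1 ` edges G) \<noteq> 1" for \<kappa>\<^sub>1
  proof (cases "card (\<kappa>\<^sub>1 ` edges G) = 2")
    case False
    then have "inj_on \<kappa>\<^sub>1 (edges G)" using nc card_colours[of \<kappa>\<^sub>1] three_colours_inj_on by auto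
    then show ?thesis using three by blast
  next
    case True
    obtain x y z c where N: "nodes G = {x, y, z}" "x \<noteq> y" "x \<noteq> z" "y \<noteq> z"
      and c: "\<kappa>\<^sub>1 (the_edge G x y) = c" "\<kappa>\<^sub>1 (the_edge G x z) = c" "\<kappa>\<^sub>1 (the_edge G y z) \<noteq> c"
      by (rule two_colours_edges[OF True])
    have n: "x \<in> nodes G" "y \<in> nodes G" "z \<in> nodes G" using N by auto
    define e1 e2 e3 where e_def: "e1 = the_edge G x y" "e2 = the_edge G x z" "e3 = the_edge G y z"
    have d: "e1 \<noteq> e2" "e1 \<noteq> e3" "e2 \<noteq> e3"
      unfolding e_def using n N(2-) by (simp_all add: the_edge_eq_iff doubleton_eq_iff)
    have edges: "edges G = {e1, e2, e3}" unfolding e_def by (rule edges_eq[OF N])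
    have ends: "ends G e1 = {x, y}" "ends G e2 = {x, z}"
      unfolding e_def by (rule the_edge(2); use n N in simp)+
    note c = c[folded e_def]
    have fin: "finite (\<kappa>\<^sub>1 ` edges G)" unfolding edges by simp
    \<comment> \<open>Both edges of the star receive new colours and the third edge keeps its own,
      which makes the new colouring injective.\<close>
    obtain a where a: "a \<notin> \<kappa>\<^sub>1 ` edges G" using ex_new_if_finite[OF inf fin] by blast
    have "finite (insert a (\<kappa>\<^sub>1 ` edges G))" using fin by simp
    then obtain b where b: "b \<notin> insert a (\<kappa>\<^sub>1 ` edges G)" using ex_new_if_finite[OF inf] by blast
    define \<kappa>\<^sub>2 where "\<kappa>\<^sub>2 = \<kappa>\<^sub>1(e1 := a, e2 := b)"
    have cl: "{e \<in> edges G. \<kappa>\<^sub>1 e = c} = {e1, e2}" unfolding edges using c by auto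
    have ab: "a \<noteq> c" "a \<noteq> \<kappa>\<^sub>1 e3" "b \<noteq> c" "b \<noteq> \<kappa>\<^sub>1 e3" "b \<noteq> a" using a b c unfolding edges by auto
    have "recolouring G \<kappa>\<^sub>1 \<kappa>\<^sub>2" unfolding recolouring_def
    proof (intro exI[of _ c] conjI)
      show "star_shaped (mono_subgraph G \<kappa>\<^sub>1 c)"
        unfolding star_shaped_def mono_subgraph_def cl by (simp add: ends)
      show "inj_on \<kappa>\<^sub>2 {e \<in> edges G. \<kappa>\<^sub>1 e = c}"
        unfolding cl using d ab by (simp add: \<kappa>\<^sub>2_def)
    qed (use c d ab in \<open>simp_all add: edges \<kappa>\<^sub>2_def\<close>)
    moreover have "inj_on \<kappa>\<^sub>2 (edges G)" using ab d unfolding edges by (auto simp: \<kappa>\<^sub>2_def)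
    ultimately show ?thesis using r_into_equivclp[of ?R \<kappa>\<^sub>1 \<kappa>\<^sub>2] by blast
  qed
  show ?thesis
  proof
    assume "(\<kappa>, \<kappa>') \<in> colouring_equiv G"
    then show "card (\<kappa> ` edges G) = 1 \<longleftrightarrow> card (\<kappa>' ` edges G) = 1" unfolding E by (rule fwd)
  next
    assume a: "card (\<kappa> ` edges G) = 1 \<longleftrightarrow> card (\<kappa>' ` edges G) = 1"
    show "(\<kappa>, \<kappa>') \<in> colouring_equiv G" unfolding E
    proof (cases "card (\<kappa> ` edges G) = 1")
      case True
      then show "equivclp ?R \<kappa> \<kappa>'" using one a by blast
    next
      case False
      then obtain \<kappa>\<^sub>1 \<kappa>\<^sub>2 where "inj_on \<kappa>\<^sub>1 (edges G)" "equivclp ?R \<kappa> \<kappa>\<^sub>1" "inj_on \<kappa>\<^sub>2 (edges G)" "equivclp ?R \<kappa>' \<kappa>\<^sub>2"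
        using two[of \<kappa>] two[of \<kappa>'] a by auto
      then show "equivclp ?R \<kappa> \<kappa>'" using equivclp_trans[OF equivclp_trans[OF _ three] equivclp_sym] by blast
    qed
  qed
qed

proposition card_colouring_classes:
  assumes inf: "infinite (UNIV :: 'c set)"
  shows "card ((colourings G :: ('e \<Rightarrow> 'c) set) // colouring_equiv G) = 2"
proof -
  define C where "C b = {\<kappa> :: 'e \<Rightarrow> 'c. (card (\<kappa> ` edges G) = 1) = b}" for b
  have cls: "colouring_equiv G `` {\<kappa>} = C (card (\<kappa> ` edges G) = 1)" for \<kappa> :: "'e \<Rightarrow> 'c"
    unfolding C_def using colouring_equiv_iff[OF inf, of \<kappa>] by auto
  have ne: "edges G \<noteq> {}" using card_edges by auto
  obtain a b :: 'c where ab: "a \<noteq> b" using ex_new_if_finite[OF inf, of "{undefined}"] by auto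
  define \<kappa>\<^sub>1 \<kappa>\<^sub>2 :: "'e \<Rightarrow> 'c" where "\<kappa>\<^sub>1 = (\<lambda>_. a)" and "\<kappa>\<^sub>2 = (\<lambda>t. if t = (SOME e. e \<in> edges G) then a else b)"
  have one: "card (\<kappa>\<^sub>1 ` edges G) = 1" unfolding \<kappa>\<^sub>1_def using ne by (simp add: image_constant_conv)
  have two: "card (\<kappa>\<^sub>2 ` edges G) \<noteq> 1"
  proof
    assume "card (\<kappa>\<^sub>2 ` edges G) = 1"
    then obtain k where k: "\<kappa>\<^sub>2 ` edges G = {k}" by (rule card_1_singletonE)
    define e where "e = (SOME e. e \<in> edges G)"
    have e: "e \<in> edges G" unfolding e_def using ne some_in_eq by blast
    have "edges G \<noteq> {e}" using card_edges by auto
    then obtain f where f: "f \<in> edges G" "f \<noteq> e" using e by blast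
    have "\<kappa>\<^sub>2 e \<in> {k}" "\<kappa>\<^sub>2 f \<in> {k}" using e f(1) k by blast+
    then show False using ab f(2) unfolding \<kappa>\<^sub>2_def e_def[symmetric] by simp
  qed
  have "(colourings G :: ('e \<Rightarrow> 'c) set) // colouring_equiv G = {C False, C True}"
  proof (rule Set.set_eqI)
    fix X
    have "X \<in> (colourings G :: ('e \<Rightarrow> 'c) set) // colouring_equiv G \<longleftrightarrow> (\<exists>\<kappa> :: 'e \<Rightarrow> 'c. X = C (card (\<kappa> ` edges G) = 1))"
      unfolding quotient_def colourings_UNIV cls by simp
    also have "\<dots> \<longleftrightarrow> X \<in> {C False, C True}"
    proof
      assume "\<exists>\<kappa> :: 'e \<Rightarrow> 'c. X = C (card (\<kappa> ` edges G) = 1)"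
      then obtain \<kappa> :: "'e \<Rightarrow> 'c" where X: "X = C (card (\<kappa> ` edges G) = 1)" by blast
      show "X \<in> {C False, C True}" unfolding X by (cases "card (\<kappa> ` edges G) = 1") simp_all
    next
      assume "X \<in> {C False, C True}"
      then consider "X = C (card (\<kappa>\<^sub>1 ` edges G) = 1)" | "X = C (card (\<kappa>\<^sub>2 ` edges G) = 1)"
        using one two by auto
      then show "\<exists>\<kappa> :: 'e \<Rightarrow> 'c. X = C (card (\<kappa> ` edges G) = 1)" by cases blast+
    qed
    finally show "X \<in> (colourings G :: ('e \<Rightarrow> 'c) set) // colouring_equiv G \<longleftrightarrow> X \<in> {C False, C True}" .
  qed
  moreover have "\<kappa>\<^sub>1 \<in> C True" "\<kappa>\<^sub>1 \<notin> C False" using one unfolding C_def by simp_all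
  then have "C False \<noteq> C True" by blast
  ultimately show ?thesis by simp
qed

end

section \<open>Invertible functions on the one-colour surface\<close>

definition polynomial_map :: "(complex \<Rightarrow> complex) \<Rightarrow> bool" where
  "polynomial_map g \<longleftrightarrow> (\<exists>P. \<forall>t. g t = poly P t)"

text \<open>The value at 0 is left free, since the curves in question live on the punctured
  line.\<close>

definition laurent_map :: "(complex \<Rightarrow> complex) \<Rightarrow> bool" where
  "laurent_map g \<longleftrightarrow> (\<exists>P N. \<forall>t. t \<noteq> 0 \<longrightarrow> g t * t ^ N = poly P t)"

lemma polynomial_map_const: "polynomial_map (\<lambda>_. c)"
  unfolding polynomial_map_def by (intro exI[of _ "[:c:]"]) simp

lemma polynomial_map_ident: "polynomial_map (\<lambda>t. t)"
  unfolding polynomial_map_def by (intro exI[of _ "[:0, 1:]"]) simp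

lemma polynomial_map_add:
  assumes "polynomial_map f" "polynomial_map g"
  shows "polynomial_map (\<lambda>t. f t + g t)"
proof -
  obtain P Q where "\<forall>t. f t = poly P t" "\<forall>t. g t = poly Q t" using assms unfolding polynomial_map_def by auto
  then show ?thesis unfolding polynomial_map_def by (intro exI[of _ "P + Q"]) simp
qed

lemma polynomial_map_mult:
  assumes "polynomial_map f" "polynomial_map g"
  shows "polynomial_map (\<lambda>t. f t * g t)"
proof -
  obtain P Q where "\<forall>t. f t = poly P t" "\<forall>t. g t = poly Q t" using assms unfolding polynomial_map_def by auto
  then show ?thesis unfolding polynomial_map_def by (intro exI[of _ "P * Q"]) simp
qed

lemma polynomial_map_minus:
  assumes "polynomial_map f" "polynomial_map g"
  shows "polynomial_map (\<lambda>t. f t - g t)"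
  using polynomial_map_add[OF assms(1) polynomial_map_mult[OF polynomial_map_const[of "-1"] assms(2)]] by simp

lemma polynomial_map_divide: "polynomial_map f \<Longrightarrow> polynomial_map (\<lambda>t. f t / c)"
  using polynomial_map_mult[OF _ polynomial_map_const[of "1 / c"], of f] by simp

lemmas polynomial_maps = polynomial_map_const polynomial_map_ident polynomial_map_add polynomial_map_minus
  polynomial_map_mult polynomial_map_divide

lemma laurent_map_polynomial: "polynomial_map f \<Longrightarrow> laurent_map f"
  unfolding polynomial_map_def laurent_map_def by (metis mult.right_neutral power_0)

lemma laurent_map_over_t: "polynomial_map f \<Longrightarrow> laurent_map (\<lambda>t. f t / t)"
  unfolding polynomial_map_def laurent_map_def by (metis nonzero_eq_divide_eq power_one_right)

lemma laurent_map_add: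
  assumes "laurent_map f" "laurent_map g"
  shows "laurent_map (\<lambda>t. f t + g t)"
proof -
  obtain P M Q N where *: "\<And>t. t \<noteq> 0 \<Longrightarrow> f t * t ^ M = poly P t" "\<And>t. t \<noteq> 0 \<Longrightarrow> g t * t ^ N = poly Q t"
    using assms unfolding laurent_map_def by auto
  have "(f t + g t) * t ^ (M + N) = poly (P * monom 1 N + Q * monom 1 M) t" if "t \<noteq> 0" for t
    by (simp add: poly_monom flip: *[OF that]) (simp add: algebra_simps power_add)
  then show ?thesis unfolding laurent_map_def by blast
qed

lemma laurent_map_mult:
  assumes "laurent_map f" "laurent_map g"
  shows "laurent_map (\<lambda>t. f t * g t)"
proof -
  obtain P M Q N where *: "\<And>t. t \<noteq> 0 \<Longrightarrow> f t * t ^ M = poly P t" "\<And>t. t \<noteq> 0 \<Longrightarrow> g t * t ^ N = poly Q t"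
    using assms unfolding laurent_map_def by auto
  have "(f t * g t) * t ^ (M + N) = poly (P * Q) t" if "t \<noteq> 0" for t
    by (simp flip: *[OF that]) (simp add: algebra_simps power_add)
  then show ?thesis unfolding laurent_map_def by blast
qed

text \<open>A nonconstant complex polynomial has a root.\<close>

lemma nonvanishing_polynomial_map_const:
  assumes "polynomial_map g" "\<And>t. g t \<noteq> 0"
  shows "g s = g t"
proof -
  obtain P where P: "\<And>t. g t = poly P t" using assms(1) unfolding polynomial_map_def by auto
  have "\<not> (\<exists>z. poly P z = 0)" using assms(2) P by auto
  then have "constant (poly P)" using fundamental_theorem_of_algebra[of P] by blast
  then show ?thesis unfolding constant_def P by blast
qed

text \<open>Splitting off the full power of \<open>t\<close> from the numerator leaves a polynomial
  that is nonzero at 0 as well, hence constant; only an exponent of \<open>t\<close>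
  survives.\<close>

lemma nonvanishing_laurent_map:
  assumes "laurent_map g" "\<And>t. t \<noteq> 0 \<Longrightarrow> g t \<noteq> 0"
  shows "\<exists>c n. \<forall>t. t \<noteq> 0 \<longrightarrow> g t = c * t powi n"
proof -
  obtain P N where P: "\<And>t. t \<noteq> 0 \<Longrightarrow> g t * t ^ N = poly P t" using assms(1) unfolding laurent_map_def by auto
  have "poly P 1 \<noteq> 0" using P[of 1] assms(2)[of 1] by simp
  then have "P \<noteq> 0" by auto
  then obtain Q where Q: "P = [:- 0, 1:] ^ order 0 P * Q" "\<not> [:- 0, 1:] dvd Q" using order_decomp by blast
  have Q0: "poly Q 0 \<noteq> 0" using Q(2) by (simp add: poly_eq_0_iff_dvd)
  have "poly Q t \<noteq> 0" for t
  proof (cases "t = 0")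
    case False
    then have "poly P t \<noteq> 0" using P[OF False, symmetric] assms(2)[OF False] by simp
    then show ?thesis by (subst (asm) Q(1)) simp
  qed (use Q0 in simp)
  then have const: "poly Q t = poly Q 0" for t
    by (intro nonvanishing_polynomial_map_const[of "poly Q"]) (auto simp: polynomial_map_def)
  have "g t = poly Q 0 * t powi (int (order 0 P) - int N)" if t: "t \<noteq> 0" for t
  proof -
    have "poly P t = t ^ order 0 P * poly Q t" by (subst Q(1)) (simp add: poly_power)
    then have "g t * t ^ N = t ^ order 0 P * poly Q 0" using P[OF t] const[of t] by simp
    then show ?thesis using t by (simp add: power_int_diff field_simps)
  qed
  then show ?thesis by blast
qed

text \<open>For the order \<open>x < y < z\<close> of the nodes, the coordinates are \<open>a = v\<^sub>x\<^sub>y\<close>, \<open>A = v\<^sub>y\<^sub>x\<close>, \<open>b = v\<^sub>y\<^sub>z\<close>, \<open>M = v\<^sub>z\<^sub>x\<close>,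
  \<open>w = v\<^sub>z\<^sub>y + v\<^sub>x\<^sub>y v\<^sub>z\<^sub>x\<close> and \<open>m = v\<^sub>x\<^sub>y v\<^sub>y\<^sub>z - v\<^sub>x\<^sub>z\<close>; in them the moment equations are those below,
  with \<open>q3 = q\<^sub>z\<close> and \<open>k = q\<^sub>y q\<^sub>z\<close>.\<close>

definition on_surface ::
  "complex \<Rightarrow> complex \<Rightarrow> complex \<Rightarrow> complex \<Rightarrow> complex \<Rightarrow> complex \<Rightarrow> complex \<Rightarrow> complex \<Rightarrow> bool" where
  "on_surface k q3 a A b w m M \<longleftrightarrow> b * w + (1 - m * M) = q3 \<and> (1 + a * A) * (1 - m * M) + m * A * w = k"

text \<open>Axiomatises a unit of the invariant ring as a function of the six coordinates.
  \<open>torus\<close> is invariance under the gauge group modulo scalars; \<open>line\<close> and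
  \<open>punctured\<close> are what the absence of zeros gives along curves. In \<open>par\<close>,
  the conditions \<open>q3 \<noteq> 1\<close>, \<open>k \<noteq> 1\<close> and
  \<open>k \<noteq> q3\<close> express \<open>q z \<noteq> 1\<close>,
  \<open>q y * q z \<noteq> 1\<close> and \<open>q y \<noteq> 1\<close>.\<close>

locale surface_unit =
  fixes k q3 :: complex and f :: "complex \<Rightarrow> complex \<Rightarrow> complex \<Rightarrow> complex \<Rightarrow> complex \<Rightarrow> complex \<Rightarrow> complex"
  assumes par: "k \<noteq> 0" "k \<noteq> 1" "q3 \<noteq> 0" "q3 \<noteq> 1" "k \<noteq> q3"
    and nonzero: "on_surface k q3 a A b w m M \<Longrightarrow> f a A b w m M \<noteq> 0"
    and torus: "\<nu> \<noteq> 0 \<Longrightarrow> \<mu> \<noteq> 0 \<Longrightarrow> on_surface k q3 a A b w m M \<Longrightarrow>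
      f (a * \<nu>) (A / \<nu>) (b * \<mu>) (w / \<mu>) (m * (\<nu> * \<mu>)) (M / (\<nu> * \<mu>)) = f a A b w m M"
    and line: "polynomial_map \<alpha> \<Longrightarrow> polynomial_map \<alpha>' \<Longrightarrow> polynomial_map \<beta> \<Longrightarrow> polynomial_map \<omega> \<Longrightarrow>
      polynomial_map \<gamma> \<Longrightarrow> polynomial_map \<gamma>' \<Longrightarrow> (\<And>t. on_surface k q3 (\<alpha> t) (\<alpha>' t) (\<beta> t) (\<omega> t) (\<gamma> t) (\<gamma>' t)) \<Longrightarrow>
      f (\<alpha> s) (\<alpha>' s) (\<beta> s) (\<omega> s) (\<gamma> s) (\<gamma>' s) = f (\<alpha> t) (\<alpha>' t) (\<beta> t) (\<omega> t) (\<gamma> t) (\<gamma>' t)"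
    and punctured: "laurent_map \<alpha> \<Longrightarrow> laurent_map \<alpha>' \<Longrightarrow> laurent_map \<beta> \<Longrightarrow> laurent_map \<omega> \<Longrightarrow>
      laurent_map \<gamma> \<Longrightarrow> laurent_map \<gamma>' \<Longrightarrow> (\<And>t. t \<noteq> 0 \<Longrightarrow> on_surface k q3 (\<alpha> t) (\<alpha>' t) (\<beta> t) (\<omega> t) (\<gamma> t) (\<gamma>' t)) \<Longrightarrow>
      \<exists>c n. \<forall>t. t \<noteq> 0 \<longrightarrow> f (\<alpha> t) (\<alpha>' t) (\<beta> t) (\<omega> t) (\<gamma> t) (\<gamma>' t) = c * t powi n"
begin

text \<open>A section over the part \<open>m A w \<noteq> 0\<close> of the quotient by the torus, with
  \<open>X = 1 + a A\<close> and \<open>\<tau> = 1 - m M\<close>.\<close>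

definition \<sigma> :: "complex \<Rightarrow> complex \<Rightarrow> complex" where
  "\<sigma> X \<tau> = f (X - 1) 1 (q3 - \<tau>) 1 (k - X * \<tau>) ((1 - \<tau>) / (k - X * \<tau>))"

lemma section_point: "X * \<tau> \<noteq> k \<Longrightarrow> on_surface k q3 (X - 1) 1 (q3 - \<tau>) 1 (k - X * \<tau>) ((1 - \<tau>) / (k - X * \<tau>))"
proof -
  assume "X * \<tau> \<noteq> k"
  then have "(k - X * \<tau>) * ((1 - \<tau>) / (k - X * \<tau>)) = 1 - \<tau>" by simp
  then show ?thesis unfolding on_surface_def by (simp only: mult_1_right) (simp add: algebra_simps)
qed

lemma \<sigma>_nonzero: "X * \<tau> \<noteq> k \<Longrightarrow> \<sigma> X \<tau> \<noteq> 0"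
  unfolding \<sigma>_def by (rule nonzero) (rule section_point)

lemma \<sigma>_one: "\<tau> \<noteq> k \<Longrightarrow> \<sigma> 1 \<tau> = \<sigma> 1 0"
proof -
  have Y: "on_surface k q3 0 (k - \<tau>) (q3 - \<tau>) 1 1 (1 - \<tau>)" for \<tau> unfolding on_surface_def by simp
  have eq: "\<sigma> 1 \<tau> = f 0 (k - \<tau>) (q3 - \<tau>) 1 1 (1 - \<tau>)" if "\<tau> \<noteq> k" for \<tau>
    using torus[of "k - \<tau>" 1, OF _ _ Y, of \<tau>] that unfolding \<sigma>_def by simp
  assume "\<tau> \<noteq> k"
  moreover have "f 0 (k - \<tau>) (q3 - \<tau>) 1 1 (1 - \<tau>) = f 0 (k - 0) (q3 - 0) 1 1 (1 - 0)"
    by (rule line[of "\<lambda>_. 0" "\<lambda>t. k - t" "\<lambda>t. q3 - t" "\<lambda>_. 1" "\<lambda>_. 1" "\<lambda>t. 1 - t"]; (intro polynomial_maps)?; use Y in simp)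
  ultimately show ?thesis using eq[of \<tau>] eq[of 0] par(1) by simp
qed

text \<open>On the curve \<open>X * \<tau> = r\<close> the denominator of the section is the
  constant \<open>k - r\<close>, so the only puncture is at \<open>s = 0\<close>. The coefficient is
  read off at \<open>s = 1\<close> from \<open>\<sigma>_one\<close>.\<close>

lemma \<sigma>_hyperbola:
  assumes "r \<noteq> k"
  shows "\<exists>n. \<forall>s. s \<noteq> 0 \<longrightarrow> \<sigma> s (r / s) = \<sigma> 1 0 * s powi n"
proof -
  have "\<exists>c n. \<forall>s. s \<noteq> 0 \<longrightarrow> f (s - 1) 1 (q3 - r / s) 1 (k - r) ((1 - r / s) / (k - r)) = c * s powi n"
  proof (rule punctured)
    have r: "laurent_map (\<lambda>s. r / s)" by (rule laurent_map_over_t) (intro polynomial_maps)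
    show "laurent_map (\<lambda>s. s - 1)" "laurent_map (\<lambda>_. 1)" "laurent_map (\<lambda>_. 1)" "laurent_map (\<lambda>s. k - r)"
      by (rule laurent_map_polynomial, intro polynomial_maps)+
    have "laurent_map (\<lambda>s. q3 + (-1) * (r / s))" "laurent_map (\<lambda>s. (1 + (-1) * (r / s)) * (1 / (k - r)))"
      by (intro laurent_map_add laurent_map_mult r laurent_map_polynomial polynomial_map_const)+
    then show "laurent_map (\<lambda>s. q3 - r / s)" "laurent_map (\<lambda>s. (1 - r / s) / (k - r))" by simp_all
    show "on_surface k q3 (s - 1) 1 (q3 - r / s) 1 (k - r) ((1 - r / s) / (k - r))" if "s \<noteq> 0" for s
      using section_point[of s "r / s"] that assms by simp
  qed
  then obtain c n where cn: "\<And>s. s \<noteq> 0 \<Longrightarrow> f (s - 1) 1 (q3 - r / s) 1 (k - r) ((1 - r / s) / (k - r)) = c * s powi n"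
    by blast
  have \<sigma>: "\<sigma> s (r / s) = c * s powi n" if "s \<noteq> 0" for s using cn[OF that] that unfolding \<sigma>_def by simp
  have "c = \<sigma> 1 0" using \<sigma>[of 1] \<sigma>_one[OF assms] by simp
  then show ?thesis using \<sigma> by blast
qed

text \<open>At \<open>\<tau> = 0\<close> the denominator is the constant \<open>k\<close>, so
  \<open>X\<close> runs over an affine line.\<close>

lemma \<sigma>_zero_right: "\<sigma> X 0 = \<sigma> 1 0"
proof -
  have "f (X - 1) 1 q3 1 k (1 / k) = f (1 - 1) 1 q3 1 k (1 / k)"
    by (rule line[of "\<lambda>t. t - 1" "\<lambda>_. 1" "\<lambda>_. q3" "\<lambda>_. 1" "\<lambda>_. k" "\<lambda>_. 1 / k"]; (intro polynomial_maps)?; use par in \<open>simp add: on_surface_def\<close>)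
  then show ?thesis unfolding \<sigma>_def by simp
qed

lemma \<sigma>_zero_left: "\<sigma> 0 \<tau> = \<sigma> 1 0"
proof -
  have "f (-1) 1 (q3 - \<tau>) 1 k ((1 - \<tau>) / k) = f (-1) 1 (q3 - 0) 1 k ((1 - 0) / k)"
    by (rule line[of "\<lambda>_. -1" "\<lambda>_. 1" "\<lambda>t. q3 - t" "\<lambda>_. 1" "\<lambda>_. k" "\<lambda>t. (1 - t) / k"]; (intro polynomial_maps)?; use par in \<open>simp add: on_surface_def\<close>)
  then have "\<sigma> 0 \<tau> = \<sigma> 0 0" unfolding \<sigma>_def by simp
  then show ?thesis using \<sigma>_zero_right by simp
qed

text \<open>On the line \<open>X = 2\<close> the single puncture is \<open>\<tau> = k / 2\<close>,
  which the shift moves to \<open>t = 0\<close>. The number 2 serves because its integral powers are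
  positive and equal 1 only for exponent 0.\<close>

lemma \<sigma>_two: "\<exists>c n. \<forall>t. t \<noteq> 0 \<longrightarrow> \<sigma> 2 (t + k / 2) = c * t powi n"
proof -
  have "\<exists>c n. \<forall>t. t \<noteq> 0 \<longrightarrow> f 1 1 (q3 - (t + k / 2)) 1 (- 2 * t) (((t + k / 2) - 1) / 2 / t) = c * t powi n"
  proof (rule punctured)
    show "laurent_map (\<lambda>_. 1)" "laurent_map (\<lambda>_. 1)" "laurent_map (\<lambda>_. 1)" "laurent_map (\<lambda>t. q3 - (t + k / 2))"
      "laurent_map (\<lambda>t. - 2 * t)" by (rule laurent_map_polynomial, intro polynomial_maps)+
    show "laurent_map (\<lambda>t. ((t + k / 2) - 1) / 2 / t)" by (rule laurent_map_over_t) (intro polynomial_maps)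
    show "on_surface k q3 1 1 (q3 - (t + k / 2)) 1 (- 2 * t) (((t + k / 2) - 1) / 2 / t)" if "t \<noteq> 0" for t
      using that unfolding on_surface_def by (simp add: field_simps)
  qed
  then obtain c n where cn: "\<And>t. t \<noteq> 0 \<Longrightarrow> f 1 1 (q3 - (t + k / 2)) 1 (- 2 * t) (((t + k / 2) - 1) / 2 / t) = c * t powi n"
    by blast
  have "\<sigma> 2 (t + k / 2) = c * t powi n" if "t \<noteq> 0" for t
  proof -
    have "k - 2 * (t + k / 2) = - 2 * t" by (simp add: algebra_simps)
    moreover have "(1 - (t + k / 2)) / (- 2 * t) = ((t + k / 2) - 1) / 2 / t" using that by (simp add: field_simps)
    ultimately show ?thesis using cn[OF that] unfolding \<sigma>_def by simp
  qed
  then show ?thesis by blast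
qed

lemma power_two_Re_pos: "Re (2 powi n) > 0"
proof -
  have "(2 :: complex) powi n = of_real (2 powi n)" by simp
  then have "Re (2 powi n) = 2 powi n" by (metis Re_complex_of_real)
  then show ?thesis by simp
qed

lemma power_two_eq_one: "(2 :: complex) powi n = 1 \<Longrightarrow> n = 0"
proof (rule ccontr)
  assume a: "(2 :: complex) powi n = 1" "n \<noteq> 0"
  have pos: "(2 :: complex) powi m \<noteq> 1" if "m > 0" for m
  proof -
    have "(2 :: real) ^ nat m > 1" using that by (intro one_less_power) auto
    moreover have "(2 :: complex) powi m = of_real (2 ^ nat m)" using that by (simp add: power_int_def)
    ultimately show ?thesis by (metis less_irrefl of_real_eq_1_iff)
  qed
  have "(2 :: complex) powi (- n) = 1" using a(1) by (simp add: power_int_minus)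
  then show False using a pos[of n] pos[of "- n"] by (cases "n > 0") auto
qed

text \<open>The exponent of \<open>\<sigma> 2\<close> vanishes: otherwise \<open>\<sigma> 2 / \<sigma> 1 0\<close> would take the value \<open>-1\<close>, while by
  \<open>\<sigma>_hyperbola\<close> all its values are powers of \<open>2\<close>.\<close>

lemma \<sigma>_const:
  assumes "X * \<tau> \<noteq> k"
  shows "\<sigma> X \<tau> = \<sigma> 1 0"
proof (cases "X = 0")
  case True
  then show ?thesis using \<sigma>_zero_left by simp
next
  case False
  let ?c = "\<sigma> 1 0"
  have c0: "?c \<noteq> 0" using \<sigma>_nonzero[of 1 0] par(1) by simp
  obtain l n where l: "\<And>t. t \<noteq> 0 \<Longrightarrow> \<sigma> 2 (t + k / 2) = l * t powi n" using \<sigma>_two by blast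
  \<comment> \<open>The parameter \<open>t = - k / 2\<close> is the point \<open>\<tau> = 0\<close>,
    where the value is known.\<close>
  have l0: "l * (- k / 2) powi n = ?c" using l[of "- k / 2"] \<sigma>_zero_right[of 2] par(1) by simp
  \<comment> \<open>The point with \<open>X = 2\<close> and \<open>\<tau> = (k - k * u) / 2\<close>
    lies on the hyperbola \<open>X * \<tau> = k - k * u\<close> as well; comparing the two monomials
    there expresses \<open>u powi n\<close> as a power of 2.\<close>
  have two: "\<exists>m. u powi n = 2 powi m" if u: "u \<noteq> 0" for u :: complex
  proof -
    have "k - k * u \<noteq> k" using u par(1) by simp
    from \<sigma>_hyperbola[OF this] obtain m where "\<forall>s. s \<noteq> 0 \<longrightarrow> \<sigma> s ((k - k * u) / s) = ?c * s powi m" by blast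
    then have m: "\<sigma> 2 ((k - k * u) / 2) = ?c * 2 powi m" by simp
    have t: "(k - k * u) / 2 = (- k / 2) * u + k / 2" by (simp add: field_simps)
    have "\<sigma> 2 ((k - k * u) / 2) = l * ((- k / 2) * u) powi n"
      unfolding t using u par(1) by (intro l) simp
    also have "\<dots> = ?c * u powi n" by (simp only: power_int_mult_distrib l0[symmetric] mult.assoc)
    finally show ?thesis using m c0 by (intro exI[of _ m]) simp
  qed
  have n0: "n = 0"
  proof (rule ccontr)
    assume "n \<noteq> 0"
    \<comment> \<open>This \<open>n\<close>-th root of -1 exists for negative \<open>n\<close>
      too.\<close>
    then have "cis (pi / n) powi n = -1" by (simp add: cis_power_int)
    moreover obtain m where "cis (pi / n) powi n = 2 powi m" using two[of "cis (pi / n)"] by auto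
    ultimately show False using power_two_Re_pos[of m] by simp
  qed
  obtain m where m: "\<And>s. s \<noteq> 0 \<Longrightarrow> \<sigma> s (X * \<tau> / s) = ?c * s powi m" using \<sigma>_hyperbola[OF assms] by blast
  \<comment> \<open>The hyperbola through \<open>(X, \<tau>)\<close> meets the line
    \<open>X = 2\<close>, where the function is now known to be constant, so the exponent on the
    hyperbola vanishes as well.\<close>
  have "X * \<tau> / 2 - k / 2 \<noteq> 0" using assms by simp
  from l[OF this] have "\<sigma> 2 (X * \<tau> / 2) = ?c" using n0 l0 by simp
  then have "(2 :: complex) powi m = 1" using m[of 2] c0 by simp
  then have "m = 0" by (rule power_two_eq_one)
  then show ?thesis using m[OF False] False by simp
qed

text \<open>The torus element with \<open>\<nu> = A\<close> and \<open>\<mu> = w\<close> normalises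
  \<open>A\<close> and \<open>w\<close> to 1; the equations of the surface then identify the other
  coordinates with those of the section.\<close>

lemma open_stratum:
  assumes "on_surface k q3 a A b w m M" "A \<noteq> 0" "w \<noteq> 0" "m \<noteq> 0"
  shows "f a A b w m M = \<sigma> 1 0"
proof -
  define X \<tau> where "X = 1 + a * A" and "\<tau> = 1 - m * M"
  have 1: "b * w = q3 - \<tau>" "m * (A * w) = k - X * \<tau>"
    using assms(1) unfolding on_surface_def X_def \<tau>_def by (simp_all add: algebra_simps)
  have ne: "k - X * \<tau> \<noteq> 0" using assms unfolding 1(2)[symmetric] by simp
  have "(1 - \<tau>) / (k - X * \<tau>) = (m * M) / (m * (A * w))" unfolding 1(2) by (simp add: \<tau>_def)
  then have "M / (A * w) = (1 - \<tau>) / (k - X * \<tau>)" using assms(4) by simp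
  moreover have "a * A = X - 1" unfolding X_def by simp
  ultimately have "f a A b w m M = \<sigma> X \<tau>"
    using torus[OF assms(2,3,1)] assms(2,3) unfolding \<sigma>_def 1 by simp
  then show ?thesis using \<sigma>_const ne by simp
qed

text \<open>A point off the open stratum is joined to it by a chain of affine lines.\<close>

theorem unit_const:
  assumes Y: "on_surface k q3 a A b w m M"
  shows "f a A b w m M = \<sigma> 1 0"
proof -
  define \<tau> where "\<tau> = 1 - m * M"
  have e: "b * w + \<tau> = q3" "(1 + a * A) * \<tau> + m * A * w = k" using Y unfolding on_surface_def \<tau>_def by auto
  consider "A \<noteq> 0" "w \<noteq> 0" "m \<noteq> 0" | "A = 0" | "A \<noteq> 0" "m = 0" | "A \<noteq> 0" "m \<noteq> 0" "w = 0" by blast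
  then show ?thesis
  proof cases
    case 1
    then show ?thesis by (rule open_stratum[OF Y])
  next
    case 2
    then have \<tau>: "\<tau> = k" using e(2) by simp
    then have w: "w \<noteq> 0" using e(1) par(5) by auto
    have m: "m \<noteq> 0" using \<tau> par(2) unfolding \<tau>_def by auto
    \<comment> \<open>While \<open>A = 0\<close>, the coordinate \<open>a\<close> moves freely. At
      this value \<open>a1 * k + m * w = 0\<close>, so the second equation holds for every
      \<open>A\<close>, and \<open>A\<close> can leave 0.\<close>
    define a1 where "a1 = - m * w / k"
    have mM: "1 - m * M = k" using \<tau> unfolding \<tau>_def .
    have s1: "f a 0 b w m M = f a1 0 b w m M"
      by (rule line[of "\<lambda>t. t" "\<lambda>_. 0" "\<lambda>_. b" "\<lambda>_. w" "\<lambda>_. m" "\<lambda>_. M"];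
         (intro polynomial_maps)?; use e \<tau> mM in \<open>simp add: on_surface_def\<close>)
    have Y1: "on_surface k q3 a1 t b w m M" for t
      using e(1) \<tau> mM par(1) unfolding on_surface_def mM a1_def by (simp add: field_simps)
    note s1
    also have "f a1 0 b w m M = f a1 1 b w m M"
      by (rule line[of "\<lambda>_. a1" "\<lambda>t. t" "\<lambda>_. b" "\<lambda>_. w" "\<lambda>_. m" "\<lambda>_. M"]; (intro polynomial_maps)?; use Y1 in simp)
    also have "\<dots> = \<sigma> 1 0" by (rule open_stratum[OF Y1]) (use w m in auto)
    finally show ?thesis using 2 by simp
  next
    case 3
    then have \<tau>: "\<tau> = 1" unfolding \<tau>_def by simp
    have w: "w \<noteq> 0" using e(1) \<tau> par(4) by auto
    have bw: "b * w = q3 - 1" and a: "a * A = k - 1" using e 3 \<tau> by (simp_all add: algebra_simps)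
    have s1: "f a A b w 0 M = f a A b w 0 0"
      by (rule line[of "\<lambda>_. a" "\<lambda>_. A" "\<lambda>_. b" "\<lambda>_. w" "\<lambda>_. 0" "\<lambda>t. t"];
         (intro polynomial_maps)?; use bw a in \<open>simp add: on_surface_def\<close>)
    \<comment> \<open>With \<open>M\<close> moved to 0, the term \<open>- t * w * A\<close> coming
      from \<open>a\<close> compensates \<open>m * A * w\<close> at \<open>m = t\<close>, so
      \<open>m\<close> can leave 0.\<close>
    have Y1: "on_surface k q3 (a - t * w) A b w t 0" for t
      using bw a unfolding on_surface_def by (simp add: algebra_simps)
    have s2: "f (a - 0 * w) A b w 0 0 = f (a - 1 * w) A b w 1 0"
      by (rule line[of "\<lambda>t. a - t * w" "\<lambda>_. A" "\<lambda>_. b" "\<lambda>_. w" "\<lambda>t. t" "\<lambda>_. 0"]; (intro polynomial_maps)?; use Y1 in simp)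
    note s1
    also have "f a A b w 0 0 = f (a - 1 * w) A b w 1 0" using s2 by simp
    also have "\<dots> = \<sigma> 1 0" by (rule open_stratum[OF Y1]) (use w 3 in auto)
    finally show ?thesis using 3 by simp
  next
    case 4
    then have \<tau>: "\<tau> = q3" using e(1) by simp
    have mM: "1 - m * M = q3" using \<tau> unfolding \<tau>_def .
    have a: "(1 + a * A) * q3 = k" using e(2) 4 \<tau> by simp
    have s1: "f a A b 0 m M = f a A 0 0 m M"
      by (rule line[of "\<lambda>_. a" "\<lambda>_. A" "\<lambda>t. t" "\<lambda>_. 0" "\<lambda>_. m" "\<lambda>_. M"];
         (intro polynomial_maps)?; use a mM in \<open>simp add: on_surface_def\<close>)
    \<comment> \<open>With \<open>b\<close> moved to 0, \<open>w\<close> is free in the first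
      equation; the correction of \<open>a\<close>, multiplied by \<open>q3 = 1 - m * M\<close>,
      balances \<open>m * A * w\<close> in the second.\<close>
    have Y1: "on_surface k q3 (a - m * t / q3) A 0 t m M" for t
    proof -
      have "(1 + (a - m * t / q3) * A) * q3 + m * A * t = (1 + a * A) * q3" using par(3) by (simp add: field_simps)
      then show ?thesis using a mM unfolding on_surface_def by simp
    qed
    have s2: "f (a - m * 0 / q3) A 0 0 m M = f (a - m * 1 / q3) A 0 1 m M"
      by (rule line[of "\<lambda>t. a - m * t / q3" "\<lambda>_. A" "\<lambda>_. 0" "\<lambda>t. t" "\<lambda>_. m" "\<lambda>_. M"]; (intro polynomial_maps)?; use Y1 in simp)
    note s1
    also have "f a A 0 0 m M = f (a - m * 1 / q3) A 0 1 m M" using s2 by simp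
    also have "\<dots> = \<sigma> 1 0" by (rule open_stratum[OF Y1]) (use 4 in auto)
    finally show ?thesis using 4 by simp
  qed
qed

end

section \<open>Dimension vector one\<close>

text \<open>An isomorphism of quotients identifies the rings of regular functions, so the
  nonconstant unit \<open>u\<close> would give a nonconstant unit on the other side. Evaluation
  characters translate relations between functions on the spectrum into relations between functions
  on the space.\<close>

lemma git_quotient_not_isomorphic:
  fixes G :: "('v, 'e) graph"
  assumes X: "gauge_stable G d X" and u: "u \<in> invariant_ring G d X" "u' \<in> invariant_ring G d X"
    and uu: "\<And>x. x \<in> X \<Longrightarrow> u x * u' x = 1" and x: "x \<in> X" "x' \<in> X" "u x \<noteq> u x'"
    and Y: "\<And>f g. f \<in> invariant_ring G d Y \<Longrightarrow> g \<in> invariant_ring G d Y \<Longrightarrow>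
      (\<And>y. y \<in> Y \<Longrightarrow> f y * g y = 1) \<Longrightarrow> \<exists>c. \<forall>y\<in>Y. f y = c"
  shows "\<not> variety_isomorphic (git_quotient G d X) (git_quotient G d Y)"
proof
  assume "variety_isomorphic (git_quotient G d X) (git_quotient G d Y)"
  let ?A = "invariant_ring G d X" and ?B = "invariant_ring G d Y"
  let ?PX = "spec_points X ?A" and ?PY = "spec_points Y ?B"
  obtain \<phi> \<psi> where "variety_morphism (git_quotient G d X) (git_quotient G d Y) \<phi>"
    "variety_morphism (git_quotient G d Y) (git_quotient G d X) \<psi>"
    and inv: "\<forall>\<chi>\<in>fst (git_quotient G d X). \<psi> (\<phi> \<chi>) = \<chi>"
    using \<open>variety_isomorphic _ _\<close> unfolding variety_isomorphic_def by blast
  then have \<phi>: "\<phi> \<in> ?PX \<rightarrow> ?PY" and \<psi>: "\<psi> \<in> ?PY \<rightarrow> ?PX"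
    and pull: "\<And>r. r \<in> (\<lambda>f. restrict (\<lambda>\<chi>. \<chi> f) ?PX) ` ?A \<Longrightarrow>
      restrict (r \<circ> \<psi>) ?PY \<in> (\<lambda>f. restrict (\<lambda>\<chi>. \<chi> f) ?PY) ` ?B"
    unfolding variety_morphism_def git_quotient_def spec_def by auto
  have eval: "(\<lambda>f\<in>invariant_ring G d Z. f z) \<in> spec_points Z (invariant_ring G d Z)"
    if "gauge_stable G d Z" "z \<in> Z" for Z :: "('v, 'e) rep set" and z
    unfolding spec_points_def using invariant_ring_closed[OF that(1)] that(2) by auto
  have "\<phi> (\<lambda>f\<in>?A. f x) \<in> ?PY" using \<phi> eval[OF X x(1)] by blast
  then have c: "\<exists>\<chi>. \<chi> \<in> ?PY" by blast
  \<comment> \<open>One character of the ring of \<open>Y\<close> suffices for stability. Being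
    extensional, it takes the value \<open>undefined\<close> off the ring, yet it sends the constant
    \<open>undefined + 1\<close> to itself, so this constant lies in the ring. Its invariance keeps
    the action inside \<open>Y\<close>, because the function is \<open>undefined\<close>
    elsewhere.\<close>
  have stY: "gauge_stable G d Y"
  proof -
    obtain \<chi> where \<chi>: "\<chi> \<in> ?PY" using c by blast
    let ?a = "undefined + 1 :: complex"
    have "restrict (\<lambda>_. ?a) Y \<in> ?B"
    proof (rule ccontr)
      assume "restrict (\<lambda>_. ?a) Y \<notin> ?B"
      then have "\<chi> (restrict (\<lambda>_. ?a) Y) = undefined" using \<chi> unfolding spec_points_def extensional_def by blast
      moreover have "\<chi> (restrict (\<lambda>_. ?a) Y) = ?a" using \<chi> unfolding spec_points_def by blast
      ultimately show False by simp
    qed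
    then have "restrict (\<lambda>_. ?a) Y (gauge_act G h y) = ?a" if "h \<in> gauge_group G d" "y \<in> Y" for h y
      using that unfolding invariant_ring_def by fastforce
    then show ?thesis unfolding gauge_stable_def by (metis add_cancel_right_right restrict_apply one_neq_zero)
  qed
  have ex: "\<exists>f\<in>?B. \<forall>\<chi>\<in>?PY. \<psi> \<chi> r = \<chi> f" if r: "r \<in> ?A" for r
  proof -
    have "restrict (restrict (\<lambda>\<chi>. \<chi> r) ?PX \<circ> \<psi>) ?PY \<in> (\<lambda>f. restrict (\<lambda>\<chi>. \<chi> f) ?PY) ` ?B"
      using r by (intro pull) blast
    then obtain f where f: "f \<in> ?B" "restrict (restrict (\<lambda>\<chi>. \<chi> r) ?PX \<circ> \<psi>) ?PY = restrict (\<lambda>\<chi>. \<chi> f) ?PY" by blast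
    have "\<psi> \<chi> r = \<chi> f" if "\<chi> \<in> ?PY" for \<chi>
      using fun_cong[OF f(2), of \<chi>] that \<psi> by (auto simp: Pi_iff)
    then show ?thesis using f(1) by blast
  qed
  obtain f where f: "f \<in> ?B" "\<forall>\<chi>\<in>?PY. \<psi> \<chi> u = \<chi> f" using ex[OF u(1)] by blast
  obtain g where g: "g \<in> ?B" "\<forall>\<chi>\<in>?PY. \<psi> \<chi> u' = \<chi> g" using ex[OF u(2)] by blast
  have "f y * g y = 1" if y: "y \<in> Y" for y
  proof -
    let ?\<chi> = "\<lambda>f\<in>?B. f y"
    have \<chi>: "?\<chi> \<in> ?PY" by (rule eval[OF stY y])
    then have \<psi>\<chi>: "\<psi> ?\<chi> \<in> ?PX" using \<psi> by blast
    have "f y * g y = \<psi> ?\<chi> u * \<psi> ?\<chi> u'" using f g \<chi> by simp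
    also have "\<dots> = \<psi> ?\<chi> (restrict (\<lambda>x. u x * u' x) X)" using \<psi>\<chi> u unfolding spec_points_def by simp
    also have "restrict (\<lambda>x. u x * u' x) X = restrict (\<lambda>_. 1) X" using uu by (intro restrict_ext) simp
    also have "\<psi> ?\<chi> (restrict (\<lambda>_. 1) X) = 1" using \<psi>\<chi> unfolding spec_points_def by simp
    finally show ?thesis .
  qed
  then obtain c where c: "\<forall>y\<in>Y. f y = c" using Y[OF f(1) g(1)] by blast
  moreover have "f \<in> extensional Y" using f(1) unfolding invariant_ring_def coord_ring_iff by blast
  ultimately have "f = restrict (\<lambda>_. c) Y" by (auto simp: extensional_def restrict_def)
  \<comment> \<open>Every character fixes constants; hence \<open>u\<close>, which corresponds to
    \<open>f\<close>, takes the same value at all evaluation characters of \<open>X\<close>.\<close>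
  then have \<chi>f: "\<chi> f = c" if "\<chi> \<in> ?PY" for \<chi> using that unfolding spec_points_def by simp
  have "u a = c" if a: "a \<in> X" for a
  proof -
    let ?\<chi> = "\<lambda>f\<in>?A. f a"
    have \<chi>: "?\<chi> \<in> ?PX" by (rule eval[OF X a])
    then have \<phi>\<chi>: "\<phi> ?\<chi> \<in> ?PY" using \<phi> by blast
    have "u a = ?\<chi> u" using u(1) by simp
    also have "\<dots> = \<psi> (\<phi> ?\<chi>) u" using inv \<chi> unfolding git_quotient_def spec_def by simp
    also have "\<dots> = c" using f(2) \<phi>\<chi> \<chi>f[OF \<phi>\<chi>] by simp
    finally show ?thesis .
  qed
  then show False using x by simp
qed

section \<open>Matrices of size one and representations by numbers\<close>

definition scalar_mat :: "complex \<Rightarrow> complex mat" where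
  "scalar_mat a = mat 1 1 (\<lambda>_. a)"

lemma scalar_mat_simps [simp]:
  "scalar_mat a \<in> carrier_mat (Suc 0) (Suc 0)" "scalar_mat a $$ (0, 0) = a" "dim_row (scalar_mat a) = 1" "dim_col (scalar_mat a) = 1"
  "scalar_mat a + scalar_mat b = scalar_mat (a + b)" "scalar_mat a - scalar_mat b = scalar_mat (a - b)"
  "scalar_mat a * scalar_mat b = scalar_mat (a * b)" "scalar_mat a = scalar_mat b \<longleftrightarrow> a = b"
  "c \<cdot>\<^sub>m scalar_mat a = scalar_mat (c * a)"
proof -
  show "scalar_mat a = scalar_mat b \<longleftrightarrow> a = b"
  proof
    assume "scalar_mat a = scalar_mat b"
    then have "scalar_mat a $$ (0, 0) = scalar_mat b $$ (0, 0)" by simp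
    then show "a = b" by (simp add: scalar_mat_def)
  qed simp
qed (auto simp: scalar_mat_def scalar_prod_def intro!: eq_matI)

lemma one_mat_scalar: "1\<^sub>m 1 = scalar_mat 1" "1\<^sub>m (Suc 0) = scalar_mat 1"
  by (auto simp: scalar_mat_def intro!: eq_matI)

lemma scalar_matI: "A \<in> carrier_mat 1 1 \<Longrightarrow> A = scalar_mat (A $$ (0, 0))"
  by (auto simp: scalar_mat_def intro!: eq_matI)

lemma scalar_mat_inverse: "a \<noteq> 0 \<Longrightarrow> scalar_mat a \<in> GL 1 \<and> minv (scalar_mat a) = scalar_mat (1 / a)"
proof -
  assume "a \<noteq> 0"
  then have "scalar_mat a * scalar_mat (1 / a) = 1\<^sub>m 1" by (simp add: one_mat_scalar)
  then show ?thesis by (intro conjI GL_I[of _ _ "scalar_mat (1 / a)"] minv_eqI[of _ 1]) simp_all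
qed

lemma scalar_mat_GL: "scalar_mat a \<in> GL 1 \<longleftrightarrow> a \<noteq> 0"
proof
  assume "scalar_mat a \<in> GL 1"
  note A = minv_GL[OF this]
  have "scalar_mat a * scalar_mat (minv (scalar_mat a) $$ (0, 0)) = scalar_mat 1"
    using A(3) scalar_matI[OF A(2)] by (simp add: one_mat_scalar)
  then show "a \<noteq> 0" by auto
qed (use scalar_mat_inverse in blast)

context triangle_graph
begin

definition scalar_rep :: "('v \<Rightarrow> 'v \<Rightarrow> complex) \<Rightarrow> ('v, 'e) rep" where
  "scalar_rep v = (\<lambda>(e, x, y)\<in>arcs G. scalar_mat (v x y))"

lemma arrow_scalar_rep:
  "x \<in> nodes G \<Longrightarrow> y \<in> nodes G \<Longrightarrow> x \<noteq> y \<Longrightarrow> arrow G (scalar_rep v) x y = scalar_mat (v x y)"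
  unfolding arrow_def scalar_rep_def by (simp add: arcs_iff)

lemma scalar_rep_cong:
  assumes "\<And>x y. x \<in> nodes G \<Longrightarrow> y \<in> nodes G \<Longrightarrow> x \<noteq> y \<Longrightarrow> v x y = v' x y"
  shows "scalar_rep v = scalar_rep v'"
  unfolding scalar_rep_def using assms by (intro restrict_ext) (auto simp: arcs_iff)

lemma scalar_rep_Rep:
  assumes "\<And>x. x \<in> nodes G \<Longrightarrow> d x = 1"
  shows "scalar_rep v \<in> Rep G d"
proof (rule Rep_I)
  show "scalar_rep v \<in> extensional (arcs G)" by (simp add: scalar_rep_def)
qed (use assms in \<open>simp add: arrow_scalar_rep\<close>)

lemma Rep_scalar_rep:
  assumes d: "\<And>x. x \<in> nodes G \<Longrightarrow> d x = 1" and \<rho>: "\<rho> \<in> Rep G d"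
  shows "\<rho> = scalar_rep (\<lambda>x y. arrow G \<rho> x y $$ (0, 0))"
proof (rule ext)
  fix t :: "('v, 'e) arc"
  obtain e x y where t: "t = (e, x, y)" by (cases t) auto
  show "\<rho> t = scalar_rep (\<lambda>x y. arrow G \<rho> x y $$ (0, 0)) t"
  proof (cases "t \<in> arcs G")
    case True
    then have xy: "x \<in> nodes G" "y \<in> nodes G" "x \<noteq> y" "e = the_edge G x y" unfolding t arcs_iff by auto
    have "arrow G \<rho> x y = scalar_mat (arrow G \<rho> x y $$ (0, 0))"
      using arrow_carrier[OF \<rho> xy(1-3)] d[OF xy(1)] d[OF xy(2)] by (intro scalar_matI) simp
    then show ?thesis using True unfolding t scalar_rep_def by (simp add: arrow_def xy(4))
  next
    case False
    then show ?thesis using \<rho> unfolding t Rep_def PiE_def extensional_def scalar_rep_def by simp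
  qed
qed

lemma gauge_act_scalar_rep:
  assumes "\<And>x. x \<in> nodes G \<Longrightarrow> h x \<noteq> 0"
  shows "gauge_act G (\<lambda>x\<in>nodes G. scalar_mat (h x)) (scalar_rep v) = scalar_rep (\<lambda>x y. h x * v x y / h y)"
  using assms unfolding gauge_act_def scalar_rep_def
  by (intro restrict_ext) (auto simp: arcs_iff scalar_mat_inverse)

text \<open>In dimension one conjugation is trivial, so the entry is invariant, and invertibility of
  the matrix says that the entry has no zero.\<close>

lemma three_colour_unit:
  fixes lt q
  assumes d: "\<And>x. x \<in> nodes G \<Longrightarrow> d x = 1" and n: "x \<in> nodes G" "y \<in> nodes G" "x \<noteq> y"
  defines "X \<equiv> edge_fibre G lt q d"
  defines "u \<equiv> \<lambda>\<rho>. one_plus d (arrow G \<rho>) x y $$ (0, 0)"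
  shows "restrict u X \<in> invariant_ring G d X" "restrict (\<lambda>\<rho>. 1 / u \<rho>) X \<in> invariant_ring G d X"
    "\<And>\<rho>. \<rho> \<in> X \<Longrightarrow> u \<rho> \<noteq> 0"
proof -
  have st: "gauge_act G h \<rho> \<in> X" if "h \<in> gauge_group G d" "\<rho> \<in> X" for h \<rho>
    using gauge_stable_edge_fibre that unfolding X_def gauge_stable_def by blast
  have XR: "X \<subseteq> Rep G d" unfolding X_def using edge_fibreD(1) by blast
  have dx: "d x = 1" by (rule d[OF n(1)])
  have GL: "one_plus d (arrow G \<rho>) x y \<in> GL 1" if "\<rho> \<in> X" for \<rho>
    using edge_fibreD(2)[OF that[unfolded X_def] n] unfolding dx .
  have E: "one_plus d (arrow G \<rho>) x y = scalar_mat (u \<rho>)" if "\<rho> \<in> X" for \<rho>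
    unfolding u_def by (rule scalar_matI[OF GL_carrier[OF GL[OF that]]])
  show nz: "u \<rho> \<noteq> 0" if "\<rho> \<in> X" for \<rho> using GL[OF that] unfolding E[OF that] scalar_mat_GL .
  have reg: "regular_on G d X u"
    using mat_regular_one_plus[OF XR n] unfolding u_def mat_regular_def dx by simp
  have inv: "u (gauge_act G h \<rho>) = u \<rho>" if h: "h \<in> gauge_group G d" and \<rho>: "\<rho> \<in> X" for h \<rho>
  proof -
    have hx: "h x \<in> GL 1" using gauge_group_GL[OF h n(1)] unfolding dx .
    obtain a where a: "h x = scalar_mat a" using scalar_matI[OF GL_carrier[OF hx]] by blast
    have a0: "a \<noteq> 0" using hx unfolding a scalar_mat_GL .
    have "scalar_mat (u (gauge_act G h \<rho>)) = h x * one_plus d (arrow G \<rho>) x y * minv (h x)"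
      unfolding E[OF st[OF h \<rho>], symmetric] using \<rho> XR by (intro one_plus_gauge_act h n) blast
    also have "\<dots> = scalar_mat (u \<rho>)" unfolding E[OF \<rho>] a using a0 by (simp add: scalar_mat_inverse)
    finally show ?thesis by simp
  qed
  show "restrict u X \<in> invariant_ring G d X"
    unfolding invariant_ring_def coord_ring_iff using regular_on_cong[OF reg, of "restrict u X"] inv st by auto
  show "restrict (\<lambda>\<rho>. 1 / u \<rho>) X \<in> invariant_ring G d X"
    unfolding invariant_ring_def coord_ring_iff
    using regular_on_cong[OF regular_on_inverse[OF reg nz], of "restrict (\<lambda>\<rho>. 1 / u \<rho>) X"] inv st by auto
qed

text \<open>In dimension one the contributions at the two ends of an edge are inverse to each other.
  The contribution \<open>t\<close> at \<open>x\<close> of the edge \<open>xy\<close> therefore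
  determines all others through the equations at \<open>x\<close> and \<open>y\<close>, and the
  equation at \<open>z\<close> becomes \<open>q x * q y * q z = 1\<close>.\<close>

lemma three_colour_points:
  assumes d: "\<And>x. x \<in> nodes G \<Longrightarrow> d x = 1" and q: "admissible G q d"
    and lt: "\<And>x y. x \<in> nodes G \<Longrightarrow> y \<in> nodes G \<Longrightarrow> x \<noteq> y \<Longrightarrow> lt x y \<longleftrightarrow> \<not> lt y x"
    and N: "nodes G = {x, y, z}" "x \<noteq> y" "x \<noteq> z" "y \<noteq> z" and t: "t \<noteq> 0"
  shows "\<exists>\<rho>\<in>edge_fibre G lt q d. one_plus d (arrow G \<rho>) x y $$ (0, 0) = (if lt x y then 1 / t else t)"
proof -
  have q0: "q x \<noteq> 0" "q y \<noteq> 0" "q z \<noteq> 0" and q1: "q x * (q y * q z) = 1"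
    using q d N unfolding admissible_def param_power_def by auto
  define C where "C a b = (if a = x then if b = y then t else q x / t
      else if a = y then if b = x then 1 / t else q y * t else if b = x then t / q x else 1 / (q y * t))" for a b
  define E where "E a b = (if lt a b then 1 / C a b else C a b)" for a b
  \<comment> \<open>One arrow of each edge is \<open>E - 1\<close> and the opposite one is 1, so
    that \<open>1 + v a b * v b a = E a b\<close>.\<close>
  define v where "v a b = (if a = x \<or> a = y \<and> b = z then E a b - 1 else 1)" for a b
  have L: "lt y x = (\<not> lt x y)" "lt z x = (\<not> lt x z)" "lt z y = (\<not> lt y z)"
    using lt[of x y] lt[of x z] lt[of y z] N by auto
  have E0: "E a b \<noteq> 0" and vE: "1 + v a b * v b a = E a b" if "a \<in> nodes G" "b \<in> nodes G" "a \<noteq> b" for a b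
    using that N(2-) L q0 t unfolding N(1) E_def C_def v_def by auto
  let ?\<rho> = "scalar_rep v"
  have op: "one_plus d (arrow G ?\<rho>) a b = scalar_mat (E a b)" if ab: "a \<in> nodes G" "b \<in> nodes G" "a \<noteq> b" for a b
    unfolding d[OF ab(1)] arrow_scalar_rep[OF ab] arrow_scalar_rep[OF ab(2,1) ab(3)[symmetric]]
    by (simp add: one_mat_scalar vE[OF ab])
  have ec: "edge_contribution lt d (arrow G ?\<rho>) a b = scalar_mat (C a b)" if ab: "a \<in> nodes G" "b \<in> nodes G" "a \<noteq> b" for a b
    unfolding edge_contribution_def op[OF ab] using E0[OF ab] by (simp add: scalar_mat_inverse) (simp add: E_def)
  have "?\<rho> \<in> edge_fibre G lt q d"
    unfolding edge_fibre_def
  proof (intro CollectI conjI ballI impI)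
    show "?\<rho> \<in> Rep G d" by (rule scalar_rep_Rep[OF d])
    show "one_plus d (arrow G ?\<rho>) a b \<in> GL (d a)" if "a \<in> nodes G" "b \<in> nodes G" "a \<noteq> b" for a b
      unfolding op[OF that] using E0[OF that] d[OF that(1)] scalar_mat_GL by simp
    fix a b b' assume n: "a \<in> nodes G" "b \<in> nodes G" "b' \<in> nodes G" "a \<noteq> b" "a \<noteq> b'" "b \<noteq> b'"
    have zz: "1 / (q x * q y) = q z" using q0 q1 by (simp add: field_simps)
    have "C a b * C a b' = q a"
      using n N(2-) q0 t zz unfolding N(1) C_def by (auto simp: mult.commute)
    then show "edge_contribution lt d (arrow G ?\<rho>) a b * edge_contribution lt d (arrow G ?\<rho>) a b' = q a \<cdot>\<^sub>m 1\<^sub>m (d a)"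
      unfolding ec[OF n(1,2,4)] ec[OF n(1,3,5)] d[OF n(1)] by (simp add: one_mat_scalar)
  qed
  moreover have "one_plus d (arrow G ?\<rho>) x y $$ (0, 0) = (if lt x y then 1 / t else t)"
    using op[of x y] N by (simp add: E_def C_def)
  ultimately show ?thesis by blast
qed

end

text \<open>The three pivots of the elimination multiply to the determinant of
  \<open>v\<^sub>c\<^sub>- v\<^sub>c\<^sub>+\<close>, a product of unitriangular matrices. The
  letters are arrows here: \<open>a\<close>, \<open>m\<close>, \<open>b\<close> are
  \<open>v x y\<close>, \<open>v x z\<close>, \<open>v y z\<close>, and \<open>A\<close>,
  \<open>M\<close>, \<open>B\<close> are the opposite ones.\<close>

lemma schur_determinant:
  fixes a b m A B M :: complex
  assumes z: "zz = M * m + (B * b + 1)" "zz \<noteq> 0"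
    and y: "(A * a + 1) - (A * m + b) * (1 / zz * (M * a + B)) \<noteq> 0" (is "?yy \<noteq> 0")
  shows "zz * ?yy * ((1 - m * (1 / zz * M)) -
    (a - m * (1 / zz * (M * a + B))) * (1 / ?yy * (A - (A * m + b) * (1 / zz * M)))) = 1"
proof -
  \<comment> \<open>The two-by-two minors containing the pivot \<open>zz\<close>. The relation
    \<open>n1 * n4 - n2 * n3 = zz\<close> is Sylvester's identity for a matrix of determinant
    1.\<close>
  define n1 n2 n3 n4 where n: "n1 = zz - m * M" "n2 = a * zz - m * (M * a + B)" "n3 = A * zz - (A * m + b) * M"
    "n4 = (A * a + 1) * zz - (A * m + b) * (M * a + B)"
  have e: "1 - m * (1 / zz * M) = n1 / zz" "a - m * (1 / zz * (M * a + B)) = n2 / zz"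
    "A - (A * m + b) * (1 / zz * M) = n3 / zz" "?yy = n4 / zz"
    unfolding n using z(2) by (simp_all add: diff_divide_distrib)
  have "n1 * n4 - n2 * n3 = zz" unfolding n z(1) by (simp add: algebra_simps)
  moreover have "n4 \<noteq> 0" using y unfolding e by auto
  moreover have "zz * (n4 / zz) * (n1 / zz - n2 / zz * (1 / (n4 / zz) * (n3 / zz))) = (n1 * n4 - n2 * n3) / zz"
    using z(2) \<open>n4 \<noteq> 0\<close> by (simp add: field_simps)
  ultimately show ?thesis unfolding e using z(2) by simp
qed

context triangle_graph
begin

section \<open>The moment equations for one colour\<close>

lemma one_colour_order:
  assumes one: "card (\<kappa> ` edges G) = 1" and \<omega>: "valid_choices G \<kappa> \<omega>"
  obtains c x y z where "\<forall>e\<in>edges G. \<kappa> e = c" "nodes G = {x, y, z}" "x \<noteq> y" "x \<noteq> z" "y \<noteq> z"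
    "node_less (part_order \<omega> c) x y" "node_less (part_order \<omega> c) x z" "node_less (part_order \<omega> c) y z"
    "distinct (concat (part_order \<omega> c))" "nodes (mono_subgraph G \<kappa> c) = {x, y, z}"
proof -
  obtain c where im: "\<kappa> ` edges G = {c}" using one by (rule card_1_singletonE)
  then have c: "\<kappa> e = c" if "e \<in> edges G" for e using that by blast
  obtain a b k where N: "nodes G = {a, b, k}" "a \<noteq> b" "a \<noteq> k" "b \<noteq> k" by (rule nodes_three)
  have Nc: "nodes (mono_subgraph G \<kappa> c) = nodes G"
  proof (rule Set.set_eqI)
    fix t
    have "\<exists>s\<in>nodes G. s \<noteq> t" unfolding N(1) using N(2) by auto
    then show "t \<in> nodes (mono_subgraph G \<kappa> c) \<longleftrightarrow> t \<in> nodes G"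
      unfolding mono_nodes_iff using c[OF the_edge(1)] by metis
  qed
  let ?lt = "node_less (part_order \<omega> c)"
  have "is_ordering (mono_subgraph G \<kappa> c) (part_order \<omega> c)"
    using \<omega> im unfolding valid_choices_def by blast
  note o = node_less_partition[OF this]
  have tot: "?lt s t \<or> ?lt t s" if "s \<in> nodes G" "t \<in> nodes G" "s \<noteq> t" for s t
    by (rule node_less_total) (use that o(2) Nc in simp_all)
  note tr = node_less_trans[OF o(1)]
  note goal = that
  have fin: thesis if xyz: "nodes G = {x, y, z}" "x \<noteq> y" "x \<noteq> z" "y \<noteq> z" "?lt x y" "?lt y z" for x y z
    by (rule goal[OF ballI[OF c] xyz(1-5) tr[OF xyz(5,6)] xyz(6) o(1)]) (use Nc xyz(1) in simp_all)
  have n: "a \<in> nodes G" "b \<in> nodes G" "k \<in> nodes G" using N by auto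
  consider "?lt a b" "?lt b k" | "?lt a k" "?lt k b" | "?lt b a" "?lt a k" | "?lt b k" "?lt k a"
    | "?lt k a" "?lt a b" | "?lt k b" "?lt b a"
    using tot[OF n(1,2) N(2)] tot[OF n(1,3) N(3)] tot[OF n(2,3) N(4)] by blast
  then show thesis
  proof cases
    case 1 show thesis by (rule fin[OF _ _ _ _ 1]) (use N in auto)
  next
    case 2 show thesis by (rule fin[OF _ _ _ _ 2]) (use N in auto)
  next
    case 3 show thesis by (rule fin[OF _ _ _ _ 3]) (use N in auto)
  next
    case 4 show thesis by (rule fin[OF _ _ _ _ 4]) (use N in auto)
  next
    case 5 show thesis by (rule fin[OF _ _ _ _ 5]) (use N in auto)
  next
    case 6 show thesis by (rule fin[OF _ _ _ _ 6]) (use N in auto)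
  qed
qed

text \<open>With one colour the moment map at a node is a component of the single factorisation;
  \<open>P\<close> stands for solvability and \<open>\<gamma>\<close> for the solution it
  forces.\<close>

lemma one_colour_moment_fibre_iff:
  assumes im: "\<And>e. e \<in> edges G \<Longrightarrow> \<kappa> e = c" and \<omega>: "valid_choices G \<kappa> \<omega>" and Nc: "nodes (mono_subgraph G \<kappa> c) = nodes G"
    and \<rho>: "\<rho> \<in> Rep G d" and q: "\<And>x. x \<in> nodes G \<Longrightarrow> q x \<noteq> 0"
    and uniq: "\<And>g. colour_factorises G \<kappa> \<omega> d \<rho> c g \<longleftrightarrow> P \<and> (\<forall>x\<in>nodes G. g x = \<gamma> x)"
    and \<gamma>: "\<And>x. P \<Longrightarrow> x \<in> nodes G \<Longrightarrow> \<gamma> x \<in> carrier_mat (d x) (d x)"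
  shows "\<rho> \<in> moment_fibre G \<kappa> \<omega> q d \<longleftrightarrow> P \<and> (\<forall>x\<in>nodes G. \<gamma> x = q x \<cdot>\<^sub>m 1\<^sub>m (d x))"
proof -
  have col: "\<kappa> ` edges G = {c}" using im card_edges by (auto simp: image_def) (metis card.empty ex_in_conv zero_neq_numeral)
  have ex: "(\<exists>g. colour_factorises G \<kappa> \<omega> d \<rho> c g) \<longleftrightarrow> P" using uniq by auto
  have mm: "moment_map G \<kappa> \<omega> d \<rho> x = \<gamma> x" if P and x: "x \<in> nodes G" for x
  proof (rule moment_map_single[OF \<omega> x])
    show "{k \<in> \<kappa> ` edges G. x \<in> nodes (mono_subgraph G \<kappa> k)} = {c}" using col Nc x by auto
    show "colour_moment G \<kappa> \<omega> d \<rho> c x = \<gamma> x"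
      by (rule colour_moment_eq) (use uniq ex x \<open>P\<close> in auto)
  qed (rule \<gamma>[OF \<open>P\<close> x])
  have "\<rho> \<in> moment_fibre G \<kappa> \<omega> q d \<longleftrightarrow> P \<and> (\<forall>x\<in>nodes G. moment_map G \<kappa> \<omega> d \<rho> x = q x \<cdot>\<^sub>m 1\<^sub>m (d x))"
    unfolding moment_fibre_def Rep_star_def col by (simp add: ex \<rho>)
  then show ?thesis using mm by (cases P) simp_all
qed

text \<open>The third moment equation follows from the other two because the product
  of the three components of the moment map is a determinant equal to one.\<close>

lemma one_colour_scalar_iff:
  assumes d: "\<And>x. x \<in> nodes G \<Longrightarrow> d x = 1" and adm: "admissible G q d"
    and im: "\<And>e. e \<in> edges G \<Longrightarrow> \<kappa> e = c" and \<omega>: "valid_choices G \<kappa> \<omega>"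
    and N: "nodes G = {x, y, z}" "x \<noteq> y" "x \<noteq> z" "y \<noteq> z"
    and lt: "node_less (part_order \<omega> c) x y" "node_less (part_order \<omega> c) x z" "node_less (part_order \<omega> c) y z"
    and dist: "distinct (concat (part_order \<omega> c))" and Nc: "nodes (mono_subgraph G \<kappa> c) = {x, y, z}"
  shows "scalar_rep v \<in> moment_fibre G \<kappa> \<omega> q d \<longleftrightarrow>
    v z x * v x z + v z y * v y z + 1 = q z \<and>
    (1 + v y x * v x y) * q z - (v y x * v x z + v y z) * (v z x * v x y + v z y) = q y * q z"
proof -
  have q0: "q x \<noteq> 0" "q y \<noteq> 0" "q z \<noteq> 0" and q1: "q x * (q y * q z) = 1"
    using adm d N unfolding admissible_def param_power_def by auto
  have dd: "d x = 1" "d y = 1" "d z = 1" using d N by auto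
  let ?\<rho> = "scalar_rep v" and ?lt = "node_less (part_order \<omega> c)"
  let ?V = "edge_map G \<kappa> d ?\<rho> c"
  let ?M = "tri_product {x, y, z} d ?lt ?V"
  have \<rho>: "?\<rho> \<in> Rep G d" by (rule scalar_rep_Rep[OF d])
  have V: "?V a b = scalar_mat (v a b)" if "a \<in> nodes G" "b \<in> nodes G" "a \<noteq> b" for a b
    using that im[OF the_edge(1)[OF that]] by (simp add: edge_map_eq arrow_scalar_rep)
  note as = node_less_asym(1)[OF dist]
  have lts: "?lt x y" "\<not> ?lt y x" "?lt x z" "\<not> ?lt z x" "?lt y z" "\<not> ?lt z y" using lt as by auto
  have Vc: "?V a b \<in> carrier_mat (d a) (d b)" if "a \<in> {x, y, z}" "b \<in> {x, y, z}" for a b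
    by (rule edge_map_carrier[OF \<rho>]) (use that N(1) in auto)
  have T: "?M a b = tri_part d (\<lambda>i j. ?lt j i) ?V a x * tri_part d ?lt ?V x b
      + (tri_part d (\<lambda>i j. ?lt j i) ?V a y * tri_part d ?lt ?V y b
      + tri_part d (\<lambda>i j. ?lt j i) ?V a z * tri_part d ?lt ?V z b)" if "a \<in> {x, y, z}" "b \<in> {x, y, z}" for a b
    by (rule tri_product_three[OF Vc N(2-4) that])
  have zero: "0\<^sub>m (Suc 0) (Suc 0) = scalar_mat 0" by (auto simp: scalar_mat_def)
  have tp: "tri_part d l ?V a b = scalar_mat (if a = b then 1 else if l a b then v a b else 0)"
    if "a \<in> {x, y, z}" "b \<in> {x, y, z}" for l a b
  proof -
    have ab: "a \<in> nodes G" "b \<in> nodes G" using that N(1) by auto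
    show ?thesis using V[OF ab] d[OF ab(1)] d[OF ab(2)] unfolding tri_part_def by (simp add: one_mat_scalar zero)
  qed
  have M: "?M x x = scalar_mat 1" "?M x y = scalar_mat (v x y)" "?M x z = scalar_mat (v x z)"
    "?M y x = scalar_mat (v y x)" "?M y y = scalar_mat (v y x * v x y + 1)" "?M y z = scalar_mat (v y x * v x z + v y z)"
    "?M z x = scalar_mat (v z x)" "?M z y = scalar_mat (v z x * v x y + v z y)"
    "?M z z = scalar_mat (v z x * v x z + (v z y * v y z + 1))"
    by (subst T; use lts N(2-) in \<open>simp add: tp\<close>)+
  let ?z = "v z x * v x z + (v z y * v y z + 1)"
  let ?S = "\<lambda>m1 m2 m3. m1 - m2 * (1 / ?z * m3)"
  let ?xx = "?S 1 (v x z) (v z x)" and ?xy = "?S (v x y) (v x z) (v z x * v x y + v z y)"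
    and ?yx = "?S (v y x) (v y x * v x z + v y z) (v z x)"
    and ?yy = "?S (v y x * v x y + 1) (v y x * v x z + v y z) (v z x * v x y + v z y)"
  have S: "schur z ?M x x = scalar_mat ?xx" "schur z ?M x y = scalar_mat ?xy"
    "schur z ?M y x = scalar_mat ?yx" "schur z ?M y y = scalar_mat ?yy" if "?z \<noteq> 0"
    unfolding schur_def M conjunct2[OF scalar_mat_inverse[OF that]] by simp_all
  let ?t = "?xx - ?xy * (1 / ?yy * ?yx)"
  have S2: "schur y (schur z ?M) x x = scalar_mat ?t" if "?z \<noteq> 0" "?yy \<noteq> 0"
    unfolding schur_def[of y "schur z ?M"] S[OF that(1)] conjunct2[OF scalar_mat_inverse[OF that(2)]] by simp
  have fac: "factorises {x, y, z} d ?lt ?M g \<longleftrightarrow> ?M z z \<in> GL (d z) \<and> g z = ?M z z \<and>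
    schur z ?M y y \<in> GL (d y) \<and> g y = schur z ?M y y \<and>
    schur y (schur z ?M) x x \<in> GL (d x) \<and> g x = schur y (schur z ?M) x x" for g
    using lts N by (intro factorises_three) simp_all
  have det: "?z * ?yy * ?t = 1" if "?z \<noteq> 0" "?yy \<noteq> 0"
    by (rule schur_determinant[OF refl that])
  define P where "P \<longleftrightarrow> ?z \<noteq> 0 \<and> ?yy \<noteq> 0"
  define \<gamma> where "\<gamma> a = scalar_mat (if a = z then ?z else if a = y then ?yy else ?t)" for a
  have "colour_factorises G \<kappa> \<omega> d ?\<rho> c g \<longleftrightarrow> P \<and> (\<forall>a\<in>nodes G. g a = \<gamma> a)" for g
  proof (cases P)
    case False
    then show ?thesis
      unfolding colour_factorises_def colour_product_def Let_def Nc fac M(9) dd scalar_mat_GL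
      using S(4) scalar_mat_GL unfolding P_def by metis
  next
    case True
    then have "?z \<noteq> 0" "?yy \<noteq> 0" unfolding P_def by auto
    note z = this
    have t0: "?t \<noteq> 0" using det[OF z] by (metis mult_zero_right zero_neq_one)
    show ?thesis
      unfolding colour_factorises_def colour_product_def Let_def Nc fac M(9) S(4)[OF z(1)] S2[OF z] dd scalar_mat_GL
        N(1) \<gamma>_def using z t0 N(2-) True by (simp only: ball_simps) auto
  qed
  then have "?\<rho> \<in> moment_fibre G \<kappa> \<omega> q d \<longleftrightarrow> P \<and> (\<forall>a\<in>nodes G. \<gamma> a = q a \<cdot>\<^sub>m 1\<^sub>m (d a))"
    by (intro one_colour_moment_fibre_iff[OF im \<omega> _ \<rho>])
       (use q0 N Nc dd in \<open>auto simp: \<gamma>_def\<close>)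
  also have "\<dots> \<longleftrightarrow> P \<and> ?z = q z \<and> ?yy = q y \<and> ?t = q x"
    unfolding N(1) \<gamma>_def using N(2-) dd by (auto simp: one_mat_scalar)
  also have "\<dots> \<longleftrightarrow> ?z = q z \<and> ?yy = q y"
  proof -
    have "P \<and> ?t = q x" if e: "?z = q z" "?yy = q y"
    proof -
      have key: "T = q x" if "Z * Y * T = 1" "Z = q z" "Y = q y" for Z Y T
      proof -
        have "q z * q y * T = q z * q y * q x" using that q1 by (simp add: ac_simps)
        then show ?thesis using q0 by simp
      qed
      have z: "?z \<noteq> 0" "?yy \<noteq> 0" using e q0 by metis+
      have "?t = q x" by (rule key[OF det[OF z] e])
      then show ?thesis using z unfolding P_def by blast
    qed
    then show ?thesis by blast
  qed
  also have "\<dots> \<longleftrightarrow> v z x * v x z + v z y * v y z + 1 = q z \<and>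
    (1 + v y x * v x y) * q z - (v y x * v x z + v y z) * (v z x * v x y + v z y) = q y * q z"
  proof -
    \<comment> \<open>Once the pivot at \<open>z\<close> equals \<open>q z\<close>, multiplying by
      it clears the denominator; this is the origin of the constant
      \<open>q y * q z\<close>.\<close>
    have "?yy = q y \<longleftrightarrow> (1 + v y x * v x y) * q z - (v y x * v x z + v y z) * (v z x * v x y + v z y) = q y * q z"
      if e: "?z = q z"
      unfolding e using q0(3) by (simp add: field_simps)
    then show ?thesis unfolding add.assoc by blast
  qed
  finally show ?thesis .
qed

end

text \<open>The class \<open>S\<close> is any class of functions containing the constants and closed
  under sums and products, so that polynomial and Laurent curves are handled alike.\<close>

lemma poly_functions_curve:
  assumes p: "p \<in> poly_functions G d"
    and S: "\<And>c. S (\<lambda>_. c)" "\<And>f g. S f \<Longrightarrow> S g \<Longrightarrow> S (\<lambda>t. f t + g t)" "\<And>f g. S f \<Longrightarrow> S g \<Longrightarrow> S (\<lambda>t. f t * g t)"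
    and \<gamma>: "\<And>e i j r s. (e, i, j) \<in> arcs G \<Longrightarrow> r < d i \<Longrightarrow> s < d j \<Longrightarrow> S (\<lambda>t. \<gamma> t (e, i, j) $$ (r, s))"
  shows "S (\<lambda>t. p (\<gamma> t))"
  using p by induction (use S \<gamma> in auto)

context triangle_graph
begin

text \<open>The dimension vectors of a single node and of two adjacent nodes have quadratic form 2,
  so genericity tests them.\<close>

lemma generic_ne_one:
  assumes d: "\<And>x. x \<in> nodes G \<Longrightarrow> d x = 1" and gen: "generic G q d"
    and N: "nodes G = {x, y, z}" "x \<noteq> y" "x \<noteq> z" "y \<noteq> z"
  shows "q x \<noteq> 1" "q x * q y \<noteq> 1"
proof -
  have ne: "num_edges G a b = (if a = b then 0 else 1)" if "a \<in> nodes G" "b \<in> nodes G" for a b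
  proof (cases "a = b")
    case True
    have "\<not> (e \<in> edges G \<and> ends G e = {a, b})" for e
      using triangle True unfolding triangle_def fin_graph_def by force
    then have "{e \<in> edges G. ends G e = {a, b}} = {}" by blast
    then show ?thesis using True unfolding num_edges_def by (metis card.empty)
  next
    case False
    then show ?thesis using triangle that unfolding triangle_def by simp
  qed
  have nes: "num_edges G x x = 0" "num_edges G x y = 1" "num_edges G x z = 1" "num_edges G y x = 1" "num_edges G y y = 0"
    "num_edges G y z = 1" "num_edges G z x = 1" "num_edges G z y = 1" "num_edges G z z = 0"
    using ne N by auto
  have qf: "quadratic_form G \<alpha> \<le> 2 \<Longrightarrow> \<forall>i\<in>nodes G. \<alpha> i \<le> 1 \<Longrightarrow> \<exists>i\<in>nodes G. \<alpha> i \<noteq> 0 \<Longrightarrow> \<exists>i\<in>nodes G. \<alpha> i \<noteq> 1 \<Longrightarrow> param_power G q \<alpha> \<noteq> 1"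
    for \<alpha> using gen d unfolding generic_def by auto
  have "param_power G q (\<lambda>i. if i = x then 1 else 0) \<noteq> 1"
    by (rule qf) (use N nes in \<open>auto simp: quadratic_form_def\<close>)
  then show "q x \<noteq> 1" using N by (simp add: param_power_def)
  have "param_power G q (\<lambda>i. if i = z then 0 else 1) \<noteq> 1"
    by (rule qf) (use N nes in \<open>auto simp: quadratic_form_def\<close>)
  then show "q x * q y \<noteq> 1" using N by (simp add: param_power_def)
qed

text \<open>Since \<open>f\<close> is a unit, the numerator of a fraction representing it has no
  zero on the fibre either. This makes \<open>f\<close>, written in the six coordinates, an instance
  of \<open>surface_unit\<close>.\<close>

proposition one_colour_units_const:
  assumes d: "\<And>x. x \<in> nodes G \<Longrightarrow> d x = 1" and gen: "generic G q d"
    and one: "card (\<kappa> ` edges G) = 1" and \<omega>: "valid_choices G \<kappa> \<omega>"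
    and f: "f \<in> invariant_ring G d (moment_fibre G \<kappa> \<omega> q d)"
    and g: "\<And>\<rho>. \<rho> \<in> moment_fibre G \<kappa> \<omega> q d \<Longrightarrow> f \<rho> * g \<rho> = 1"
  shows "\<exists>c. \<forall>\<rho>\<in>moment_fibre G \<kappa> \<omega> q d. f \<rho> = c"
proof -
  let ?X = "moment_fibre G \<kappa> \<omega> q d"
  have adm: "admissible G q d" using gen unfolding generic_def by blast
  obtain c x y z where im': "\<forall>e\<in>edges G. \<kappa> e = c"
    and N: "nodes G = {x, y, z}" "x \<noteq> y" "x \<noteq> z" "y \<noteq> z"
    and ord: "node_less (part_order \<omega> c) x y" "node_less (part_order \<omega> c) x z" "node_less (part_order \<omega> c) y z"
      "distinct (concat (part_order \<omega> c))" "nodes (mono_subgraph G \<kappa> c) = {x, y, z}"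
    by (rule one_colour_order[OF one \<omega>])
  have im: "\<kappa> e = c" if "e \<in> edges G" for e using im' that by blast
  have nodes: "x \<in> nodes G" "y \<in> nodes G" "z \<in> nodes G" using N by auto
  have iff: "scalar_rep v \<in> ?X \<longleftrightarrow> v z x * v x z + v z y * v y z + 1 = q z \<and>
      (1 + v y x * v x y) * q z - (v y x * v x z + v y z) * (v z x * v x y + v z y) = q y * q z" for v
    by (rule one_colour_scalar_iff[OF d adm im \<omega> N ord])
  define k where "k = q y * q z"
  have q0: "q y \<noteq> 0" "q z \<noteq> 0" using adm nodes unfolding admissible_def by auto
  \<comment> \<open>Permuting the names of the nodes yields all three inequalities for
    \<open>q\<close> from one lemma.\<close>
  have N1: "nodes G = {z, y, x}" "nodes G = {y, z, x}" using N(1) by auto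
  have "q z \<noteq> 1" by (rule generic_ne_one(1)[OF d gen N1(1)]) (use N in auto)
  moreover have "q y \<noteq> 1" "q y * q z \<noteq> 1" by (rule generic_ne_one[OF d gen N1(2)]; use N in auto)+
  ultimately have par: "k \<noteq> 0" "k \<noteq> 1" "q z \<noteq> 0" "q z \<noteq> 1" "k \<noteq> q z"
    using q0 unfolding k_def by auto
  \<comment> \<open>The inverse change of coordinates: \<open>v x z = a * b - m\<close> and
    \<open>v z y = w - a * M\<close>.\<close>
  define V where "V a A b w m M s t = (if s = x then if t = y then a else a * b - m
      else if s = y then if t = x then A else b else if t = x then M else w - a * M)"
    for a A b w m M :: complex and s t :: 'v
  define R where "R a A b w m M = scalar_rep (V a A b w m M)" for a A b w m M
  have RX: "R a A b w m M \<in> ?X \<longleftrightarrow> on_surface k (q z) a A b w m M" for a A b w m M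
  proof -
    have "R a A b w m M \<in> ?X \<longleftrightarrow> M * (a * b - m) + (w - a * M) * b + 1 = q z \<and>
        (1 + A * a) * q z - (A * (a * b - m) + b) * (M * a + (w - a * M)) = k"
      unfolding R_def iff k_def using N(2-) by (simp add: V_def)
    also have "M * (a * b - m) + (w - a * M) * b + 1 = b * w + (1 - m * M)" by (simp add: algebra_simps)
    also have "b * w + (1 - m * M) = q z \<and>
        (1 + A * a) * q z - (A * (a * b - m) + b) * (M * a + (w - a * M)) = k \<longleftrightarrow> on_surface k (q z) a A b w m M"
    proof -
      have "(1 + A * a) * q z - (A * (a * b - m) + b) * (M * a + (w - a * M)) = (1 + a * A) * (1 - m * M) + m * A * w"
        if e: "b * w + (1 - m * M) = q z" unfolding e[symmetric] by (simp add: algebra_simps)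
      then show ?thesis unfolding on_surface_def by auto
    qed
    finally show ?thesis .
  qed
  have surj: "\<exists>a A b w m M. \<rho> = R a A b w m M" if \<rho>: "\<rho> \<in> ?X" for \<rho>
  proof -
    have Rep: "\<rho> \<in> Rep G d" using \<rho> unfolding moment_fibre_def Rep_star_def by blast
    define v where "v s t = arrow G \<rho> s t $$ (0, 0)" for s t
    have "\<rho> = scalar_rep v" using Rep_scalar_rep[OF d Rep] unfolding v_def .
    also have "\<dots> = R (v x y) (v y x) (v y z) (v z y + v x y * v z x) (v x y * v y z - v x z) (v z x)"
      unfolding R_def by (rule scalar_rep_cong) (use N in \<open>auto simp: V_def\<close>)
    finally show ?thesis by blast
  qed
  obtain p h where ph: "p \<in> poly_functions G d" "h \<in> poly_functions G d" "\<forall>\<rho>\<in>?X. h \<rho> \<noteq> 0" "\<forall>\<rho>\<in>?X. f \<rho> = p \<rho> / h \<rho>"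
    using f unfolding invariant_ring_def coord_ring_iff regular_on_def by auto
  have f0: "f \<rho> \<noteq> 0" if "\<rho> \<in> ?X" for \<rho> using g[OF that] by auto
  have p0: "p \<rho> \<noteq> 0" if "\<rho> \<in> ?X" for \<rho> using f0[OF that] ph(4) that by auto
  have curve: "S (\<lambda>t. r (R (\<alpha> t) (\<alpha>' t) (\<beta> t) (\<eta> t) (\<gamma> t) (\<gamma>' t)))"
    if r: "r \<in> poly_functions G d"
      and S: "\<And>c. S (\<lambda>_. c)" "\<And>f g. S f \<Longrightarrow> S g \<Longrightarrow> S (\<lambda>t. f t + g t)" "\<And>f g. S f \<Longrightarrow> S g \<Longrightarrow> S (\<lambda>t. f t * g t)"
      and co: "S \<alpha>" "S \<alpha>'" "S \<beta>" "S \<eta>" "S \<gamma>" "S \<gamma>'" for S r \<alpha> \<alpha>' \<beta> \<eta> \<gamma> \<gamma>'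
  proof (rule poly_functions_curve[OF r S])
    fix e i j r' s' assume a: "(e, i, j) \<in> arcs G" and rs: "r' < d i" "s' < d j"
    have ij: "i \<in> nodes G" "j \<in> nodes G" "i \<noteq> j" "e = the_edge G i j" using a unfolding arcs_iff by auto
    have "r' = 0" "s' = 0" using rs d ij by auto
    then have "(\<lambda>t. R (\<alpha> t) (\<alpha>' t) (\<beta> t) (\<eta> t) (\<gamma> t) (\<gamma>' t) (e, i, j) $$ (r', s')) =
        (\<lambda>t. V (\<alpha> t) (\<alpha>' t) (\<beta> t) (\<eta> t) (\<gamma> t) (\<gamma>' t) i j)"
      unfolding R_def using arrow_scalar_rep[OF ij(1-3)] unfolding arrow_def ij(4) by simp
    moreover have neg: "S (\<lambda>t. f t - g t)" if "S f" "S g" for f g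
      using S(2)[OF that(1) S(3)[OF S(1)[of "-1"] that(2)]] by simp
    have "S (\<lambda>t. V (\<alpha> t) (\<alpha>' t) (\<beta> t) (\<eta> t) (\<gamma> t) (\<gamma>' t) i j)"
      using co neg[OF S(3)[OF co(1,3)] co(5)] neg[OF co(4) S(3)[OF co(1,6)]] unfolding V_def
      by (cases "i = x"; cases "j = y"; cases "i = y"; cases "j = x") simp_all
    ultimately show "S (\<lambda>t. R (\<alpha> t) (\<alpha>' t) (\<beta> t) (\<eta> t) (\<gamma> t) (\<gamma>' t) (e, i, j) $$ (r', s'))" by simp
  qed
  define F where "F a A b w m M = f (R a A b w m M)" for a A b w m M
  have "surface_unit k (q z) F"
  proof
    show "k \<noteq> 0" "k \<noteq> 1" "q z \<noteq> 0" "q z \<noteq> 1" "k \<noteq> q z" by (fact par)+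
    show "F a A b w m M \<noteq> 0" if "on_surface k (q z) a A b w m M" for a A b w m M
      unfolding F_def using f0 that RX by blast
    show "F (a * \<nu>) (A / \<nu>) (b * \<mu>) (w / \<mu>) (m * (\<nu> * \<mu>)) (M / (\<nu> * \<mu>)) = F a A b w m M"
      if nz: "\<nu> \<noteq> 0" "\<mu> \<noteq> 0" and on: "on_surface k (q z) a A b w m M" for \<nu> \<mu> a A b w m M
    proof -
      \<comment> \<open>The arrow from \<open>j\<close> to \<open>i\<close> scales by
        \<open>t i / t j\<close>; these values give \<open>a\<close>, \<open>b\<close> and
        \<open>m\<close> the weights \<open>\<nu>\<close>, \<open>\<mu>\<close> and
        \<open>\<nu> * \<mu>\<close>.\<close>
      define t where "t s = (if s = x then \<nu> * \<mu> else if s = y then \<mu> else 1)" for s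
      have t0: "t s \<noteq> 0" for s unfolding t_def using nz by simp
      let ?h = "\<lambda>s\<in>nodes G. scalar_mat (t s)"
      have "?h \<in> gauge_group G d"
        unfolding gauge_group_def using d scalar_mat_GL t0 by auto
      then have "f (gauge_act G ?h (R a A b w m M)) = f (R a A b w m M)"
        using f on RX unfolding invariant_ring_def by blast
      moreover have "gauge_act G ?h (R a A b w m M) = R (a * \<nu>) (A / \<nu>) (b * \<mu>) (w / \<mu>) (m * (\<nu> * \<mu>)) (M / (\<nu> * \<mu>))"
        unfolding R_def gauge_act_scalar_rep[of t, OF t0]
        by (rule scalar_rep_cong) (use N nz in \<open>auto simp: V_def t_def field_simps\<close>)
      ultimately show ?thesis unfolding F_def by simp
    qed
  next
    fix \<alpha> \<alpha>' \<beta> \<eta> \<gamma> \<gamma>' s t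
    assume pm: "polynomial_map \<alpha>" "polynomial_map \<alpha>'" "polynomial_map \<beta>" "polynomial_map \<eta>" "polynomial_map \<gamma>" "polynomial_map \<gamma>'"
      and on: "\<And>t. on_surface k (q z) (\<alpha> t) (\<alpha>' t) (\<beta> t) (\<eta> t) (\<gamma> t) (\<gamma>' t)"
    let ?R = "\<lambda>t. R (\<alpha> t) (\<alpha>' t) (\<beta> t) (\<eta> t) (\<gamma> t) (\<gamma>' t)"
    have X: "?R t \<in> ?X" for t using on RX by blast
    have P: "polynomial_map (\<lambda>t. r (?R t))" if "r \<in> poly_functions G d" for r
      by (rule curve[of r polynomial_map, OF that polynomial_map_const polynomial_map_add polynomial_map_mult pm])
    \<comment> \<open>Numerator and denominator may fail to be invariant, but each is a polynomial
      without zeros along the curve.\<close>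
    have "p (?R s) = p (?R t)"
      by (rule nonvanishing_polynomial_map_const[OF P[OF ph(1)]]) (rule p0[OF X])
    moreover have "h (?R s) = h (?R t)"
      by (rule nonvanishing_polynomial_map_const[OF P[OF ph(2)]]) (rule bspec[OF ph(3) X])
    ultimately show "F (\<alpha> s) (\<alpha>' s) (\<beta> s) (\<eta> s) (\<gamma> s) (\<gamma>' s) = F (\<alpha> t) (\<alpha>' t) (\<beta> t) (\<eta> t) (\<gamma> t) (\<gamma>' t)"
      unfolding F_def using X ph(4) by simp
  next
    fix \<alpha> \<alpha>' \<beta> \<eta> \<gamma> \<gamma>'
    assume lm: "laurent_map \<alpha>" "laurent_map \<alpha>'" "laurent_map \<beta>" "laurent_map \<eta>" "laurent_map \<gamma>" "laurent_map \<gamma>'"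
      and on: "\<And>t. t \<noteq> 0 \<Longrightarrow> on_surface k (q z) (\<alpha> t) (\<alpha>' t) (\<beta> t) (\<eta> t) (\<gamma> t) (\<gamma>' t)"
    let ?R = "\<lambda>t. R (\<alpha> t) (\<alpha>' t) (\<beta> t) (\<eta> t) (\<gamma> t) (\<gamma>' t)"
    have X: "?R t \<in> ?X" if "t \<noteq> 0" for t using on[OF that] RX by blast
    have L: "laurent_map (\<lambda>t. r (?R t))" if "r \<in> poly_functions G d" for r
      by (rule curve[of r laurent_map, OF that laurent_map_polynomial[OF polynomial_map_const] laurent_map_add
        laurent_map_mult lm])
    obtain c1 n1 where 1: "\<forall>t. t \<noteq> 0 \<longrightarrow> p (?R t) = c1 * t powi n1"
      using nonvanishing_laurent_map[OF L[OF ph(1)] p0[OF X]] by blast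
    obtain c2 n2 where 2: "\<forall>t. t \<noteq> 0 \<longrightarrow> h (?R t) = c2 * t powi n2"
      using nonvanishing_laurent_map[OF L[OF ph(2)] bspec[OF ph(3) X]] by blast
    have "F (\<alpha> t) (\<alpha>' t) (\<beta> t) (\<eta> t) (\<gamma> t) (\<gamma>' t) = (c1 / c2) * t powi (n1 - n2)" if t: "t \<noteq> 0" for t
      unfolding F_def using X[OF t] ph(4) 1 2 t by (simp add: power_int_diff)
    then show "\<exists>c n. \<forall>t. t \<noteq> 0 \<longrightarrow> F (\<alpha> t) (\<alpha>' t) (\<beta> t) (\<eta> t) (\<gamma> t) (\<gamma>' t) = c * t powi n" by blast
  qed
  then interpret surface_unit k "q z" F .
  show ?thesis
  proof (intro exI ballI)
    fix \<rho> assume \<rho>: "\<rho> \<in> ?X"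
    obtain a A b w m M where "\<rho> = R a A b w m M" using surj[OF \<rho>] by blast
    then show "f \<rho> = \<sigma> 1 0" using unit_const[of a A b w m M] \<rho> RX unfolding F_def by simp
  qed
qed

text \<open>The entry of \<open>1 + v x y * v y x\<close> separates the representations whose
  contributions at \<open>x\<close> from the edge \<open>xy\<close> are 1 and 2.\<close>

theorem one_three_colours_not_isomorphic:
  assumes d: "\<And>x. x \<in> nodes G \<Longrightarrow> d x = 1" and gen: "generic G q d"
    and three: "inj_on \<kappa> (edges G)" and one: "card (\<kappa>' ` edges G) = 1"
    and \<omega>: "valid_choices G \<kappa> \<omega>" "valid_choices G \<kappa>' \<omega>'"
  shows "\<not> variety_isomorphic (quiver_variety G \<kappa> \<omega> q d) (quiver_variety G \<kappa>' \<omega>' q d)"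
proof -
  have adm: "admissible G q d" using gen unfolding generic_def by blast
  then have "q x \<noteq> 0" if "x \<in> nodes G" for x using that unfolding admissible_def by blast
  then have X: "moment_fibre G \<kappa> \<omega> q d = edge_fibre G (colour_less \<kappa> \<omega>) q d"
    by (rule moment_fibre_three_colours[OF three \<omega>(1)])
  obtain x y z where N: "nodes G = {x, y, z}" "x \<noteq> y" "x \<noteq> z" "y \<noteq> z" by (rule nodes_three)
  let ?X = "edge_fibre G (colour_less \<kappa> \<omega>) q d"
  let ?u = "\<lambda>\<rho>. one_plus d (arrow G \<rho>) x y $$ (0, 0)"
  have n: "x \<in> nodes G" "y \<in> nodes G" using N by auto
  have u: "restrict ?u ?X \<in> invariant_ring G d ?X" "restrict (\<lambda>\<rho>. 1 / ?u \<rho>) ?X \<in> invariant_ring G d ?X"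
    by (rule three_colour_unit(1,2)[where d = d, OF d n N(2)], assumption)+
  have u0: "?u \<rho> \<noteq> 0" if "\<rho> \<in> ?X" for \<rho>
    by (rule three_colour_unit(3)[where d = d, OF d n N(2) that])
  have pt: "\<exists>\<rho>\<in>?X. ?u \<rho> = (if colour_less \<kappa> \<omega> x y then 1 / t else t)" if "t \<noteq> 0" for t
    by (rule three_colour_points[OF _ adm _ N that]) (rule d, assumption, rule colour_less_iff[OF \<omega>(1)])
  obtain \<rho>1 where \<rho>1: "\<rho>1 \<in> ?X" "?u \<rho>1 = (if colour_less \<kappa> \<omega> x y then 1 / 1 else 1)" using pt[of 1] by auto
  obtain \<rho>2 where \<rho>2: "\<rho>2 \<in> ?X" "?u \<rho>2 = (if colour_less \<kappa> \<omega> x y then 1 / 2 else 2)" using pt[of 2] by auto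
  have ne: "?u \<rho>1 \<noteq> ?u \<rho>2" unfolding \<rho>1(2) \<rho>2(2) by simp
  show ?thesis unfolding quiver_variety_def X
  proof (rule git_quotient_not_isomorphic[OF gauge_stable_edge_fibre u(1,2) _ \<rho>1(1) \<rho>2(1)])
    show "restrict ?u ?X \<rho> * restrict (\<lambda>\<rho>. 1 / ?u \<rho>) ?X \<rho> = 1" if "\<rho> \<in> ?X" for \<rho>
      using u0[OF that] that by (simp only: restrict_apply if_True) simp
    show "restrict ?u ?X \<rho>1 \<noteq> restrict ?u ?X \<rho>2" using ne \<rho>1(1) \<rho>2(1) by (simp only: restrict_apply if_True) simp
    show "\<exists>c. \<forall>\<rho>\<in>moment_fibre G \<kappa>' \<omega>' q d. f \<rho> = c"
      if "f \<in> invariant_ring G d (moment_fibre G \<kappa>' \<omega>' q d)"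
        "\<And>\<rho>. \<rho> \<in> moment_fibre G \<kappa>' \<omega>' q d \<Longrightarrow> f \<rho> * g \<rho> = 1" for f g
      by (rule one_colour_units_const[OF d gen one \<omega>(2) that])
  qed
qed

lemma generic_exists: "\<exists>q. generic G q (\<lambda>_. 1)"
proof -
  obtain x y z where N: "nodes G = {x, y, z}" "x \<noteq> y" "x \<noteq> z" "y \<noteq> z" by (rule nodes_three)
  \<comment> \<open>The numbers 2, 3 and 1/6 have product 1, and no product over a proper nonempty
    subset of them is 1.\<close>
  define q :: "'v \<Rightarrow> complex" where "q s = (if s = x then 2 else if s = y then 3 else 1 / 6)" for s
  have pp: "param_power G q \<alpha> = 2 ^ \<alpha> x * (3 ^ \<alpha> y * (1 / 6) ^ \<alpha> z)" for \<alpha>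
    unfolding param_power_def N(1) using N(2-) by (simp add: q_def)
  have "param_power G q \<alpha> \<noteq> 1"
    if "\<forall>i\<in>nodes G. \<alpha> i \<le> 1" "\<exists>i\<in>nodes G. \<alpha> i \<noteq> 0" "\<exists>i\<in>nodes G. \<alpha> i \<noteq> 1" for \<alpha>
  proof -
    have "\<alpha> x \<in> {0, 1}" "\<alpha> y \<in> {0, 1}" "\<alpha> z \<in> {0, 1}" using that(1) unfolding N(1) by auto
    then show ?thesis using that(2,3) unfolding pp N(1) by auto
  qed
  then have "generic G q (\<lambda>_. 1)"
    unfolding generic_def admissible_def pp using N by (auto simp: q_def)
  then show ?thesis by blast
qed

end

theorem proposition1p2:
  fixes G :: "('v, 'e) graph"
  assumes "triangle G"
    and "infinite (UNIV :: 'c set)"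
  shows
    "card ((colourings G :: ('e \<Rightarrow> 'c) set) // colouring_equiv G) = 2 \<and>
     (\<forall>(\<kappa> :: 'e \<Rightarrow> 'c) (\<kappa>' :: 'e \<Rightarrow> 'c). card (\<kappa> ` edges G) = 3 \<and> card (\<kappa>' ` edges G) = 1 \<longrightarrow>
        \<kappa> \<in> colourings G \<and> \<kappa>' \<in> colourings G \<and> (\<kappa>, \<kappa>') \<notin> colouring_equiv G) \<and>
     (\<forall>(\<kappa> :: 'e \<Rightarrow> 'c) (\<kappa>' :: 'e \<Rightarrow> 'c). card (\<kappa> ` edges G) = 2 \<and> card (\<kappa>' ` edges G) = 3 \<longrightarrow>
        (\<kappa>, \<kappa>') \<in> colouring_equiv G \<and>
        (\<forall>\<omega> \<omega>' q d. valid_choices G \<kappa> \<omega> \<and> valid_choices G \<kappa>' \<omega>' \<and> admissible G q d \<longrightarrow>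
           variety_isomorphic (quiver_variety G \<kappa> \<omega> q d) (quiver_variety G \<kappa>' \<omega>' q d))) \<and>
     (\<exists>q d. admissible G q d \<and>
        (\<forall>(\<kappa> :: 'e \<Rightarrow> 'c) (\<kappa>' :: 'e \<Rightarrow> 'c) \<omega> \<omega>'. card (\<kappa> ` edges G) = 3 \<and> card (\<kappa>' ` edges G) = 1 \<and>
           valid_choices G \<kappa> \<omega> \<and> valid_choices G \<kappa>' \<omega>' \<longrightarrow>
           \<not> variety_isomorphic (quiver_variety G \<kappa> \<omega> q d) (quiver_variety G \<kappa>' \<omega>' q d))) \<and>
     (\<forall>q d. (\<forall>i\<in>nodes G. d i = 1) \<and> generic G q d \<longrightarrow>
        (\<forall>(\<kappa> :: 'e \<Rightarrow> 'c) (\<kappa>' :: 'e \<Rightarrow> 'c) \<omega> \<omega>'. card (\<kappa> ` edges G) = 3 \<and> card (\<kappa>' ` edges G) = 1 \<and>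
           valid_choices G \<kappa> \<omega> \<and> valid_choices G \<kappa>' \<omega>' \<longrightarrow>
           \<not> variety_isomorphic (quiver_variety G \<kappa> \<omega> q d) (quiver_variety G \<kappa>' \<omega>' q d)))"
proof -
  interpret triangle_graph G by unfold_locales (fact assms(1))
  have three: "inj_on \<kappa> (edges G)" if "card (\<kappa> ` edges G) = 3" for \<kappa> :: "'e \<Rightarrow> 'c"
    by (rule three_colours_inj_on[OF that])
  have noniso: "\<not> variety_isomorphic (quiver_variety G \<kappa> \<omega> q d) (quiver_variety G \<kappa>' \<omega>' q d)"
    if "\<forall>i\<in>nodes G. d i = 1" "generic G q d" "card (\<kappa> ` edges G) = 3" "card (\<kappa>' ` edges G) = 1"
      "valid_choices G \<kappa> \<omega>" "valid_choices G \<kappa>' \<omega>'" for q d \<omega> \<omega>' and \<kappa> \<kappa>' :: "'e \<Rightarrow> 'c"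
    by (rule one_three_colours_not_isomorphic) (use that three in auto)
  have iso: "variety_isomorphic (quiver_variety G \<kappa> \<omega> q d) (quiver_variety G \<kappa>' \<omega>' q d)"
    if "card (\<kappa> ` edges G) = 2" "card (\<kappa>' ` edges G) = 3"
      "valid_choices G \<kappa> \<omega>" "valid_choices G \<kappa>' \<omega>'" "admissible G q d" for q d \<omega> \<omega>' and \<kappa> \<kappa>' :: "'e \<Rightarrow> 'c"
    by (rule two_three_colours_isomorphic[OF that(1) three[OF that(2)] that(3-5)])
  \<comment> \<open>A generic \<open>q\<close> for the dimension vector one witnesses that the
    varieties differ in general.\<close>
  obtain q where q: "generic G q (\<lambda>_. 1)" using generic_exists by blast
  show ?thesis
  proof (intro conjI allI impI)
    show "card ((colourings G :: ('e \<Rightarrow> 'c) set) // colouring_equiv G) = 2"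
      by (rule card_colouring_classes[OF assms(2)])
    show "\<exists>q d. admissible G q d \<and>
        (\<forall>(\<kappa> :: 'e \<Rightarrow> 'c) (\<kappa>' :: 'e \<Rightarrow> 'c) \<omega> \<omega>'. card (\<kappa> ` edges G) = 3 \<and> card (\<kappa>' ` edges G) = 1 \<and>
           valid_choices G \<kappa> \<omega> \<and> valid_choices G \<kappa>' \<omega>' \<longrightarrow>
           \<not> variety_isomorphic (quiver_variety G \<kappa> \<omega> q d) (quiver_variety G \<kappa>' \<omega>' q d))"
      by (intro exI[of _ q] exI[of _ "\<lambda>_. 1"] conjI allI impI)
         (use q noniso[OF _ q] in \<open>auto simp: generic_def\<close>)
  qed (use noniso iso in \<open>auto simp: colourings_UNIV colouring_equiv_iff[OF assms(2)]\<close>)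
qed

end
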